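(* Let $\{(x_k,\eta_k)\}$, $\eta_k=(\mu_k,\lambda_k)\in\mathbb R^{m+n}$, be a sequence generated by RSQO and let $(x^*,\eta^* )$, $\eta^*=(\mu^*,\lambda^* )$, be an accumulation point of it. Assume: (A1) the quadratic subproblem $\mathrm{QP}_k$ is feasible at every iteration $k$; (A2) there exist constants $m_0>0$, $M_0>0$ such that, for every $k$, $m_0\|\xi\|^2\le\langle B_k[\xi],\xi\rangle\le M_0\|\xi\|^2$ for all $\xi\in T_{x_k}\mathcal M$; (A3) the sequence $\{(x_k,\mu_k,\lambda_k)\}$ is bounded; (B1) $(x^*,\eta^* )$ satisfies the LICQ, the SOSCs and the SC; (B2) $f$, $g_i$ ($i\in\mathcal I_a(x^* )$) and $h_j$ ($j\in\mathcal E$) are of class $C^3$; and there is $K_0$ such that for all $k\ge K_0$: (B3) $B_k=\operatorname{Hess}\mathcal L_{\eta_k}(x_k)$; (B4) the step length of unity is accepted, i.e. $\alpha_k=1$. Then the whole sequence $\{(x_k,\eta_k)\}$ converges to $(x^*,\eta^* )$ quadratically.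
   Context: Let $\mathcal M$ be a connected, complete, $d$-dimensional Riemannian manifold with metric $\langle\cdot,\cdot\rangle_x$ on the tangent space $T_x\mathcal M$, induced norm $\|\cdot\|_x$ (subscripts are often omitted), and Riemannian gradient $\operatorname{grad}$. The Riemannian Hessian of $\theta$ is $\operatorname{Hess}\theta(x)[\xi]=\nabla_\xi\operatorname{grad}\theta$ with $\nabla$ the Levi-Civita connection. Let $\mathcal I=\{1,\dots,m\}$, $\mathcal E=\{1,\dots,n\}$ and let $f,g_i,h_j:\mathcal M\to\mathbb R$ ($i\in\mathcal I$, $j\in\mathcal E$) be twice continuously differentiable. RNLO is the problem: minimize $f(x)$ over $x\in\mathcal M$ subject to $g_i(x)\le0$ ($i\in\mathcal I$), $h_j(x)=0$ ($j\in\mathcal E$). A retraction is a smooth map $R:T\mathcal M\to\mathcal M$ whose restrictions $R_x$ to $T_x\mathcal M$ satisfy $R_x(0_x)=x$ and $\mathrm DR_x(0_x)=\mathrm{id}_{T_x\mathcal M}$ (identifying $T_{0_x}(T_x\mathcal M)\simeq T_x\mathcal M$). For $\rho>0$ put $P_\rho(x)=f(x)+\rho\big(\sum_{i\in\mathcal I}\max\{0,g_i(x)\}+\sum_{j\in\mathcal E}|h_j(x)|\big)$. RSQO (Riemannian sequential quadratic optimization): parameters $\varepsilon>0$, $\rho_{-1}>0$, $\beta\in(0,1)$, $\gamma\in(0,1)$, a retraction $R$, an initial point $x_0\in\mathcal M$ and initial vectors $\mu_0\in\mathbb R^m,\lambda_0\in\mathbb R^n$ (arbitrary). At each iteration $k=0,1,\dots$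 a linear operator $B_k:T_{x_k}\mathcal M\to T_{x_k}\mathcal M$ is given, symmetric and positive-definite. (1) Let $\Delta x_k^*$ be the solution, with Lagrange multipliers $\mu_k^*\in\mathbb R^m$ and $\lambda_k^*\in\mathbb R^n$ for the inequality and equality constraints (so that the KKT conditions hold), of the subproblem $\mathrm{QP}_k$: minimize $\tfrac12\langle B_k[\Delta x],\Delta x\rangle+\langle\operatorname{grad} f(x_k),\Delta x\rangle$ over $\Delta x\in T_{x_k}\mathcal M$ subject to $g_i(x_k)+\langle\operatorname{grad} g_i(x_k),\Delta x\rangle\le0$ ($i\in\mathcal I$) and $h_j(x_k)+\langle\operatorname{grad} h_j(x_k),\Delta x\rangle=0$ ($j\in\mathcal E$). (2) With $\upsilon_k=\max\{\max_{i}\mu_{ki}^*,\max_j|\lambda_{kj}^*|\}$, set $\rho_k=\rho_{k-1}$ if $\rho_{k-1}\ge\upsilon_k$, and $\rho_k=\upsilon_k+\varepsilon$ otherwise. (3) Let $r$ be the smallest nonnegative integer with $\gamma\beta^r\langle B_k[\Delta x_k^*],\Delta x_k^*\rangle\le P_{\rho_k}(x_k)-P_{\rho_k}(R_{x_k}(\beta^r\Delta x_k^* ))$, and set $\alpha_k=\beta^r$. (4) Set $x_{k+1}=R_{x_k}(\alpha_k\Delta x_k^* )$, $\mu_{k+1}=\mu_k^*$, $\lambda_{k+1}=\lambda_k^*$. Boundedness on $\mathcal M$ is with respect to the Riemannian distance. Definitions. For $\eta=(\mu,\lambda)$, $\mathcal L_\eta(x)=f(x)+\sum_{i\in\mathcal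 I}\mu_ig_i(x)+\sum_{j\in\mathcal E}\lambda_jh_j(x)$. For a feasible $x$, $\mathcal I_a(x)=\{i\in\mathcal I: g_i(x)=0\}$. LICQ at $x^*$: $\{\operatorname{grad} g_i(x^* ),\operatorname{grad} h_j(x^* )\}_{i\in\mathcal I_a(x^* ),j\in\mathcal E}$ are linearly independent in $T_{x^*}\mathcal M$. KKT conditions at $x^*$ with multipliers $\mu^*,\lambda^*$: $\operatorname{grad}\mathcal L_{\eta^*}(x^* )=0$; $\mu_i^*\ge0$, $g_i(x^* )\le0$, $\mu_i^*g_i(x^* )=0$ for all $i\in\mathcal I$; $h_j(x^* )=0$ for all $j\in\mathcal E$. SOSCs: the KKT conditions hold at $x^*$ with multipliers $\mu^*,\lambda^*$, and $\langle\operatorname{Hess}\mathcal L_{\eta^*}(x^* )[\xi],\xi\rangle>0$ for every nonzero $\xi\in T_{x^*}\mathcal M$ satisfying $\langle\xi,\operatorname{grad} h_j(x^* )\rangle=0$ for all $j\in\mathcal E$, $\langle\xi,\operatorname{grad} g_i(x^* )\rangle=0$ for all $i\in\mathcal I_a(x^* )$ with $\mu_i^*>0$, and $\langle\xi,\operatorname{grad} g_i(x^* )\rangle\le0$ for all $i\in\mathcal I_a(x^* )$ with $\mu_i^*=0$. SC (strict complementarity): for each $i\in\mathcal I$ exactly one of $\mu_i^*$ and $g_i(x^* )$ is zero. Quadratic convergence: a sequence $\{(x_k,\eta_k)\}$ in $\mathcal M\times\mathbb R^{m+n}$ converging to $(x^*,\eta^* )$ converges quadratically if, for a chart $(\mathcal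 U,\varphi)$ of $\mathcal M$ containing $x^*$, there is a constant $c\ge0$ such that for all sufficiently large $k$, $\left\|(\varphi(x_{k+1})-\varphi(x^* ),\,\eta_{k+1}-\eta^* )\right\|\le c\left\|(\varphi(x_k)-\varphi(x^* ),\,\eta_k-\eta^* )\right\|^2$ (Euclidean norm on $\mathbb R^{d+m+n}$). *)

theory Defs
  imports "HOL-Analysis.Analysis"
begin

section \<open>Functions of class C^k on open subsets of normed spaces\<close>

text \<open>Intended for open sets \<open>S\<close> and finite-dimensional domains, where continuity of all iterated
  directional derivatives of a differentiable map is continuity of the derivatives.\<close>

primrec Ck_on ::
  "nat \<Rightarrow> ('a::real_normed_vector \<Rightarrow> 'b::real_normed_vector) \<Rightarrow> 'a set \<Rightarrow> bool" where
  "Ck_on 0 f S \<longleftrightarrow> continuous_on S f"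
| "Ck_on (Suc k) f S \<longleftrightarrow>
     (\<forall>x\<in>S. f differentiable (at x)) \<and> (\<forall>v. Ck_on k (\<lambda>x. frechet_derivative f (at x) v) S)"

definition smooth_on ::
  "('a::real_normed_vector \<Rightarrow> 'b::real_normed_vector) \<Rightarrow> 'a set \<Rightarrow> bool" where
  "smooth_on f S \<longleftrightarrow> (\<forall>k. Ck_on k f S)"


section \<open>Smooth manifolds\<close>

text \<open>The points of the manifold are all elements of a Hausdorff, second countable type; charts take
  values in a Euclidean space \<open>'e\<close>, so the dimension is \<open>DIM('e)\<close>.  A chart \<open>(U, \<phi>)\<close> consists of its
  domain and the coordinate map; \<open>\<phi>\<close> is unspecified outside \<open>U\<close>.\<close>

type_synonym ('p, 'e) chart = "'p set \<times> ('p \<Rightarrow> 'e)"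

definition chart_inv :: "('p, 'e) chart \<Rightarrow> 'e \<Rightarrow> 'p" where
  "chart_inv c = inv_into (fst c) (snd c)"

definition smooth_atlas ::
  "('p::{t2_space,second_countable_topology}, 'e::euclidean_space) chart set \<Rightarrow> bool" where
  "smooth_atlas A \<longleftrightarrow>
     (\<forall>c\<in>A. open (fst c) \<and> open (snd c ` fst c) \<and>
        homeomorphism (fst c) (snd c ` fst c) (snd c) (chart_inv c)) \<and>
     (\<Union>c\<in>A. fst c) = UNIV \<and>
     (\<forall>c\<in>A. \<forall>c'\<in>A. smooth_on (snd c' \<circ> chart_inv c) (snd c ` (fst c \<inter> fst c')))"

definition Ck_fun ::
  "('p, 'e::euclidean_space) chart set \<Rightarrow> nat \<Rightarrow> ('p \<Rightarrow> real) \<Rightarrow> bool" where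
  "Ck_fun A k \<theta> \<longleftrightarrow> (\<forall>c\<in>A. Ck_on k (\<theta> \<circ> chart_inv c) (snd c ` fst c))"

text \<open>Each tangent space is the vector space \<open>'e\<close>: a chart around \<open>x\<close> is chosen once and for all, and
  a tangent vector at \<open>x\<close> is identified with its coordinates in that chart.  The identification need
  not depend continuously on \<open>x\<close>; regularity of tensors is therefore always expressed through their
  components in the charts of the atlas, obtained with \<open>to_coord\<close> and \<open>from_coord\<close>, the differentials
  of the transition maps.  Vector fields have type \<open>'p \<Rightarrow> 'e\<close>.\<close>

definition chart_at :: "('p, 'e) chart set \<Rightarrow> 'p \<Rightarrow> ('p, 'e) chart" where
  "chart_at A x = (SOME c. c \<in> A \<and> x \<in> fst c)"

definition to_coord ::
  "('p, 'e::euclidean_space) chart set \<Rightarrow> ('p, 'e) chart \<Rightarrow> 'p \<Rightarrow> 'e \<Rightarrow> 'e" where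
  "to_coord A c x =
     frechet_derivative (snd c \<circ> chart_inv (chart_at A x)) (at (snd (chart_at A x) x))"

definition from_coord ::
  "('p, 'e::euclidean_space) chart set \<Rightarrow> ('p, 'e) chart \<Rightarrow> 'p \<Rightarrow> 'e \<Rightarrow> 'e" where
  "from_coord A c x = frechet_derivative (snd (chart_at A x) \<circ> chart_inv c) (at (snd c x))"

definition differential ::
  "('p, 'e::euclidean_space) chart set \<Rightarrow> ('p \<Rightarrow> real) \<Rightarrow> 'p \<Rightarrow> 'e \<Rightarrow> real" where
  "differential A \<theta> x =
     frechet_derivative (\<theta> \<circ> chart_inv (chart_at A x)) (at (snd (chart_at A x) x))"

definition Ck_field ::
  "('p, 'e::euclidean_space) chart set \<Rightarrow> nat \<Rightarrow> ('p \<Rightarrow> 'e) \<Rightarrow> bool" where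
  "Ck_field A k V \<longleftrightarrow>
     (\<forall>c\<in>A. Ck_on k (\<lambda>y. to_coord A c (chart_inv c y) (V (chart_inv c y))) (snd c ` fst c))"


section \<open>Riemannian metric and distance\<close>

definition riemannian_metric ::
  "('p, 'e::euclidean_space) chart set \<Rightarrow> ('p \<Rightarrow> 'e \<Rightarrow> 'e \<Rightarrow> real) \<Rightarrow> bool" where
  "riemannian_metric A met \<longleftrightarrow>
     (\<forall>x. bilinear (met x) \<and> (\<forall>u v. met x u v = met x v u) \<and> (\<forall>u. u \<noteq> 0 \<longrightarrow> met x u u > 0)) \<and>
     (\<forall>c\<in>A. \<forall>u v. smooth_on
        (\<lambda>y. met (chart_inv c y) (from_coord A c (chart_inv c y) u) (from_coord A c (chart_inv c y) v))
        (snd c ` fst c))"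

definition tnorm :: "('p \<Rightarrow> 'e \<Rightarrow> 'e \<Rightarrow> real) \<Rightarrow> 'p \<Rightarrow> 'e \<Rightarrow> real" where
  "tnorm met x u = sqrt (met x u u)"

definition speed ::
  "('p, 'e::euclidean_space) chart set \<Rightarrow> ('p \<Rightarrow> 'e \<Rightarrow> 'e \<Rightarrow> real) \<Rightarrow> (real \<Rightarrow> 'p) \<Rightarrow> real \<Rightarrow> real" where
  "speed A met \<gamma> t =
     tnorm met (\<gamma> t) (vector_derivative (snd (chart_at A (\<gamma> t)) \<circ> \<gamma>) (at t))"

text \<open>Piecewise C^1 curves of finite length.  Without integrability of the speed a curve of infinite
  length would be assigned the integral 0.\<close>

definition admissible_curve ::
  "('p::topological_space, 'e::euclidean_space) chart set \<Rightarrow> ('p \<Rightarrow> 'e \<Rightarrow> 'e \<Rightarrow> real)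
    \<Rightarrow> (real \<Rightarrow> 'p) \<Rightarrow> bool" where
  "admissible_curve A met \<gamma> \<longleftrightarrow>
     continuous_on {0..1} \<gamma> \<and>
     (\<exists>S. finite S \<and> (\<forall>c\<in>A. Ck_on 1 (snd c \<circ> \<gamma>) {t \<in> {0<..<1} - S. \<gamma> t \<in> fst c})) \<and>
     speed A met \<gamma> integrable_on {0..1}"

definition riem_dist ::
  "('p::topological_space, 'e::euclidean_space) chart set \<Rightarrow> ('p \<Rightarrow> 'e \<Rightarrow> 'e \<Rightarrow> real)
    \<Rightarrow> 'p \<Rightarrow> 'p \<Rightarrow> real" where
  "riem_dist A met x y =
     Inf {integral {0..1} (speed A met \<gamma>) | \<gamma>. admissible_curve A met \<gamma> \<and> \<gamma> 0 = x \<and> \<gamma> 1 = y}"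

definition connected_complete_riemannian_manifold ::
  "('p::{t2_space,second_countable_topology}, 'e::euclidean_space) chart set
    \<Rightarrow> ('p \<Rightarrow> 'e \<Rightarrow> 'e \<Rightarrow> real) \<Rightarrow> bool" where
  "connected_complete_riemannian_manifold A met \<longleftrightarrow>
     smooth_atlas A \<and> riemannian_metric A met \<and>
     connected (UNIV :: 'p set) \<and> Metric_space.mcomplete UNIV (riem_dist A met)"


section \<open>Gradient, Levi-Civita connection, Hessian, retraction\<close>

definition grad ::
  "('p, 'e::euclidean_space) chart set \<Rightarrow> ('p \<Rightarrow> 'e \<Rightarrow> 'e \<Rightarrow> real) \<Rightarrow> ('p \<Rightarrow> real) \<Rightarrow> 'p \<Rightarrow> 'e" where
  "grad A met \<theta> x = (THE v. \<forall>\<xi>. met x v \<xi> = differential A \<theta> x \<xi>)"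

text \<open>\<open>nab x \<xi> V\<close> is the covariant derivative at \<open>x\<close> of the field \<open>V\<close> in the direction \<open>\<xi>\<close>.  The
  connection acts on C^1 fields, since the gradient of a C^2 function is only C^1.  In the last
  condition the Lie bracket \<open>[V,W]\<close> acts on functions as the commutator \<open>V W - W V\<close>.\<close>

definition levi_civita ::
  "('p, 'e::euclidean_space) chart set \<Rightarrow> ('p \<Rightarrow> 'e \<Rightarrow> 'e \<Rightarrow> real)
    \<Rightarrow> ('p \<Rightarrow> 'e \<Rightarrow> ('p \<Rightarrow> 'e) \<Rightarrow> 'e) \<Rightarrow> bool" where
  "levi_civita A met nab \<longleftrightarrow>
     (\<forall>x V. Ck_field A 1 V \<longrightarrow> linear (\<lambda>\<xi>. nab x \<xi> V)) \<and>
     (\<forall>x \<xi> V W. Ck_field A 1 V \<longrightarrow> Ck_field A 1 W \<longrightarrow>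
        nab x \<xi> (\<lambda>y. V y + W y) = nab x \<xi> V + nab x \<xi> W) \<and>
     (\<forall>x \<xi> \<theta> V. Ck_fun A 1 \<theta> \<longrightarrow> Ck_field A 1 V \<longrightarrow>
        nab x \<xi> (\<lambda>y. \<theta> y *\<^sub>R V y) = differential A \<theta> x \<xi> *\<^sub>R V x + \<theta> x *\<^sub>R nab x \<xi> V) \<and>
     (\<forall>x \<xi> V W. Ck_field A 1 V \<longrightarrow> Ck_field A 1 W \<longrightarrow>
        differential A (\<lambda>y. met y (V y) (W y)) x \<xi> =
          met x (nab x \<xi> V) (W x) + met x (V x) (nab x \<xi> W)) \<and>
     (\<forall>x V W \<theta>. Ck_field A 1 V \<longrightarrow> Ck_field A 1 W \<longrightarrow> Ck_fun A 2 \<theta> \<longrightarrow>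
        differential A \<theta> x (nab x (V x) W - nab x (W x) V) =
          differential A (\<lambda>y. differential A \<theta> y (W y)) x (V x) -
          differential A (\<lambda>y. differential A \<theta> y (V y)) x (W x))"

definition Hess ::
  "('p, 'e::euclidean_space) chart set \<Rightarrow> ('p \<Rightarrow> 'e \<Rightarrow> 'e \<Rightarrow> real)
    \<Rightarrow> ('p \<Rightarrow> 'e \<Rightarrow> ('p \<Rightarrow> 'e) \<Rightarrow> 'e) \<Rightarrow> ('p \<Rightarrow> real) \<Rightarrow> 'p \<Rightarrow> 'e \<Rightarrow> 'e" where
  "Hess A met nab \<theta> x \<xi> = nab x \<xi> (grad A met \<theta>)"

text \<open>The first condition is smoothness on the tangent bundle, whose charts are
  \<open>(x, v) \<mapsto> (\<phi> x, to_coord A (U, \<phi>) x v)\<close> for the charts \<open>(U, \<phi>)\<close> of \<open>A\<close>; openness of the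
  preimages is continuity.\<close>

definition riem_retraction ::
  "('p, 'e::euclidean_space) chart set \<Rightarrow> ('p \<Rightarrow> 'e \<Rightarrow> 'p) \<Rightarrow> bool" where
  "riem_retraction A R \<longleftrightarrow>
     (\<forall>c\<in>A. \<forall>c'\<in>A.
        let F = (\<lambda>(y, w). R (chart_inv c y) (from_coord A c (chart_inv c y) w));
            D = {(y, w). y \<in> snd c ` fst c \<and> F (y, w) \<in> fst c'}
        in open D \<and> smooth_on (snd c' \<circ> F) D) \<and>
     (\<forall>x. R x 0 = x) \<and>
     (\<forall>x. ((snd (chart_at A x) \<circ> R x) has_derivative id) (at 0))"


section \<open>Nonlinear optimization on a manifold\<close>

text \<open>Constraints are indexed by \<open>{1..m}\<close> and \<open>{1..n}\<close>; vectors of \<open>\<real>^m\<close> and \<open>\<real>^n\<close> are functions on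
  \<open>nat\<close> of which only the values on these index sets matter (\<open>m = 0\<close> and \<open>n = 0\<close> are allowed).\<close>

definition lagrangian ::
  "('p \<Rightarrow> real) \<Rightarrow> (nat \<Rightarrow> 'p \<Rightarrow> real) \<Rightarrow> (nat \<Rightarrow> 'p \<Rightarrow> real) \<Rightarrow> nat \<Rightarrow> nat
    \<Rightarrow> (nat \<Rightarrow> real) \<Rightarrow> (nat \<Rightarrow> real) \<Rightarrow> 'p \<Rightarrow> real" where
  "lagrangian f g h m n \<mu> lam x =
     f x + (\<Sum>i\<in>{1..m}. \<mu> i * g i x) + (\<Sum>j\<in>{1..n}. lam j * h j x)"

definition active_set :: "(nat \<Rightarrow> 'p \<Rightarrow> real) \<Rightarrow> nat \<Rightarrow> 'p \<Rightarrow> nat set" where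
  "active_set g m x = {i \<in> {1..m}. g i x = 0}"

text \<open>Linear independence of the gradients as an indexed family, so that repetitions are
  excluded.\<close>

definition LICQ ::
  "('p, 'e::euclidean_space) chart set \<Rightarrow> ('p \<Rightarrow> 'e \<Rightarrow> 'e \<Rightarrow> real)
    \<Rightarrow> (nat \<Rightarrow> 'p \<Rightarrow> real) \<Rightarrow> (nat \<Rightarrow> 'p \<Rightarrow> real) \<Rightarrow> nat \<Rightarrow> nat \<Rightarrow> 'p \<Rightarrow> bool" where
  "LICQ A met g h m n x \<longleftrightarrow>
     (\<forall>a b. (\<Sum>i\<in>active_set g m x. a i *\<^sub>R grad A met (g i) x) +
            (\<Sum>j\<in>{1..n}. b j *\<^sub>R grad A met (h j) x) = 0 \<longrightarrow>
        (\<forall>i\<in>active_set g m x. a i = (0::real)) \<and> (\<forall>j\<in>{1..n}. b j = (0::real)))"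

definition KKT ::
  "('p, 'e::euclidean_space) chart set \<Rightarrow> ('p \<Rightarrow> 'e \<Rightarrow> 'e \<Rightarrow> real)
    \<Rightarrow> ('p \<Rightarrow> real) \<Rightarrow> (nat \<Rightarrow> 'p \<Rightarrow> real) \<Rightarrow> (nat \<Rightarrow> 'p \<Rightarrow> real) \<Rightarrow> nat \<Rightarrow> nat
    \<Rightarrow> 'p \<Rightarrow> (nat \<Rightarrow> real) \<Rightarrow> (nat \<Rightarrow> real) \<Rightarrow> bool" where
  "KKT A met f g h m n x \<mu> lam \<longleftrightarrow>
     grad A met (lagrangian f g h m n \<mu> lam) x = 0 \<and>
     (\<forall>i\<in>{1..m}. \<mu> i \<ge> 0 \<and> g i x \<le> 0 \<and> \<mu> i * g i x = 0) \<and>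
     (\<forall>j\<in>{1..n}. h j x = 0)"

definition SOSC ::
  "('p, 'e::euclidean_space) chart set \<Rightarrow> ('p \<Rightarrow> 'e \<Rightarrow> 'e \<Rightarrow> real)
    \<Rightarrow> ('p \<Rightarrow> 'e \<Rightarrow> ('p \<Rightarrow> 'e) \<Rightarrow> 'e)
    \<Rightarrow> ('p \<Rightarrow> real) \<Rightarrow> (nat \<Rightarrow> 'p \<Rightarrow> real) \<Rightarrow> (nat \<Rightarrow> 'p \<Rightarrow> real) \<Rightarrow> nat \<Rightarrow> nat
    \<Rightarrow> 'p \<Rightarrow> (nat \<Rightarrow> real) \<Rightarrow> (nat \<Rightarrow> real) \<Rightarrow> bool" where
  "SOSC A met nab f g h m n x \<mu> lam \<longleftrightarrow>
     KKT A met f g h m n x \<mu> lam \<and>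
     (\<forall>\<xi>. \<xi> \<noteq> 0 \<longrightarrow>
        (\<forall>j\<in>{1..n}. met x \<xi> (grad A met (h j) x) = 0) \<longrightarrow>
        (\<forall>i\<in>active_set g m x. \<mu> i > 0 \<longrightarrow> met x \<xi> (grad A met (g i) x) = 0) \<longrightarrow>
        (\<forall>i\<in>active_set g m x. \<mu> i = 0 \<longrightarrow> met x \<xi> (grad A met (g i) x) \<le> 0) \<longrightarrow>
        met x (Hess A met nab (lagrangian f g h m n \<mu> lam) x \<xi>) \<xi> > 0)"

definition strict_complementarity ::
  "(nat \<Rightarrow> 'p \<Rightarrow> real) \<Rightarrow> nat \<Rightarrow> 'p \<Rightarrow> (nat \<Rightarrow> real) \<Rightarrow> bool" where
  "strict_complementarity g m x \<mu> \<longleftrightarrow> (\<forall>i\<in>{1..m}. (\<mu> i = 0) \<noteq> (g i x = 0))"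


section \<open>Riemannian sequential quadratic optimization\<close>

definition penalty ::
  "('p \<Rightarrow> real) \<Rightarrow> (nat \<Rightarrow> 'p \<Rightarrow> real) \<Rightarrow> (nat \<Rightarrow> 'p \<Rightarrow> real) \<Rightarrow> nat \<Rightarrow> nat \<Rightarrow> real \<Rightarrow> 'p \<Rightarrow> real" where
  "penalty f g h m n \<rho> x =
     f x + \<rho> * ((\<Sum>i\<in>{1..m}. max 0 (g i x)) + (\<Sum>j\<in>{1..n}. \<bar>h j x\<bar>))"

text \<open>The multipliers \<open>\<mu>\<close> it is applied to are nonnegative, so inserting 0 only matters in the
  unconstrained case.\<close>

definition max_multiplier :: "nat \<Rightarrow> nat \<Rightarrow> (nat \<Rightarrow> real) \<Rightarrow> (nat \<Rightarrow> real) \<Rightarrow> real" where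
  "max_multiplier m n \<mu> lam = Max (insert 0 (\<mu> ` {1..m} \<union> (\<lambda>j. \<bar>lam j\<bar>) ` {1..n}))"

definition spd_operator :: "('p \<Rightarrow> 'e::real_vector \<Rightarrow> 'e \<Rightarrow> real) \<Rightarrow> 'p \<Rightarrow> ('e \<Rightarrow> 'e) \<Rightarrow> bool" where
  "spd_operator met x B \<longleftrightarrow>
     linear B \<and> (\<forall>u v. met x (B u) v = met x u (B v)) \<and> (\<forall>u. u \<noteq> 0 \<longrightarrow> met x (B u) u > 0)"

definition QP_objective ::
  "('p, 'e::euclidean_space) chart set \<Rightarrow> ('p \<Rightarrow> 'e \<Rightarrow> 'e \<Rightarrow> real)
    \<Rightarrow> ('p \<Rightarrow> real) \<Rightarrow> 'p \<Rightarrow> ('e \<Rightarrow> 'e) \<Rightarrow> 'e \<Rightarrow> real" where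
  "QP_objective A met f x B v = 1/2 * met x (B v) v + met x (grad A met f x) v"

definition QP_feasible_set ::
  "('p, 'e::euclidean_space) chart set \<Rightarrow> ('p \<Rightarrow> 'e \<Rightarrow> 'e \<Rightarrow> real)
    \<Rightarrow> (nat \<Rightarrow> 'p \<Rightarrow> real) \<Rightarrow> (nat \<Rightarrow> 'p \<Rightarrow> real) \<Rightarrow> nat \<Rightarrow> nat \<Rightarrow> 'p \<Rightarrow> 'e set" where
  "QP_feasible_set A met g h m n x =
     {v. (\<forall>i\<in>{1..m}. g i x + met x (grad A met (g i) x) v \<le> 0) \<and>
         (\<forall>j\<in>{1..n}. h j x + met x (grad A met (h j) x) v = 0)}"

definition QP_KKT ::
  "('p, 'e::euclidean_space) chart set \<Rightarrow> ('p \<Rightarrow> 'e \<Rightarrow> 'e \<Rightarrow> real)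
    \<Rightarrow> ('p \<Rightarrow> real) \<Rightarrow> (nat \<Rightarrow> 'p \<Rightarrow> real) \<Rightarrow> (nat \<Rightarrow> 'p \<Rightarrow> real) \<Rightarrow> nat \<Rightarrow> nat
    \<Rightarrow> 'p \<Rightarrow> ('e \<Rightarrow> 'e) \<Rightarrow> 'e \<Rightarrow> (nat \<Rightarrow> real) \<Rightarrow> (nat \<Rightarrow> real) \<Rightarrow> bool" where
  "QP_KKT A met f g h m n x B v \<mu> lam \<longleftrightarrow>
     B v + grad A met f x + (\<Sum>i\<in>{1..m}. \<mu> i *\<^sub>R grad A met (g i) x)
       + (\<Sum>j\<in>{1..n}. lam j *\<^sub>R grad A met (h j) x) = 0 \<and>
     v \<in> QP_feasible_set A met g h m n x \<and>
     (\<forall>i\<in>{1..m}. \<mu> i \<ge> 0 \<and> \<mu> i * (g i x + met x (grad A met (g i) x) v) = 0)"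

definition QP_solution ::
  "('p, 'e::euclidean_space) chart set \<Rightarrow> ('p \<Rightarrow> 'e \<Rightarrow> 'e \<Rightarrow> real)
    \<Rightarrow> ('p \<Rightarrow> real) \<Rightarrow> (nat \<Rightarrow> 'p \<Rightarrow> real) \<Rightarrow> (nat \<Rightarrow> 'p \<Rightarrow> real) \<Rightarrow> nat \<Rightarrow> nat
    \<Rightarrow> 'p \<Rightarrow> ('e \<Rightarrow> 'e) \<Rightarrow> 'e \<Rightarrow> bool" where
  "QP_solution A met f g h m n x B v \<longleftrightarrow>
     is_arg_min (QP_objective A met f x B) (\<lambda>w. w \<in> QP_feasible_set A met g h m n x) v"

definition step_accepted ::
  "('p \<Rightarrow> 'e::real_vector \<Rightarrow> 'e \<Rightarrow> real) \<Rightarrow> ('p \<Rightarrow> 'e \<Rightarrow> 'p)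
    \<Rightarrow> ('p \<Rightarrow> real) \<Rightarrow> (nat \<Rightarrow> 'p \<Rightarrow> real) \<Rightarrow> (nat \<Rightarrow> 'p \<Rightarrow> real) \<Rightarrow> nat \<Rightarrow> nat
    \<Rightarrow> real \<Rightarrow> real \<Rightarrow> real \<Rightarrow> 'p \<Rightarrow> ('e \<Rightarrow> 'e) \<Rightarrow> 'e \<Rightarrow> nat \<Rightarrow> bool" where
  "step_accepted met R f g h m n \<beta> \<gamma> \<rho> x B v r \<longleftrightarrow>
     \<gamma> * \<beta> ^ r * met x (B v) v \<le>
       penalty f g h m n \<rho> x - penalty f g h m n \<rho> (R x (\<beta> ^ r *\<^sub>R v))"

text \<open>\<open>\<rho>\<^sub>i\<close> is the initial penalty parameter, with index -1 in the usual numbering.  \<open>dx\<close>, \<open>\<mu>q\<close> and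
  \<open>lamq\<close> are the solutions of the quadratic subproblems and their multipliers.\<close>

definition RSQO_sequence ::
  "('p, 'e::euclidean_space) chart set \<Rightarrow> ('p \<Rightarrow> 'e \<Rightarrow> 'e \<Rightarrow> real)
    \<Rightarrow> ('p \<Rightarrow> real) \<Rightarrow> (nat \<Rightarrow> 'p \<Rightarrow> real) \<Rightarrow> (nat \<Rightarrow> 'p \<Rightarrow> real) \<Rightarrow> nat \<Rightarrow> nat
    \<Rightarrow> ('p \<Rightarrow> 'e \<Rightarrow> 'p) \<Rightarrow> real \<Rightarrow> real \<Rightarrow> real \<Rightarrow> real
    \<Rightarrow> (nat \<Rightarrow> 'e \<Rightarrow> 'e) \<Rightarrow> (nat \<Rightarrow> 'e) \<Rightarrow> (nat \<Rightarrow> nat \<Rightarrow> real) \<Rightarrow> (nat \<Rightarrow> nat \<Rightarrow> real)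
    \<Rightarrow> (nat \<Rightarrow> real) \<Rightarrow> (nat \<Rightarrow> real)
    \<Rightarrow> (nat \<Rightarrow> 'p) \<Rightarrow> (nat \<Rightarrow> nat \<Rightarrow> real) \<Rightarrow> (nat \<Rightarrow> nat \<Rightarrow> real) \<Rightarrow> bool" where
  "RSQO_sequence A met f g h m n R \<epsilon> \<rho>\<^sub>i \<beta> \<gamma> B dx \<mu>q lamq \<rho> \<alpha> x \<mu> lam \<longleftrightarrow>
     (\<forall>k. spd_operator met (x k) (B k) \<and>
        QP_solution A met f g h m n (x k) (B k) (dx k) \<and>
        QP_KKT A met f g h m n (x k) (B k) (dx k) (\<mu>q k) (lamq k) \<and>
        (let \<rho>_prev = (case k of 0 \<Rightarrow> \<rho>\<^sub>i | Suc l \<Rightarrow> \<rho> l);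
             \<upsilon> = max_multiplier m n (\<mu>q k) (lamq k)
         in \<rho> k = (if \<rho>_prev \<ge> \<upsilon> then \<rho>_prev else \<upsilon> + \<epsilon>)) \<and>
        (\<exists>r. step_accepted met R f g h m n \<beta> \<gamma> (\<rho> k) (x k) (B k) (dx k) r \<and>
             (\<forall>s<r. \<not> step_accepted met R f g h m n \<beta> \<gamma> (\<rho> k) (x k) (B k) (dx k) s) \<and>
             \<alpha> k = \<beta> ^ r) \<and>
        x (Suc k) = R (x k) (\<alpha> k *\<^sub>R dx k) \<and>
        (\<forall>i\<in>{1..m}. \<mu> (Suc k) i = \<mu>q k i) \<and>
        (\<forall>j\<in>{1..n}. lam (Suc k) j = lamq k j))"


section \<open>Boundedness and convergence of iterates\<close>

definition bounded_iterates ::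
  "('p::topological_space, 'e::euclidean_space) chart set \<Rightarrow> ('p \<Rightarrow> 'e \<Rightarrow> 'e \<Rightarrow> real) \<Rightarrow> nat \<Rightarrow> nat
    \<Rightarrow> (nat \<Rightarrow> 'p) \<Rightarrow> (nat \<Rightarrow> nat \<Rightarrow> real) \<Rightarrow> (nat \<Rightarrow> nat \<Rightarrow> real) \<Rightarrow> bool" where
  "bounded_iterates A met m n x \<mu> lam \<longleftrightarrow>
     Metric_space.mbounded UNIV (riem_dist A met) (range x) \<and>
     (\<exists>C. \<forall>k. L2_set (\<mu> k) {1..m} \<le> C \<and> L2_set (lam k) {1..n} \<le> C)"

definition iterates_converge ::
  "nat \<Rightarrow> nat \<Rightarrow> (nat \<Rightarrow> 'p::topological_space) \<Rightarrow> (nat \<Rightarrow> nat \<Rightarrow> real) \<Rightarrow> (nat \<Rightarrow> nat \<Rightarrow> real)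
    \<Rightarrow> 'p \<Rightarrow> (nat \<Rightarrow> real) \<Rightarrow> (nat \<Rightarrow> real) \<Rightarrow> bool" where
  "iterates_converge m n x \<mu> lam xs \<mu>s lams \<longleftrightarrow>
     x \<longlonglongrightarrow> xs \<and>
     (\<forall>i\<in>{1..m}. (\<lambda>k. \<mu> k i) \<longlonglongrightarrow> \<mu>s i) \<and> (\<forall>j\<in>{1..n}. (\<lambda>k. lam k j) \<longlonglongrightarrow> lams j)"

definition accumulation_point ::
  "nat \<Rightarrow> nat \<Rightarrow> (nat \<Rightarrow> 'p::topological_space) \<Rightarrow> (nat \<Rightarrow> nat \<Rightarrow> real) \<Rightarrow> (nat \<Rightarrow> nat \<Rightarrow> real)
    \<Rightarrow> 'p \<Rightarrow> (nat \<Rightarrow> real) \<Rightarrow> (nat \<Rightarrow> real) \<Rightarrow> bool" where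
  "accumulation_point m n x \<mu> lam xs \<mu>s lams \<longleftrightarrow>
     (\<exists>r. strict_mono r \<and> iterates_converge m n (x \<circ> r) (\<mu> \<circ> r) (lam \<circ> r) xs \<mu>s lams)"

definition coord_error ::
  "nat \<Rightarrow> nat \<Rightarrow> ('p, 'e::euclidean_space) chart \<Rightarrow> 'p \<Rightarrow> (nat \<Rightarrow> real) \<Rightarrow> (nat \<Rightarrow> real)
    \<Rightarrow> 'p \<Rightarrow> (nat \<Rightarrow> real) \<Rightarrow> (nat \<Rightarrow> real) \<Rightarrow> real" where
  "coord_error m n c x \<mu> lam xs \<mu>s lams =
     sqrt ((norm (snd c x - snd c xs))\<^sup>2 + (\<Sum>i\<in>{1..m}. (\<mu> i - \<mu>s i)\<^sup>2) + (\<Sum>j\<in>{1..n}. (lam j - lams j)\<^sup>2))"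

definition converges_quadratically ::
  "('p::topological_space, 'e::euclidean_space) chart set \<Rightarrow> nat \<Rightarrow> nat
    \<Rightarrow> (nat \<Rightarrow> 'p) \<Rightarrow> (nat \<Rightarrow> nat \<Rightarrow> real) \<Rightarrow> (nat \<Rightarrow> nat \<Rightarrow> real)
    \<Rightarrow> 'p \<Rightarrow> (nat \<Rightarrow> real) \<Rightarrow> (nat \<Rightarrow> real) \<Rightarrow> bool" where
  "converges_quadratically A m n x \<mu> lam xs \<mu>s lams \<longleftrightarrow>
     iterates_converge m n x \<mu> lam xs \<mu>s lams \<and>
     (\<exists>c\<in>A. xs \<in> fst c \<and> (\<exists>C\<ge>0. \<forall>\<^sub>F k in sequentially.
        coord_error m n c (x (Suc k)) (\<mu> (Suc k)) (lam (Suc k)) xs \<mu>s lams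
          \<le> C * (coord_error m n c (x k) (\<mu> k) (lam k) xs \<mu>s lams)\<^sup>2))"

end

theory Submission
  imports Defs
begin

text \<open>
  In a fixed chart around the solution, an iteration with exact Hessian and unit step is, up to
  errors quadratic in the distance \<open>e\<close> of the current iterate and multipliers from the solution, a
  step of Newton's method for the equations stating that the differential of the Lagrangian and the
  active constraints vanish.  Three things distinguish it from that Newton step.  The Riemannian
  Hessian in coordinates is the second derivative minus the differential composed with the
  Christoffel symbols (\<open>hessian_in_chart\<close>); the differential of the Lagrangian is of order \<open>e\<close> at the
  iterate, and so is the step it is multiplied with.  The Hessian uses the current multipliers in
  place of the optimal ones; the resulting error again has two factors of order \<open>e\<close>.  Finally the
  retraction replaces addition, with which it agrees to second order (\<open>retraction_in_chart\<close>).

  Why the subproblem behaves like this system of equations has to be shown first, since all that is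
  known about its solution and multipliers is that the multipliers are bounded.  Testing its stationarity condition with the step \<open>d\<close>
  and using complementarity bounds \<open>(norm d)\<^sup>2\<close> by a multiple of \<open>e * (norm d + 1)\<close>, because the
  operators \<open>B k\<close> are uniformly positive definite.  So \<open>d\<close> is small, the constraints that are inactive
  at the solution stay inactive in the subproblem, and LICQ controls the remaining multipliers.  Now
  a stability estimate for saddle-point systems (\<open>saddle_point_estimate\<close>) applies twice: first to \<open>d\<close>
  and the multiplier error, which are therefore of order \<open>e\<close>, whereupon strict complementarity turns
  the active linearised constraints into equations; then to the new position relative to the
  solution, for which all residuals are Taylor remainders, hence of order \<open>e\<^sup>2\<close>
  (\<open>newton_qp_quadratic_step\<close>).

  The geometric input is the formula for the Hessian with locally bounded Christoffel symbols.  The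
  connection is known only through its axioms on global \<open>C\<^sup>1\<close> fields, so the gradient has to be shown to
  be such a field (\<open>grad_C1_field\<close>), and coordinate fields have to be cut off by bump functions; the
  Koszul formula then bounds the symbols by derivatives of the metric.

  Altogether the error after a step is at most a constant times the square of the error before it
  (\<open>rsqo_step\<close>).  The accumulation point provides one iterate with small error, and from there on this
  estimate keeps all iterates near the solution and makes them converge.
\<close>

section \<open>Calculus of maps of class C^k\<close>

abbreviation fderiv :: "('a::real_normed_vector \<Rightarrow> 'b::real_normed_vector) \<Rightarrow> 'a \<Rightarrow> 'a \<Rightarrow> 'b" where
  "fderiv F y \<equiv> frechet_derivative F (at y)"

abbreviation fderiv2 :: "('a::real_normed_vector \<Rightarrow> 'b::real_normed_vector) \<Rightarrow> 'a \<Rightarrow> 'a \<Rightarrow> 'a \<Rightarrow> 'b" where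
  "fderiv2 F y u v \<equiv> fderiv (\<lambda>z. fderiv F z v) y u"

lemma fderiv_has_derivative: "F differentiable (at y) \<Longrightarrow> (F has_derivative fderiv F y) (at y)"
  by (simp add: frechet_derivative_works)

lemma fderiv_eqI: "(F has_derivative F') (at y) \<Longrightarrow> fderiv F y = F'"
  using frechet_derivative_at by metis

lemma Ck_on_subset: "Ck_on k f S \<Longrightarrow> T \<subseteq> S \<Longrightarrow> Ck_on k f T"
  by (induction k arbitrary: f) (auto intro: continuous_on_subset)

lemma Ck_on_cong:
  assumes "open S" "Ck_on k f S" "\<And>x. x \<in> S \<Longrightarrow> f x = g x"
  shows "Ck_on k g S"
  using assms(2,3)
proof (induction k arbitrary: f g)
  case 0
  then show ?case using continuous_on_cong by (metis Ck_on.simps(1))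
next
  case (Suc k)
  have der: "(g has_derivative fderiv f x) (at x)" if "x \<in> S" for x
    using Suc.prems that has_derivative_transform_within_open[OF fderiv_has_derivative \<open>open S\<close>]
    by (metis Ck_on.simps(2))
  then have eq: "fderiv f x = fderiv g x" if "x \<in> S" for x
    using fderiv_eqI that by metis
  show ?case
    using Suc.prems(1) Suc.IH[of "\<lambda>x. fderiv f x v" "\<lambda>x. fderiv g x v" for v] der eq
    by (auto simp: differentiable_def)
qed

lemma Ck_on_Suc_imp: "Ck_on (Suc k) f S \<Longrightarrow> Ck_on k f S"
proof (induction k arbitrary: f)
  case 0
  then show ?case
    by (auto intro!: continuous_at_imp_continuous_on differentiable_imp_continuous_within)
qed simp

lemma Ck_on_mono: "Ck_on k f S \<Longrightarrow> j \<le> k \<Longrightarrow> Ck_on j f S"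
  by (induction k) (use Ck_on_Suc_imp le_Suc_eq in auto)

lemma Ck_on_imp_continuous: "Ck_on k f S \<Longrightarrow> continuous_on S f"
  using Ck_on_mono[of k f S 0] by simp

lemma Ck_on_differentiable: "Ck_on k f S \<Longrightarrow> 0 < k \<Longrightarrow> x \<in> S \<Longrightarrow> f differentiable (at x)"
  by (cases k) auto

lemma Ck_on_has_derivative:
  "Ck_on k f S \<Longrightarrow> 0 < k \<Longrightarrow> x \<in> S \<Longrightarrow> (f has_derivative fderiv f x) (at x within T)"
  by (rule has_derivative_at_withinI, rule fderiv_has_derivative, rule Ck_on_differentiable)

lemma Ck_on_fderiv: "Ck_on k f S \<Longrightarrow> j < k \<Longrightarrow> Ck_on j (\<lambda>x. fderiv f x v) S"
  by (cases k) (auto intro: Ck_on_mono)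

lemma Ck_on_const: "Ck_on k (\<lambda>x. c) S"
  by (induction k arbitrary: c) (auto simp: continuous_on_const)

lemma Ck_on_bounded_linear:
  assumes "bounded_linear L" "open S" "Ck_on k f S"
  shows "Ck_on k (\<lambda>x. L (f x)) S"
  using assms(3)
proof (induction k arbitrary: f)
  case 0
  then show ?case using bounded_linear.continuous_on[OF assms(1)] by simp
next
  case (Suc k)
  have der: "((\<lambda>x. L (f x)) has_derivative (\<lambda>v. L (fderiv f x v))) (at x)" if "x \<in> S" for x
    using Suc.prems that by (intro bounded_linear.has_derivative[OF assms(1)] fderiv_has_derivative) auto
  have "Ck_on k (\<lambda>x. fderiv (\<lambda>x. L (f x)) x v) S" for v
    by (rule Ck_on_cong[OF \<open>open S\<close> Suc.IH[of "\<lambda>x. fderiv f x v"]])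
       (use Suc.prems fderiv_eqI[OF der] in auto)
  then show ?case using der by (auto simp: differentiable_def)
qed

lemma Ck_on_ident: "open S \<Longrightarrow> Ck_on k (\<lambda>x. x) S"
proof (cases k)
  case (Suc k)
  then show ?thesis using Ck_on_const by (auto simp: frechet_derivative_ident)
qed (auto simp: continuous_on_id)

lemma Ck_on_add:
  assumes "open S" "Ck_on k f S" "Ck_on k g S"
  shows "Ck_on k (\<lambda>x. f x + g x) S"
  using assms(2,3)
proof (induction k arbitrary: f g)
  case (Suc k)
  have der: "((\<lambda>x. f x + g x) has_derivative (\<lambda>v. fderiv f x v + fderiv g x v)) (at x)"
    if "x \<in> S" for x
    using Suc.prems that by (intro has_derivative_add fderiv_has_derivative) auto
  have "Ck_on k (\<lambda>x. fderiv (\<lambda>x. f x + g x) x v) S" for v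
    by (rule Ck_on_cong[OF \<open>open S\<close> Suc.IH[of "\<lambda>x. fderiv f x v" "\<lambda>x. fderiv g x v"]])
       (use Suc.prems fderiv_eqI[OF der] in auto)
  then show ?case using der by (auto simp: differentiable_def)
qed (auto intro: continuous_on_add)

lemma Ck_on_sum:
  assumes "open S" "\<And>i. i \<in> I \<Longrightarrow> Ck_on k (f i) S"
  shows "Ck_on k (\<lambda>x. \<Sum>i\<in>I. f i x) S"
  using assms(2)
  by (induction I rule: infinite_finite_induct) (auto intro: Ck_on_const Ck_on_add[OF \<open>open S\<close>])

lemma Ck_on_scaleR:
  fixes f :: "'a::real_normed_vector \<Rightarrow> real"
  assumes "open S" "Ck_on k f S" "Ck_on k g S"
  shows "Ck_on k (\<lambda>x. f x *\<^sub>R g x) S"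
  using assms(2,3)
proof (induction k arbitrary: f g)
  case (Suc k)
  have der: "((\<lambda>x. f x *\<^sub>R g x) has_derivative (\<lambda>v. f x *\<^sub>R fderiv g x v + fderiv f x v *\<^sub>R g x)) (at x)"
    if "x \<in> S" for x
    using Suc.prems that by (intro has_derivative_scaleR fderiv_has_derivative) auto
  have "Ck_on k (\<lambda>x. f x *\<^sub>R fderiv g x v + fderiv f x v *\<^sub>R g x) S" for v
    using Suc.prems Ck_on_Suc_imp[OF Suc.prems(1)] Ck_on_Suc_imp[OF Suc.prems(2)]
    by (intro Ck_on_add[OF \<open>open S\<close>] Suc.IH) auto
  then have "Ck_on k (\<lambda>x. fderiv (\<lambda>x. f x *\<^sub>R g x) x v) S" for v
    by (rule Ck_on_cong[OF \<open>open S\<close>]) (use fderiv_eqI[OF der] in auto)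
  then show ?case using der by (auto simp: differentiable_def)
qed (auto intro: continuous_on_scaleR)

lemma Ck_on_mult:
  fixes f g :: "'a::real_normed_vector \<Rightarrow> real"
  assumes "open S" "Ck_on k f S" "Ck_on k g S"
  shows "Ck_on k (\<lambda>x. f x * g x) S"
  using Ck_on_scaleR[OF assms] by simp

lemma Ck_on_inner:
  fixes f g :: "'a::real_normed_vector \<Rightarrow> 'b::euclidean_space"
  assumes "open S" "Ck_on k f S" "Ck_on k g S"
  shows "Ck_on k (\<lambda>x. f x \<bullet> g x) S"
proof -
  have "Ck_on k (\<lambda>x. \<Sum>b\<in>Basis. (f x \<bullet> b) * (g x \<bullet> b)) S"
    by (intro Ck_on_sum Ck_on_mult Ck_on_bounded_linear[OF bounded_linear_inner_left] assms)
  then show ?thesis by (simp add: euclidean_inner[symmetric])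
qed

lemma linear_eq_sum_Basis:
  fixes L :: "'a::euclidean_space \<Rightarrow> 'b::real_vector"
  assumes "linear L"
  shows "L v = (\<Sum>b\<in>Basis. (v \<bullet> b) *\<^sub>R L b)"
proof -
  have "L v = L (\<Sum>b\<in>Basis. (v \<bullet> b) *\<^sub>R b)"
    by (simp only: euclidean_representation)
  also have "\<dots> = (\<Sum>b\<in>Basis. (v \<bullet> b) *\<^sub>R L b)"
    by (simp only: linear_sum[OF assms] linear_scale[OF assms])
  finally show ?thesis .
qed

lemma fderiv_compose:
  assumes "g differentiable (at x)" "f differentiable (at (g x))"
  shows "fderiv (\<lambda>x. f (g x)) x = (\<lambda>v. fderiv f (g x) (fderiv g x v))"
  using frechet_derivative_compose[OF assms] by (simp add: o_def)

text \<open>For a Euclidean middle space the directional derivative of a composition is a finite combination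
  of directional derivatives of the outer map in fixed basis directions.  The coefficients and the
  composed directional derivatives are one class lower, which is what closes the induction.\<close>

lemma Ck_on_compose:
  fixes g :: "'a::real_normed_vector \<Rightarrow> 'b::euclidean_space"
  assumes "open S" "open T" "Ck_on k g S" "Ck_on k f T" "g ` S \<subseteq> T"
  shows "Ck_on k (\<lambda>x. f (g x)) S"
  using assms(3,4)
proof (induction k arbitrary: f)
  case 0
  then show ?case using continuous_on_compose2[of T f S g] assms(5) by simp
next
  case (Suc k)
  have diff: "g differentiable (at x)" "f differentiable (at (g x))" if "x \<in> S" for x
    using Suc.prems that assms(5) by auto
  have sm: "Ck_on k (\<lambda>x. \<Sum>b\<in>Basis. (fderiv g x v \<bullet> b) *\<^sub>R fderiv f (g x) b) S" for v
    using Suc.prems Ck_on_Suc_imp[OF Suc.prems(1)]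
    by (intro Ck_on_sum[OF \<open>open S\<close>] Ck_on_scaleR[OF \<open>open S\<close>] Suc.IH
          Ck_on_bounded_linear[OF bounded_linear_inner_left \<open>open S\<close>]) auto
  have "(\<Sum>b\<in>Basis. (fderiv g x v \<bullet> b) *\<^sub>R fderiv f (g x) b) = fderiv (\<lambda>x. f (g x)) x v"
    if "x \<in> S" for x v
  proof -
    have "linear (fderiv f (g x))" using diff that by (intro linear_frechet_derivative)
    then have "fderiv f (g x) (fderiv g x v) = (\<Sum>b\<in>Basis. (fderiv g x v \<bullet> b) *\<^sub>R fderiv f (g x) b)"
      by (rule linear_eq_sum_Basis)
    then show ?thesis using fderiv_compose diff that by metis
  qed
  then have "Ck_on k (\<lambda>x. fderiv (\<lambda>x. f (g x)) x v) S" for v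
    by (intro Ck_on_cong[OF \<open>open S\<close> sm]) auto
  moreover have "(\<lambda>x. f (g x)) differentiable (at x)" if "x \<in> S" for x
    using diff[OF that] differentiable_chain_at[of g x f] by (simp add: o_def)
  ultimately show ?case by auto
qed

lemma Ck_on_Un:
  assumes "open S" "open T" "Ck_on k f S" "Ck_on k f T"
  shows "Ck_on k f (S \<union> T)"
  using assms(3,4) by (induction k arbitrary: f) (auto intro: continuous_on_open_Un assms)

section \<open>Local Lipschitz and Taylor estimates\<close>

lemma linear_norm_le_Basis:
  fixes L :: "'a::euclidean_space \<Rightarrow> 'b::real_normed_vector"
  assumes "linear L" "\<And>b. b \<in> Basis \<Longrightarrow> norm (L b) \<le> K"
  shows "norm (L v) \<le> real DIM('a) * K * norm v"
proof -
  have "norm (L v) = norm (\<Sum>b\<in>Basis. (v \<bullet> b) *\<^sub>R L b)"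
    by (simp only: linear_eq_sum_Basis[OF assms(1), of v])
  also have "\<dots> \<le> (\<Sum>b::'a\<in>Basis. norm v * K)"
    by (rule sum_norm_le) (auto intro!: mult_mono assms(2) Basis_le_norm)
  finally show ?thesis by (simp add: algebra_simps)
qed

lemma bilinear_norm_le_Basis:
  fixes T :: "'a::euclidean_space \<Rightarrow> 'b::euclidean_space \<Rightarrow> 'c::real_normed_vector"
  assumes "bilinear T" "\<And>a b. a \<in> Basis \<Longrightarrow> b \<in> Basis \<Longrightarrow> norm (T a b) \<le> K"
  shows "norm (T u v) \<le> real DIM('a) * (real DIM('b) * K) * norm u * norm v"
proof -
  have "norm (T a v) \<le> real DIM('b) * K * norm v" if "a \<in> Basis" for a
    using linear_norm_le_Basis[of "T a" K v] assms that by (simp add: bilinear_def)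
  then show ?thesis
    using linear_norm_le_Basis[of "\<lambda>u. T u v" "real DIM('b) * K * norm v" u] assms(1)
    by (simp add: algebra_simps bilinear_def)
qed

lemma eventually_bounded_of_continuous:
  fixes F :: "'a::real_normed_vector \<Rightarrow> 'b::real_normed_vector"
  assumes "open S" "p \<in> S" "continuous_on S F"
  shows "\<forall>\<^sub>F x in nhds p. norm (F x) \<le> norm (F p) + 1"
proof -
  have "(F \<longlongrightarrow> F p) (nhds p)"
    using assms continuous_on_eq_continuous_at continuous_at_imp_continuous_within
    by (metis isCont_def tendsto_at_iff_tendsto_nhds)
  then have "\<forall>\<^sub>F x in nhds p. dist (F x) (F p) < 1" by (rule tendstoD) simp
  then show ?thesis
    by (rule eventually_mono) (smt (verit) dist_norm norm_triangle_sub)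
qed

text \<open>Regularity is only assumed of directional derivatives in fixed directions; finitely many of them,
  those along a basis, control the whole differential.\<close>

lemma C1_fderiv_bounded:
  fixes F :: "'a::euclidean_space \<Rightarrow> 'b::real_normed_vector"
  assumes "open S" "p \<in> S" "Ck_on 1 F S"
  shows "\<exists>K\<ge>0. \<forall>\<^sub>F x in nhds p. \<forall>v. norm (fderiv F x v) \<le> K * norm v"
proof -
  define K where "K = (\<Sum>b\<in>Basis. norm (fderiv F p b) + 1)"
  have "\<forall>\<^sub>F x in nhds p. \<forall>b\<in>Basis. norm (fderiv F x b) \<le> norm (fderiv F p b) + 1"
    using assms by (intro eventually_ball_finite ballI eventually_bounded_of_continuous) auto
  moreover have "\<forall>\<^sub>F x in nhds p. x \<in> S"
    using assms eventually_nhds by blast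
  ultimately have "\<forall>\<^sub>F x in nhds p. \<forall>v. norm (fderiv F x v) \<le> real DIM('a) * K * norm v"
  proof eventually_elim
    case (elim x)
    have "norm (fderiv F p b) + 1 \<le> K" if "b \<in> Basis" for b
      unfolding K_def by (rule member_le_sum[OF that]) auto
    then show ?case
      using elim assms(3)
      by (intro allI linear_norm_le_Basis linear_frechet_derivative) force+
  qed
  moreover have "K \<ge> 0" unfolding K_def by (intro sum_nonneg) auto
  ultimately show ?thesis by (intro exI[of _ "real DIM('a) * K"]) auto
qed

lemma C1_locally_Lipschitz:
  fixes F :: "'a::euclidean_space \<Rightarrow> 'b::real_normed_vector"
  assumes "open S" "p \<in> S" "Ck_on 1 F S"
  shows "\<exists>\<delta>>0. \<exists>K\<ge>0. ball p \<delta> \<subseteq> S \<and> (\<forall>x\<in>ball p \<delta>. \<forall>y\<in>ball p \<delta>. norm (F x - F y) \<le> K * norm (x - y))"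
proof -
  obtain K where K: "K \<ge> 0" "\<forall>\<^sub>F x in nhds p. \<forall>v. norm (fderiv F x v) \<le> K * norm v"
    using C1_fderiv_bounded[OF assms] by auto
  have "\<forall>\<^sub>F x in nhds p. x \<in> S" using assms eventually_nhds by blast
  with K(2) have "\<forall>\<^sub>F x in nhds p. x \<in> S \<and> (\<forall>v. norm (fderiv F x v) \<le> K * norm v)"
    by eventually_elim auto
  then obtain \<delta> where \<delta>: "\<delta> > 0" "\<And>x. x \<in> ball p \<delta> \<Longrightarrow> x \<in> S \<and> (\<forall>v. norm (fderiv F x v) \<le> K * norm v)"
    unfolding eventually_nhds_metric by (auto simp: dist_commute)
  have "norm (F x - F y) \<le> K * norm (x - y)" if "x \<in> ball p \<delta>" "y \<in> ball p \<delta>" for x y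
  proof (rule differentiable_bound[of "ball p \<delta>" F "fderiv F" K x y])
    show "(F has_derivative fderiv F z) (at z within ball p \<delta>)" if "z \<in> ball p \<delta>" for z
      using Ck_on_has_derivative[OF assms(3)] \<delta>(2)[OF that] by simp
    show "onorm (fderiv F z) \<le> K" if "z \<in> ball p \<delta>" for z
      using \<delta>(2)[OF that] K(1) by (intro onorm_le) auto
  qed (use that in auto)
  then show ?thesis using \<delta> K(1) by blast
qed

text \<open>The remainder is uniform in the base point as well as the end point: the expansions needed
  later are based at the moving iterate, not at the limit.\<close>

lemma C2_Taylor:
  fixes F :: "'a::euclidean_space \<Rightarrow> 'b::real_normed_vector"
  assumes "open S" "p \<in> S" "Ck_on 2 F S"
  shows "\<exists>\<delta>>0. \<exists>K\<ge>0. ball p \<delta> \<subseteq> S \<and>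
    (\<forall>x\<in>ball p \<delta>. \<forall>y\<in>ball p \<delta>. norm (F y - F x - fderiv F x (y - x)) \<le> K * (norm (y - x))\<^sup>2)"
proof -
  have C1: "Ck_on 1 (\<lambda>x. fderiv F x b) S" for b
    using assms(3) by (intro Ck_on_fderiv) auto
  have "\<forall>b\<in>Basis. \<exists>\<delta>>0. \<exists>K\<ge>0. ball p \<delta> \<subseteq> S \<and>
     (\<forall>x\<in>ball p \<delta>. \<forall>y\<in>ball p \<delta>. norm (fderiv F x b - fderiv F y b) \<le> K * norm (x - y))"
    using C1_locally_Lipschitz[OF assms(1,2) C1] by blast
  then obtain \<delta> K where \<delta>: "\<And>b. b \<in> Basis \<Longrightarrow> \<delta> b > (0::real)" "\<And>b. b \<in> Basis \<Longrightarrow> K b \<ge> (0::real)"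
    "\<And>b. b \<in> Basis \<Longrightarrow> ball p (\<delta> b) \<subseteq> S"
    "\<And>b x y. b \<in> Basis \<Longrightarrow> x \<in> ball p (\<delta> b) \<Longrightarrow> y \<in> ball p (\<delta> b) \<Longrightarrow>
       norm (fderiv F x b - fderiv F y b) \<le> K b * norm (x - y)"
    by metis
  define d where "d = Min (\<delta> ` Basis)"
  have d: "d > 0" "\<And>b. b \<in> Basis \<Longrightarrow> d \<le> \<delta> b"
    unfolding d_def using \<delta>(1) by auto
  define M where "M = (\<Sum>b\<in>Basis. K b)"
  have M: "M \<ge> 0" "\<And>b. b \<in> Basis \<Longrightarrow> K b \<le> M"
    unfolding M_def using \<delta>(2) by (auto intro: sum_nonneg member_le_sum)
  obtain b0 :: 'a where "b0 \<in> Basis" using nonempty_Basis by blast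
  then have sub: "ball p d \<subseteq> S" using \<delta>(3) d(2) by (meson order.trans subset_ball)
  define N where "N = real DIM('a) * M"
  have lip: "norm (fderiv F x v - fderiv F y v) \<le> N * norm (x - y) * norm v"
    if "x \<in> ball p d" "y \<in> ball p d" for x y v
  proof -
    have lin: "linear (fderiv F z)" if "z \<in> ball p d" for z
      using that sub assms(3) by (intro linear_frechet_derivative) (auto simp: numeral_2_eq_2)
    have "norm (fderiv F x b - fderiv F y b) \<le> M * norm (x - y)" if b: "b \<in> Basis" for b
      using \<delta>(4)[OF b, of x y] d(2)[OF b] M(2)[OF b] \<open>x \<in> _\<close> \<open>y \<in> _\<close>
      by (smt (verit, best) mem_ball mult_right_mono norm_ge_zero)
    then show ?thesis
      using linear_norm_le_Basis[of "\<lambda>v. fderiv F x v - fderiv F y v" "M * norm (x - y)" v]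
        linear_compose_sub[OF lin lin] that by (simp add: N_def mult.assoc)
  qed
  have N: "N \<ge> 0" using M by (simp add: N_def)
  have "norm (F y - F x - fderiv F x (y - x)) \<le> N * (norm (y - x))\<^sup>2"
    if "x \<in> ball p d" "y \<in> ball p d" for x y
  proof -
    define seg where "seg = closed_segment x y"
    have segb: "seg \<subseteq> ball p d" unfolding seg_def using that by (simp add: closed_segment_subset)
    have "norm (F y - F x - fderiv F x (y - x)) \<le> norm (y - x) * (N * norm (y - x))"
    proof (rule differentiable_bound_linearization[where S = seg])
      show "x + t *\<^sub>R (y - x) \<in> seg" if "t \<in> {0..1}" for t
        unfolding seg_def closed_segment_def using that by (auto intro!: exI[of _ t] simp: algebra_simps)
      show "(F has_derivative fderiv F z) (at z within seg)" if "z \<in> seg" for z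
        using that segb sub by (intro Ck_on_has_derivative[OF assms(3)]) auto
      show "onorm (fderiv F z - fderiv F x) \<le> N * norm (y - x)" if "z \<in> seg" for z
      proof (rule onorm_le)
        fix v :: 'a
        have "norm (z - x) \<le> norm (y - x)"
          using that unfolding seg_def using segment_bound(1) by (metis)
        then have "N * norm (z - x) * norm v \<le> N * norm (y - x) * norm v"
          using N by (intro mult_right_mono mult_left_mono) auto
        moreover have "norm (fderiv F z v - fderiv F x v) \<le> N * norm (z - x) * norm v"
          using lip segb that \<open>x \<in> ball p d\<close> by blast
        ultimately show "norm ((fderiv F z - fderiv F x) v) \<le> N * norm (y - x) * norm v" by simp
      qed
      show "x \<in> seg" by (simp add: seg_def)
    qed
    then show ?thesis by (simp add: power2_eq_square algebra_simps)
  qed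
  then show ?thesis using d(1) N sub by blast
qed

section \<open>Independent functionals and coercive forms\<close>

lemma linear_functional_eq_inner:
  fixes L :: "'a::euclidean_space \<Rightarrow> real"
  assumes "linear L"
  shows "(\<Sum>b\<in>Basis. L b *\<^sub>R b) \<bullet> v = L v"
proof -
  have "(\<Sum>b\<in>Basis. L b *\<^sub>R b) \<bullet> v = (\<Sum>b\<in>Basis. L b * (b \<bullet> v))"
    by (simp add: inner_sum_left)
  also have "\<dots> = (\<Sum>b\<in>Basis. (v \<bullet> b) *\<^sub>R L b)"
    by (rule sum.cong) (simp_all add: inner_commute)
  finally show ?thesis using linear_eq_sum_Basis[OF assms, of v] by simp
qed

lemma in_span_image_obtain_coefficients:
  assumes "finite J" "x \<in> span (r ` J)"
  shows "\<exists>c. x = (\<Sum>k\<in>J. c k *\<^sub>R r k)"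
  using assms(2)
proof (induction rule: span_induct_alt)
  case base
  show ?case by (intro exI[of _ "\<lambda>_. 0"]) simp
next
  case (step t v y)
  then obtain k c where k: "k \<in> J" "v = r k" "y = (\<Sum>k\<in>J. c k *\<^sub>R r k)" by auto
  have "(\<Sum>j\<in>J. (c j + (if j = k then t else 0)) *\<^sub>R r j)
      = (\<Sum>j\<in>J. c j *\<^sub>R r j) + (\<Sum>j\<in>J. if j = k then t *\<^sub>R r j else 0)"
    by (subst sum.distrib[symmetric], rule sum.cong) (auto simp: scaleR_add_left)
  then show ?case
    using k assms(1) by (intro exI[of _ "\<lambda>j. c j + (if j = k then t else 0)"]) simp
qed

text \<open>Dual vectors of an independent family: the component of the representing vector of \<open>a l\<close> that is
  orthogonal to the others is nonzero by independence, and suitably scaled it is dual to \<open>a l\<close>.\<close>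

lemma dual_vectors_exist:
  fixes a :: "'i \<Rightarrow> 'e::euclidean_space \<Rightarrow> real"
  assumes "finite J" and lin: "\<And>l. l \<in> J \<Longrightarrow> linear (a l)"
    and indep: "\<And>w. (\<And>\<xi>. (\<Sum>l\<in>J. w l * a l \<xi>) = 0) \<Longrightarrow> \<forall>l\<in>J. w l = 0"
  shows "\<exists>\<zeta>. \<forall>l\<in>J. \<forall>k\<in>J. a k (\<zeta> l) = (if k = l then 1 else 0)"
proof -
  define r where "r l = (\<Sum>b\<in>Basis. a l b *\<^sub>R b)" for l
  have r: "a l \<xi> = r l \<bullet> \<xi>" if "l \<in> J" for l \<xi>
    using linear_functional_eq_inner[OF lin[OF that]] by (simp add: r_def)
  have "\<exists>\<zeta>. \<forall>k\<in>J. a k \<zeta> = (if k = l then 1 else 0)" if l: "l \<in> J" for l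
  proof -
    obtain y z where yz: "y \<in> span (r ` (J - {l}))" "\<And>w. w \<in> span (r ` (J - {l})) \<Longrightarrow> orthogonal z w"
      "r l = y + z"
      using orthogonal_subspace_decomp_exists[of "r ` (J - {l})" "r l"] by metis
    have orth: "z \<bullet> r k = 0" if "k \<in> J" "k \<noteq> l" for k
      using yz(2)[of "r k"] that by (auto simp: orthogonal_def intro: span_base)
    have "z \<noteq> 0"
    proof
      assume "z = 0"
      then obtain c where c: "r l = (\<Sum>k\<in>J-{l}. c k *\<^sub>R r k)"
        using yz in_span_image_obtain_coefficients[of "J - {l}" "r l" r] assms(1) by auto
      define w where "w = c(l := -1)"
      have "(\<Sum>k\<in>J. w k * a k \<xi>) = 0" for \<xi>
      proof -
        have "(\<Sum>k\<in>J. w k * a k \<xi>) = (\<Sum>k\<in>J. w k *\<^sub>R r k) \<bullet> \<xi>"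
          by (simp add: inner_sum_left r)
        also have "(\<Sum>k\<in>J. w k *\<^sub>R r k) = w l *\<^sub>R r l + (\<Sum>k\<in>J-{l}. w k *\<^sub>R r k)"
          using assms(1) l by (rule sum.remove)
        also have "(\<Sum>k\<in>J-{l}. w k *\<^sub>R r k) = r l"
          unfolding c by (rule sum.cong) (auto simp: w_def)
        finally show ?thesis by (simp add: w_def)
      qed
      then have "w l = 0" using indep l by blast
      then show False by (simp add: w_def)
    qed
    moreover have "y \<bullet> z = 0" using yz(2)[OF yz(1)] by (simp add: orthogonal_def inner_commute)
    ultimately have "\<forall>k\<in>J. a k (z /\<^sub>R (z \<bullet> z)) = (if k = l then 1 else 0)"
      using orth r l yz(3) by (auto simp: inner_add_left inner_add_right inner_commute)
    then show ?thesis by blast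
  qed
  then show ?thesis by metis
qed

text \<open>Linear independence survives perturbation, with a uniform bound of the coefficients by the norm
  of the combination: testing the perturbed combination on the dual vectors of the unperturbed family
  recovers each coefficient up to an error that \<open>\<rho>\<close> makes at most half of the total.  This is how LICQ
  at the solution controls multipliers at nearby points.\<close>

lemma independent_functionals_stable:
  fixes a0 :: "'i \<Rightarrow> 'e::euclidean_space \<Rightarrow> real"
  assumes "finite J" and lin: "\<And>l. l \<in> J \<Longrightarrow> linear (a0 l)"
    and indep: "\<And>w. (\<And>\<xi>. (\<Sum>l\<in>J. w l * a0 l \<xi>) = 0) \<Longrightarrow> \<forall>l\<in>J. w l = 0"
  shows "\<exists>\<rho>>0. \<exists>\<kappa>\<ge>0. \<forall>a. (\<forall>l\<in>J. \<forall>\<xi>. \<bar>a l \<xi> - a0 l \<xi>\<bar> \<le> \<rho> * norm \<xi>) \<longrightarrow>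
    (\<forall>w s. (\<forall>\<xi>. \<bar>\<Sum>l\<in>J. w l * a l \<xi>\<bar> \<le> s * norm \<xi>) \<longrightarrow> (\<Sum>l\<in>J. \<bar>w l\<bar>) \<le> \<kappa> * s)"
proof -
  obtain \<zeta> where \<zeta>: "\<And>l k. l \<in> J \<Longrightarrow> k \<in> J \<Longrightarrow> a0 k (\<zeta> l) = (if k = l then 1 else 0)"
    using dual_vectors_exist[of J a0, OF assms] by blast
  define Z where "Z = (\<Sum>l\<in>J. norm (\<zeta> l)) + 1"
  have Z: "Z > 0" unfolding Z_def by (smt (verit) sum_nonneg norm_ge_zero)
  have "(\<Sum>l\<in>J. \<bar>w l\<bar>) \<le> 2 * Z * s"
    if a: "\<forall>l\<in>J. \<forall>\<xi>. \<bar>a l \<xi> - a0 l \<xi>\<bar> \<le> 1 / (2 * Z) * norm \<xi>"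
      and s: "\<forall>\<xi>. \<bar>\<Sum>l\<in>J. w l * a l \<xi>\<bar> \<le> s * norm \<xi>" for a w s
  proof -
    define W where "W = (\<Sum>l\<in>J. \<bar>w l\<bar>)"
    have W0: "W \<ge> 0" unfolding W_def by (intro sum_nonneg) auto
    obtain b :: 'e where "b \<in> Basis" using nonempty_Basis by blast
    then have s0: "s \<ge> 0" using s[rule_format, of b] by simp
    have "\<bar>w l\<bar> \<le> (s + W / (2 * Z)) * norm (\<zeta> l)" if l: "l \<in> J" for l
    proof -
      have "w l = (\<Sum>k\<in>J. if k = l then w k else 0)" using assms(1) l by simp
      also have "\<dots> = (\<Sum>k\<in>J. w k * a0 k (\<zeta> l))" using \<zeta> l by (intro sum.cong) auto
      also have "\<dots> = (\<Sum>k\<in>J. w k * a k (\<zeta> l)) - (\<Sum>k\<in>J. w k * (a k (\<zeta> l) - a0 k (\<zeta> l)))"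
        by (simp add: sum_subtractf[symmetric] algebra_simps)
      finally have "\<bar>w l\<bar> \<le> \<bar>\<Sum>k\<in>J. w k * a k (\<zeta> l)\<bar> + \<bar>\<Sum>k\<in>J. w k * (a k (\<zeta> l) - a0 k (\<zeta> l))\<bar>"
        by linarith
      also have "\<bar>\<Sum>k\<in>J. w k * (a k (\<zeta> l) - a0 k (\<zeta> l))\<bar> \<le> (\<Sum>k\<in>J. \<bar>w k\<bar> * (1 / (2 * Z) * norm (\<zeta> l)))"
        unfolding abs_mult[symmetric] using a
        by (intro order.trans[OF sum_abs] sum_mono) (simp only: abs_mult, intro mult_left_mono, auto)
      also have "\<dots> = W / (2 * Z) * norm (\<zeta> l)" by (simp add: W_def sum_distrib_right sum_divide_distrib)
      finally show ?thesis using s[rule_format, of "\<zeta> l"] by (simp add: distrib_right)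
    qed
    then have "W \<le> (\<Sum>l\<in>J. (s + W / (2 * Z)) * norm (\<zeta> l))" unfolding W_def by (rule sum_mono)
    also have "\<dots> \<le> (s + W / (2 * Z)) * Z"
      unfolding sum_distrib_left[symmetric] using s0 W0 Z by (intro mult_left_mono) (auto simp: Z_def)
    finally have "W \<le> (s + W / (2 * Z)) * Z" .
    then show ?thesis using Z unfolding W_def[symmetric] by (simp add: field_simps)
  qed
  then show ?thesis using Z by (intro exI[of _ "1 / (2 * Z)"] conjI exI[of _ "2 * Z"]) auto
qed

lemma bilinear_continuous_on:
  fixes G :: "'e::euclidean_space \<Rightarrow> 'e \<Rightarrow> real"
  assumes "bilinear G"
  shows "continuous_on S (\<lambda>u. G u u)"
  using assms unfolding bilinear_conv_bounded_bilinear
  by (intro bounded_bilinear.continuous_on[of G] continuous_on_id)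

lemma posdef_coercive:
  fixes G :: "'e::euclidean_space \<Rightarrow> 'e \<Rightarrow> real"
  assumes "bilinear G" "\<And>u. u \<noteq> 0 \<Longrightarrow> G u u > 0"
  shows "\<exists>m>0. \<forall>u. m * (norm u)\<^sup>2 \<le> G u u"
proof -
  obtain b :: 'e where "b \<in> Basis" using nonempty_Basis by blast
  then have "sphere (0::'e) 1 \<noteq> {}" by (auto intro!: exI[of _ b])
  then obtain p where p: "p \<in> sphere 0 1" "\<And>u. u \<in> sphere 0 1 \<Longrightarrow> G p p \<le> G u u"
    using continuous_attains_inf[OF compact_sphere _ bilinear_continuous_on[OF assms(1)]] by metis
  have "G p p * (norm u)\<^sup>2 \<le> G u u" for u
  proof (cases "u = 0")
    case True
    then show ?thesis using assms(1) by (simp add: bilinear_lzero)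
  next
    case False
    have "G p p \<le> G (u /\<^sub>R norm u) (u /\<^sub>R norm u)" using False by (intro p) simp
    also have "\<dots> = G u u / (norm u)\<^sup>2"
      using assms(1) by (simp add: bilinear_lmul bilinear_rmul power2_eq_square divide_inverse)
    finally show ?thesis using False by (simp add: field_simps)
  qed
  moreover have "G p p > 0" using p(1) by (intro assms(2)) auto
  ultimately show ?thesis by blast
qed

lemma bilinear_diff:
  assumes "bilinear F" "bilinear G"
  shows "bilinear (\<lambda>u v. F u v - G u v)"
  using assms unfolding bilinear_def by (auto intro: linear_compose_sub)

text \<open>Coercivity at one point comes from compactness of the sphere; continuity of the finitely many
  entries of the form then costs at most half of the constant nearby.\<close>

lemma locally_uniformly_coercive:
  fixes G :: "'a::real_normed_vector \<Rightarrow> 'e::euclidean_space \<Rightarrow> 'e \<Rightarrow> real"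
  assumes "open S" "p \<in> S" and bil: "\<And>y. y \<in> S \<Longrightarrow> bilinear (G y)"
    and pd: "\<And>u. u \<noteq> 0 \<Longrightarrow> G p u u > 0"
    and cont: "\<And>u v. continuous_on S (\<lambda>y. G y u v)"
  shows "\<exists>m>0. \<forall>\<^sub>F y in nhds p. \<forall>u. m * (norm u)\<^sup>2 \<le> G y u u"
proof -
  obtain m where m: "m > 0" "\<And>u. m * (norm u)\<^sup>2 \<le> G p u u"
    using posdef_coercive[OF bil[OF assms(2)] pd] by blast
  define D where "D = real DIM('e)"
  have D: "D > 0" by (simp add: D_def)
  define \<epsilon> where "\<epsilon> = m / (2 * (D * D))"
  have \<epsilon>: "\<epsilon> > 0" using m D by (simp add: \<epsilon>_def)
  have "\<forall>\<^sub>F y in nhds p. \<bar>G y b c - G p b c\<bar> < \<epsilon>" for b c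
  proof -
    have "((\<lambda>y. G y b c) \<longlongrightarrow> G p b c) (nhds p)"
      using cont assms(1,2) continuous_on_eq_continuous_at isCont_def tendsto_at_iff_tendsto_nhds by metis
    then show ?thesis using \<epsilon> by (auto dest!: tendstoD[of _ _ _ \<epsilon>] simp: dist_real_def)
  qed
  then have "\<forall>\<^sub>F y in nhds p. \<forall>b\<in>Basis. \<forall>c\<in>Basis. \<bar>G y b c - G p b c\<bar> < \<epsilon>"
    by (intro eventually_ball_finite ballI) auto
  moreover have "\<forall>\<^sub>F y in nhds p. y \<in> S" using assms eventually_nhds by blast
  ultimately have "\<forall>\<^sub>F y in nhds p. \<forall>u. m / 2 * (norm u)\<^sup>2 \<le> G y u u"
  proof eventually_elim
    case (elim y)
    show ?case
    proof
      fix u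
      have "\<bar>G y u u - G p u u\<bar> \<le> D * (D * \<epsilon>) * norm u * norm u"
        using bilinear_norm_le_Basis[OF bilinear_diff[OF bil[OF elim(2)] bil[OF assms(2)]], of \<epsilon> u u] elim(1)
        unfolding D_def by (simp add: less_imp_le)
      also have "\<dots> = m / 2 * (norm u)\<^sup>2" using D by (simp add: \<epsilon>_def power2_eq_square)
      finally show "m / 2 * (norm u)\<^sup>2 \<le> G y u u" using m(2)[of u] by linarith
    qed
  qed
  then show ?thesis using m(1) by (intro exI[of _ "m / 2"]) auto
qed

lemma posdef_representation:
  fixes G :: "'e::euclidean_space \<Rightarrow> 'e \<Rightarrow> real"
  assumes "bilinear G" "\<And>u. u \<noteq> 0 \<Longrightarrow> G u u > 0" "linear \<rho>"
  shows "\<exists>!u. \<forall>v. G u v = \<rho> v"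
proof -
  define L where "L u = (\<Sum>b\<in>Basis. G u b *\<^sub>R b)" for u
  have L: "L u \<bullet> v = G u v" for u v
    using linear_functional_eq_inner[of "G u" v] assms(1) by (simp add: L_def bilinear_def)
  have lin: "linear L"
    unfolding L_def using assms(1)
    by (intro linear_compose_sum ballI) (auto simp: bilinear_def linear_iff scaleR_add_left)
  have "u = 0" if "L u = 0" for u using L[of u u] assms(2)[of u] that by fastforce
  then have "inj L" using lin by (simp add: linear_injective_0)
  then have "surj L" using lin linear_injective_imp_surjective by blast
  then obtain u where u: "L u = (\<Sum>b\<in>Basis. \<rho> b *\<^sub>R b)" by (metis surjD)
  have "G u v = \<rho> v" for v
    using L[of u v] linear_functional_eq_inner[OF assms(3), of v] unfolding u by simp
  moreover have "u = u'" if "\<forall>v. G u' v = \<rho> v" "\<forall>v. G u v = \<rho> v" for u u'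
  proof -
    have "G (u - u') v = 0" for v using that assms(1) by (simp add: bilinear_lsub)
    then show ?thesis using assms(2)[of "u - u'"] by force
  qed
  ultimately show ?thesis by blast
qed

text \<open>Recovers the size of a vector from finitely many entries; it turns statements about the
  right-hand side of a linear system with coercive form into statements about the solution.\<close>

lemma coercive_norm_le:
  fixes G :: "'e::euclidean_space \<Rightarrow> 'e \<Rightarrow> real"
  assumes "bilinear G" "m > 0" "\<And>u. m * (norm u)\<^sup>2 \<le> G u u"
  shows "norm u \<le> (\<Sum>b\<in>Basis. \<bar>G u b\<bar>) / m"
proof (cases "u = 0")
  case True
  then show ?thesis using assms(2) by (simp add: sum_nonneg)
next
  case False
  have "G u u = (\<Sum>b\<in>Basis. (u \<bullet> b) * G u b)"
    using linear_eq_sum_Basis[of "G u" u] assms(1) by (simp add: bilinear_def)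
  also have "\<dots> \<le> (\<Sum>b\<in>Basis. norm u * \<bar>G u b\<bar>)"
  proof (rule sum_mono)
    fix b :: 'e assume "b \<in> Basis"
    then have "\<bar>u \<bullet> b\<bar> * \<bar>G u b\<bar> \<le> norm u * \<bar>G u b\<bar>"
      by (intro mult_right_mono Basis_le_norm) auto
    then show "(u \<bullet> b) * G u b \<le> norm u * \<bar>G u b\<bar>"
      using abs_ge_self[of "(u \<bullet> b) * G u b"] by (simp add: abs_mult)
  qed
  finally have "m * norm u * norm u \<le> (\<Sum>b\<in>Basis. \<bar>G u b\<bar>) * norm u"
    using assms(3)[of u] by (simp add: power2_eq_square sum_distrib_left mult.commute mult.left_commute)
  then have "m * norm u \<le> (\<Sum>b\<in>Basis. \<bar>G u b\<bar>)" using False by simp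
  then show ?thesis using assms(2) by (simp add: field_simps)
qed

text \<open>At a zero of the differentiable factor the product rule asks for no more than continuity of the
  other factor.\<close>

lemma has_derivative_mult_vanishing:
  fixes k u :: "'a::real_normed_vector \<Rightarrow> real"
  assumes k: "(k has_derivative k') (at p)" "k p = 0" and u: "isCont u p"
  shows "((\<lambda>y. u y * k y) has_derivative (\<lambda>h. u p * k' h)) (at p)"
proof -
  interpret bounded_linear k' using k(1) by (rule has_derivative_bounded_linear)
  let ?n = "\<lambda>y. norm (y - p)"
  have R: "(\<lambda>y. (k y - k' (y - p)) / ?n y) \<midarrow>p\<rightarrow> 0"
    using k unfolding has_derivative_within by simp
  have "(\<lambda>y. (u y - u p) * (k' (y - p) / ?n y)) \<midarrow>p\<rightarrow> 0"
  proof (rule Lim_null_comparison)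
    show "\<forall>\<^sub>F y in at p. norm ((u y - u p) * (k' (y - p) / ?n y)) \<le> \<bar>u y - u p\<bar> * onorm k'"
      using onorm[OF bounded_linear_axioms]
      by (intro always_eventually allI) (auto simp: abs_mult divide_le_eq mult.assoc
          intro!: mult_left_mono onorm_pos_le bounded_linear_axioms)
    show "(\<lambda>y. \<bar>u y - u p\<bar> * onorm k') \<midarrow>p\<rightarrow> 0"
      using u by (intro tendsto_mult_left_zero tendsto_rabs_zero LIM_zero) (simp add: isCont_def)
  qed
  from tendsto_add[OF tendsto_mult[OF u[unfolded isCont_def] R] this]
  have "(\<lambda>y. (u y * k y - u p * k' (y - p)) / ?n y) \<midarrow>p\<rightarrow> 0"
    by (simp add: add_divide_distrib[symmetric] algebra_simps)
  then show "((\<lambda>y. u y * k y) has_derivative (\<lambda>h. u p * k' h)) (at p)"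
    using k(2) bounded_linear_const_mult[OF bounded_linear_axioms]
    by (simp add: has_derivative_within)
qed

section \<open>Solutions of positive definite systems\<close>

context
  fixes S :: "'a::euclidean_space set" and G :: "'a \<Rightarrow> 'e::euclidean_space \<Rightarrow> 'e \<Rightarrow> real"
  assumes op: "open S" and bil: "\<And>y. y \<in> S \<Longrightarrow> bilinear (G y)"
    and pd: "\<And>y u. y \<in> S \<Longrightarrow> u \<noteq> 0 \<Longrightarrow> G y u u > 0"
begin

lemma posdef_system_norm_le:
  assumes "p \<in> S" "\<And>u v. continuous_on S (\<lambda>y. G y u v)"
  shows "\<exists>m>0. \<forall>\<^sub>F y in nhds p. y \<in> S \<and> (\<forall>u. norm u \<le> (\<Sum>b\<in>Basis. \<bar>G y u b\<bar>) / m)"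
proof -
  obtain m where m: "m > 0" "\<forall>\<^sub>F y in nhds p. \<forall>u. m * (norm u)\<^sup>2 \<le> G y u u"
    using locally_uniformly_coercive[OF op assms(1) bil pd[OF assms(1)] assms(2)] by auto
  have "\<forall>\<^sub>F y in nhds p. y \<in> S" using op assms(1) eventually_nhds by blast
  with m(2) have "\<forall>\<^sub>F y in nhds p. y \<in> S \<and> (\<forall>u. norm u \<le> (\<Sum>b\<in>Basis. \<bar>G y u b\<bar>) / m)"
  proof eventually_elim
    case (elim y)
    then show ?case using coercive_norm_le[OF bil \<open>m > 0\<close>] by blast
  qed
  then show ?thesis using m by blast
qed

text \<open>The difference \<open>\<gamma> y - \<gamma> p\<close> solves the system at \<open>y\<close> with right-hand side \<open>\<rho> y - G y (\<gamma> p)\<close>, which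
  tends to zero.\<close>

lemma posdef_solution_continuous:
  assumes cG: "\<And>u v. continuous_on S (\<lambda>y. G y u v)" and c\<rho>: "\<And>v. continuous_on S (\<lambda>y. \<rho> y v)"
    and sol: "\<And>y v. y \<in> S \<Longrightarrow> G y (\<gamma> y) v = \<rho> y v"
  shows "continuous_on S \<gamma>"
  unfolding continuous_on_eq_continuous_at[OF op] isCont_def
proof
  fix p assume p: "p \<in> S"
  obtain m where m: "m > 0" "\<forall>\<^sub>F y in nhds p. y \<in> S \<and> (\<forall>u. norm u \<le> (\<Sum>b\<in>Basis. \<bar>G y u b\<bar>) / m)"
    using posdef_system_norm_le[OF p cG] by blast
  have lim: "((\<lambda>y. (\<Sum>b\<in>Basis. \<bar>\<rho> y b - G y (\<gamma> p) b\<bar>) / m) \<longlongrightarrow>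
      (\<Sum>b\<in>Basis. \<bar>\<rho> p b - G p (\<gamma> p) b\<bar>) / m) (at p)"
    using cG c\<rho> p m(1) unfolding continuous_on_eq_continuous_at[OF op] isCont_def
    by (intro tendsto_divide tendsto_sum tendsto_rabs tendsto_diff tendsto_const) auto
  show "\<gamma> \<midarrow>p\<rightarrow> \<gamma> p"
  proof (rule Lim_null_comparison[THEN Lim_null[THEN iffD2]])
    show "\<forall>\<^sub>F y in at p. norm (\<gamma> y - \<gamma> p) \<le> (\<Sum>b\<in>Basis. \<bar>\<rho> y b - G y (\<gamma> p) b\<bar>) / m"
      using eventually_nhds_conv_at[THEN iffD1, OF m(2), THEN conjunct1]
    proof eventually_elim
      case (elim y)
      then have "norm (\<gamma> y - \<gamma> p) \<le> (\<Sum>b\<in>Basis. \<bar>G y (\<gamma> y - \<gamma> p) b\<bar>) / m" by blast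
      then show ?case using elim sol[of y] bil[of y] by (simp add: bilinear_lsub)
    qed
    show "((\<lambda>y. (\<Sum>b\<in>Basis. \<bar>\<rho> y b - G y (\<gamma> p) b\<bar>) / m) \<longlongrightarrow> 0) (at p)"
      using lim p sol by simp
  qed
qed

text \<open>Freezing the form at \<open>p\<close> leaves \<open>G p (\<gamma> y) = \<rho> y - (G y - G p) (\<gamma> y)\<close>.  The last term is a sum of
  products of continuous factors with differentiable ones that vanish at \<open>p\<close>, so continuity of \<open>\<gamma>\<close>
  already makes the right-hand side differentiable; inverting the fixed form \<open>G p\<close> gives \<open>\<gamma>\<close>.\<close>

lemma posdef_solution_differentiable:
  assumes G1: "\<And>u v. Ck_on 1 (\<lambda>y. G y u v) S" and \<rho>1: "\<And>v. Ck_on 1 (\<lambda>y. \<rho> y v) S"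
    and sol: "\<And>y v. y \<in> S \<Longrightarrow> G y (\<gamma> y) v = \<rho> y v"
    and p: "p \<in> S"
  shows "\<gamma> differentiable (at p)"
proof -
  have "isCont \<gamma> p"
    using posdef_solution_continuous[OF Ck_on_imp_continuous[OF G1] Ck_on_imp_continuous[OF \<rho>1] sol] p
    by (simp add: continuous_on_eq_continuous_at[OF op])
  then have cont: "isCont (\<lambda>y. \<gamma> y \<bullet> b) p" for b by (intro continuous_intros)
  have repr: "(\<Sum>b\<in>Basis. (w \<bullet> b) * G y b v) = G y w v" if "y \<in> S" for y w v
    using linear_eq_sum_Basis[of "\<lambda>u. G y u v" w] bil[OF that] by (simp add: bilinear_def)
  have diff: "(\<lambda>y. G p (\<gamma> y) v) differentiable (at p)" for v
  proof -
    have "((\<lambda>y. \<rho> y v - (\<Sum>b\<in>Basis. (\<gamma> y \<bullet> b) * (G y b v - G p b v))) has_derivative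
        (\<lambda>h. fderiv (\<lambda>y. \<rho> y v) p h - (\<Sum>b\<in>Basis. (\<gamma> p \<bullet> b) * (fderiv (\<lambda>y. G y b v) p h - 0)))) (at p)"
      using Ck_on_has_derivative[OF \<rho>1 _ p] Ck_on_has_derivative[OF G1 _ p]
      by (intro has_derivative_diff has_derivative_sum has_derivative_mult_vanishing has_derivative_const cont) auto
    then have "((\<lambda>y. G p (\<gamma> y) v) has_derivative
        (\<lambda>h. fderiv (\<lambda>y. \<rho> y v) p h - (\<Sum>b\<in>Basis. (\<gamma> p \<bullet> b) * (fderiv (\<lambda>y. G y b v) p h - 0)))) (at p)"
      by (rule has_derivative_transform_within_open[OF _ op p])
         (simp add: right_diff_distrib sum_subtractf repr p sol)
    then show ?thesis by (auto simp: differentiable_def)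
  qed
  define L where "L u = (\<Sum>b\<in>Basis. G p u b *\<^sub>R b)" for u
  have lin: "linear L"
    unfolding L_def using bil[OF p]
    by (intro linear_compose_sum ballI) (auto simp: bilinear_def linear_iff scaleR_add_left)
  moreover have "u = 0" if "L u = 0" for u
    using linear_functional_eq_inner[of "G p u" u] bil[OF p] pd[OF p, of u] that
    unfolding L_def by (fastforce simp: bilinear_def)
  ultimately have "inj L" by (simp add: linear_injective_0)
  then obtain M where M: "linear M" "M \<circ> L = id"
    using linear_injective_left_inverse[OF lin] by blast
  have "(\<lambda>y. L (\<gamma> y)) differentiable (at p)"
    unfolding L_def using has_derivative_scaleR_left[OF fderiv_has_derivative[OF diff]]
    by (intro differentiable_sum) (auto intro: differentiableI)
  then have "(\<lambda>y. M (L (\<gamma> y))) differentiable (at p)"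
    using linear_imp_differentiable[OF M(1)] differentiable_chain_at[of "\<lambda>y. L (\<gamma> y)" p M] by (simp add: o_def)
  then show ?thesis using M(2) by (simp add: o_def fun_eq_iff)
qed

text \<open>The directional derivatives of \<open>\<gamma>\<close> solve the differentiated system, which has the same form and a
  continuous right-hand side.  It is applied to the coordinates of a gradient, where the form is the
  metric.\<close>

theorem posdef_solution_C1:
  assumes G1: "\<And>u v. Ck_on 1 (\<lambda>y. G y u v) S" and \<rho>1: "\<And>v. Ck_on 1 (\<lambda>y. \<rho> y v) S"
    and sol: "\<And>y v. y \<in> S \<Longrightarrow> G y (\<gamma> y) v = \<rho> y v"
  shows "Ck_on 1 \<gamma> S"
proof -
  have diff: "\<gamma> differentiable (at y)" if "y \<in> S" for y
    using posdef_solution_differentiable[OF assms that] .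
  have cG: "continuous_on S (\<lambda>y. G y u v)" for u v using G1 by (rule Ck_on_imp_continuous)
  have c\<rho>: "continuous_on S (\<lambda>y. \<rho> y v)" for v using \<rho>1 by (rule Ck_on_imp_continuous)
  have c\<gamma>: "continuous_on S \<gamma>" by (rule posdef_solution_continuous[OF cG c\<rho> sol])
  have "continuous_on S (\<lambda>y. fderiv \<gamma> y u)" for u
  proof (rule posdef_solution_continuous[OF cG])
    show "continuous_on S (\<lambda>y. fderiv (\<lambda>y. \<rho> y v) y u - (\<Sum>b\<in>Basis. (\<gamma> y \<bullet> b) * fderiv (\<lambda>y. G y b v) y u))" for v
      using \<rho>1[of v] G1[of _ v]
      by (intro continuous_on_diff continuous_on_sum continuous_on_mult continuous_on_inner c\<gamma> continuous_on_const) auto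
    fix y v assume y: "y \<in> S"
    have repr: "(\<Sum>b\<in>Basis. (w \<bullet> b) * G y' b v) = G y' w v" if "y' \<in> S" for y' w
      using linear_eq_sum_Basis[of "\<lambda>u. G y' u v" w] bil[OF that] by (simp add: bilinear_def)
    have "((\<lambda>y. \<Sum>b\<in>Basis. (\<gamma> y \<bullet> b) * G y b v) has_derivative
       (\<lambda>u. \<Sum>b\<in>Basis. (\<gamma> y \<bullet> b) * fderiv (\<lambda>y. G y b v) y u + (fderiv \<gamma> y u \<bullet> b) * G y b v)) (at y)"
      using y diff by (intro has_derivative_sum has_derivative_mult has_derivative_inner_left fderiv_has_derivative
          Ck_on_has_derivative[OF G1]) auto
    then have "((\<lambda>y. \<rho> y v) has_derivative
       (\<lambda>u. \<Sum>b\<in>Basis. (\<gamma> y \<bullet> b) * fderiv (\<lambda>y. G y b v) y u + (fderiv \<gamma> y u \<bullet> b) * G y b v)) (at y)"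
      by (rule has_derivative_transform_within_open[OF _ op y]) (use repr sol in auto)
    from fderiv_eqI[OF this] show "G y (fderiv \<gamma> y u) v =
       fderiv (\<lambda>y. \<rho> y v) y u - (\<Sum>b\<in>Basis. (\<gamma> y \<bullet> b) * fderiv (\<lambda>y. G y b v) y u)"
      using repr[OF y, of "fderiv \<gamma> y u"] by (simp add: sum.distrib)
  qed
  then show ?thesis using diff by simp
qed

end

section \<open>The quadratic subproblem near a strict solution\<close>

text \<open>Stability of a saddle-point system with residual \<open>t\<close> in both blocks.  Testing stationarity with
  \<open>u\<close> itself bounds \<open>u\<close> by coercivity, up to the multipliers \<open>w\<close>; independence of the constraint
  functionals bounds \<open>w\<close> by \<open>u\<close>.  The products of the two unknowns carry the small factor \<open>t\<close>, so the
  circle closes.\<close>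

lemma saddle_point_estimate:
  fixes H :: "'e::real_normed_vector \<Rightarrow> 'e \<Rightarrow> real" and a :: "'i \<Rightarrow> 'e \<Rightarrow> real"
  assumes pos: "0 < m" "0 \<le> M" "0 \<le> \<kappa>" "0 \<le> t"
    and coercive: "m * (norm u)\<^sup>2 \<le> H u u"
    and bounded: "\<And>\<xi>. \<bar>H u \<xi>\<bar> \<le> M * norm u * norm \<xi>"
    and indep: "\<And>s. (\<And>\<xi>. \<bar>\<Sum>l\<in>J. w l * a l \<xi>\<bar> \<le> s * norm \<xi>) \<Longrightarrow> (\<Sum>l\<in>J. \<bar>w l\<bar>) \<le> \<kappa> * s"
    and stationary: "\<And>\<xi>. \<bar>H u \<xi> + (\<Sum>l\<in>J. w l * a l \<xi>)\<bar> \<le> t * norm \<xi>"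
    and feasible: "- (\<Sum>l\<in>J. w l * a l u) \<le> t * (\<Sum>l\<in>J. \<bar>w l\<bar>)"
  shows "norm u \<le> max 1 ((1 + \<kappa> * M + \<kappa>) / m) * t"
    and "(\<Sum>l\<in>J. \<bar>w l\<bar>) \<le> \<kappa> * (M * max 1 ((1 + \<kappa> * M + \<kappa>) / m) + 1) * t"
proof -
  define W where "W = (\<Sum>l\<in>J. \<bar>w l\<bar>)"
  define C where "C = max 1 ((1 + \<kappa> * M + \<kappa>) / m)"
  have "\<bar>\<Sum>l\<in>J. w l * a l \<xi>\<bar> \<le> (M * norm u + t) * norm \<xi>" for \<xi>
    using bounded[of \<xi>] stationary[of \<xi>] by (simp add: distrib_right)
  then have W: "W \<le> \<kappa> * (M * norm u + t)" unfolding W_def by (rule indep)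
  have "m * (norm u)\<^sup>2 \<le> t * norm u + t * W"
    using stationary[of u] feasible coercive unfolding W_def by linarith
  also have "\<dots> \<le> t * norm u + t * (\<kappa> * (M * norm u + t))"
    using W pos by (simp add: mult_left_mono)
  finally have main: "m * (norm u)\<^sup>2 \<le> t * norm u + t * (\<kappa> * (M * norm u + t))" .
  show u: "norm u \<le> C * t"
  proof (cases "norm u \<le> t")
    case True
    also have "t \<le> C * t" using pos by (simp add: C_def mult_le_cancel_right1)
    finally show ?thesis .
  next
    case False
    then have nu: "norm u > 0" using pos by linarith
    \<comment> \<open>For a vector longer than \<open>t\<close> the term quadratic in
      \<open>t\<close> is absorbed, and \<open>norm u\<close> can be cancelled.\<close>
    have "t * (\<kappa> * t) \<le> t * (\<kappa> * norm u)"
      using False pos by (intro mult_left_mono) auto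
    then have "m * (norm u)\<^sup>2 \<le> ((1 + \<kappa> * M + \<kappa>) * t) * norm u"
      using main by (simp add: algebra_simps)
    then have "m * norm u \<le> (1 + \<kappa> * M + \<kappa>) * t"
      using nu by (simp add: power2_eq_square)
    then have "norm u \<le> (1 + \<kappa> * M + \<kappa>) / m * t" using pos by (simp add: field_simps)
    also have "\<dots> \<le> C * t" using pos by (intro mult_right_mono) (auto simp: C_def)
    finally show ?thesis .
  qed
  have "M * norm u \<le> M * (C * t)" using u pos by (intro mult_left_mono) auto
  then have "\<kappa> * (M * norm u + t) \<le> \<kappa> * (M * (C * t) + t)"
    using pos by (intro mult_left_mono) auto
  then show "W \<le> \<kappa> * (M * C + 1) * t" using W by (simp add: algebra_simps)
qed

text \<open>The data of one subproblem in coordinates at distance at most \<open>e\<close> from the solution: \<open>z\<close> is the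
  position relative to the solution, \<open>d\<close> the step, \<open>H\<close> the quadratic form, \<open>p\<close> the differential of the
  Lagrangian with the optimal multipliers \<open>\<eta>s\<close>, \<open>c l\<close> and \<open>a l\<close> the values and differentials of the
  constraints, \<open>\<eta>\<close> the multipliers of the subproblem.  \<open>I\<close>, \<open>J\<close> and \<open>E\<close> index all constraints, those
  active at the solution, and the equalities.  All constants are independent of \<open>e\<close>, and the two
  Taylor hypotheses are what makes the step a Newton step.\<close>

locale newton_qp =
  fixes I J E :: "'i set" and \<eta>s :: "'i \<Rightarrow> real" and m K \<kappa> \<sigma> e :: real
    and z d :: "'e::real_normed_vector" and H :: "'e \<Rightarrow> 'e \<Rightarrow> real" and p :: "'e \<Rightarrow> real"
    and c :: "'i \<Rightarrow> real" and a :: "'i \<Rightarrow> 'e \<Rightarrow> real" and \<eta> :: "'i \<Rightarrow> real"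
  assumes sets: "finite I" "J \<subseteq> I" "E \<subseteq> J"
    and pos: "0 < m" "0 \<le> K" "0 \<le> \<kappa>" "0 < \<sigma>" "0 \<le> e"
    and inactive: "\<And>l. l \<in> I - J \<Longrightarrow> \<eta>s l = 0" "\<And>l. l \<in> I - J \<Longrightarrow> c l \<le> - \<sigma>"
    and strict: "\<And>l. l \<in> J - E \<Longrightarrow> \<sigma> \<le> \<eta>s l"
    and H_add: "\<And>u v \<xi>. H (u + v) \<xi> = H u \<xi> + H v \<xi>"
    and H_coercive: "\<And>u. m * (norm u)\<^sup>2 \<le> H u u"
    and H_bounded: "\<And>u v. \<bar>H u v\<bar> \<le> K * norm u * norm v"
    and p_small: "\<And>\<xi>. \<bar>p \<xi>\<bar> \<le> K * e * norm \<xi>"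
    and p_Taylor: "\<And>\<xi>. \<bar>p \<xi> - H z \<xi>\<bar> \<le> K * e\<^sup>2 * norm \<xi>"
    and a_add: "\<And>l u v. l \<in> I \<Longrightarrow> a l (u + v) = a l u + a l v"
    and a_bounded: "\<And>l \<xi>. l \<in> I \<Longrightarrow> \<bar>a l \<xi>\<bar> \<le> K * norm \<xi>"
    and c_small: "\<And>l. l \<in> J \<Longrightarrow> \<bar>c l\<bar> \<le> K * e"
    and c_Taylor: "\<And>l. l \<in> J \<Longrightarrow> \<bar>c l - a l z\<bar> \<le> K * e\<^sup>2"
    and indep: "\<And>w s. (\<And>\<xi>. \<bar>\<Sum>l\<in>J. w l * a l \<xi>\<bar> \<le> s * norm \<xi>) \<Longrightarrow> (\<Sum>l\<in>J. \<bar>w l\<bar>) \<le> \<kappa> * s"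
    and stationary: "\<And>\<xi>. H d \<xi> + p \<xi> + (\<Sum>l\<in>I. (\<eta> l - \<eta>s l) * a l \<xi>) = 0"
    and equality: "\<And>l. l \<in> E \<Longrightarrow> c l + a l d = 0"
    and inequality: "\<And>l. l \<in> I - E \<Longrightarrow> c l + a l d \<le> 0" "\<And>l. l \<in> I - E \<Longrightarrow> 0 \<le> \<eta> l"
      "\<And>l. l \<in> I - E \<Longrightarrow> \<eta> l * (c l + a l d) = 0"
    and \<eta>_bounded: "\<And>l. l \<in> I \<Longrightarrow> \<bar>\<eta> l - \<eta>s l\<bar> \<le> K"
begin

abbreviation "mult_err l \<equiv> \<eta> l - \<eta>s l"

definition primal_gain where "primal_gain = max 1 ((1 + \<kappa> * K + \<kappa>) / m) * K"
definition dual_gain where "dual_gain = \<kappa> * (K * max 1 ((1 + \<kappa> * K + \<kappa>) / m) + 1) * K"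
text \<open>A step of this length changes the linearised inactive constraints by less than their slack \<open>\<sigma>\<close>.\<close>

definition step_bound where "step_bound = \<sigma> / (2 * (K + 1))"

lemma saddle_point:
  assumes "0 \<le> t"
    and "\<And>\<xi>. \<bar>H u \<xi> + (\<Sum>l\<in>J. w l * a l \<xi>)\<bar> \<le> t * norm \<xi>"
    and "- (\<Sum>l\<in>J. w l * a l u) \<le> t * (\<Sum>l\<in>J. \<bar>w l\<bar>)"
  shows "norm u \<le> max 1 ((1 + \<kappa> * K + \<kappa>) / m) * t"
    and "(\<Sum>l\<in>J. \<bar>w l\<bar>) \<le> \<kappa> * (K * max 1 ((1 + \<kappa> * K + \<kappa>) / m) + 1) * t"
proof -
  have J: "(\<Sum>l\<in>J. \<bar>w l\<bar>) \<le> \<kappa> * s" if "\<And>\<xi>. \<bar>\<Sum>l\<in>J. w l * a l \<xi>\<bar> \<le> s * norm \<xi>" for s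
    using that by (rule indep)
  show "norm u \<le> max 1 ((1 + \<kappa> * K + \<kappa>) / m) * t"
    by (rule saddle_point_estimate(1)[where H = H and a = a and M = K])
       (fact pos assms H_coercive H_bounded J)+
  show "(\<Sum>l\<in>J. \<bar>w l\<bar>) \<le> \<kappa> * (K * max 1 ((1 + \<kappa> * K + \<kappa>) / m) + 1) * t"
    by (rule saddle_point_estimate(2)[where H = H and a = a and M = K])
       (fact pos assms H_coercive H_bounded J)+
qed

lemma finite_J: "finite J" using sets finite_subset by blast

lemma step_bound_pos: "step_bound > 0"
  unfolding step_bound_def using pos by simp

text \<open>Feasibility and complementarity in the subproblem, together with the sign of the optimal
  multipliers, make the pairing of the multiplier difference with the step one-sided.\<close>

lemma multiplier_term: "l \<in> I \<Longrightarrow> - (mult_err l * a l d) \<le> mult_err l * c l"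
proof (cases "l \<in> E")
  case True
  then show ?thesis using equality[OF True] by (metis add.inverse_unique add.commute minus_mult_right order_refl)
next
  case False
  assume l: "l \<in> I"
  have "0 \<le> \<eta>s l"
    using inactive(1)[of l] strict[of l] l False pos by (cases "l \<in> J") auto
  then have "mult_err l * (c l + a l d) \<ge> 0"
    using inequality[of l] l False mult_nonneg_nonpos[of "\<eta>s l" "c l + a l d"]
    by (auto simp: left_diff_distrib)
  then show ?thesis by (simp add: algebra_simps)
qed

lemma feasible_sum: "- (\<Sum>l\<in>I. mult_err l * a l d) \<le> K * e * (\<Sum>l\<in>J. \<bar>mult_err l\<bar>)"
proof -
  have "- (\<Sum>l\<in>I. mult_err l * a l d) \<le> (\<Sum>l\<in>I. mult_err l * c l)"
    by (simp add: sum_negf[symmetric] sum_mono multiplier_term)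
  also have "\<dots> = (\<Sum>l\<in>J. mult_err l * c l) + (\<Sum>l\<in>I-J. mult_err l * c l)"
    using sum.subset_diff[OF sets(2,1), of "\<lambda>l. mult_err l * c l"] by simp
  also have "\<dots> \<le> (\<Sum>l\<in>J. K * e * \<bar>mult_err l\<bar>) + 0"
  proof (intro add_mono sum_mono sum_nonpos)
    fix l assume "l \<in> J"
    have "mult_err l * c l \<le> \<bar>c l\<bar> * \<bar>mult_err l\<bar>"
      by (metis abs_ge_self abs_mult mult.commute)
    also have "\<dots> \<le> K * e * \<bar>mult_err l\<bar>"
      using c_small[OF \<open>l \<in> J\<close>] by (intro mult_right_mono) auto
    finally show "mult_err l * c l \<le> K * e * \<bar>mult_err l\<bar>" .
  next
    fix l assume l: "l \<in> I - J"
    then have "0 \<le> \<eta> l" using inequality(2)[of l] sets by auto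
    then show "mult_err l * c l \<le> 0"
      using inactive[OF l] pos by (simp add: mult_nonneg_nonpos)
  qed
  finally show ?thesis by (simp add: sum_distrib_left)
qed

text \<open>The first rough bound: \<open>m * (norm d)\<^sup>2\<close> is at most of order \<open>e * (norm d + 1)\<close> as long as the
  multipliers are merely bounded.\<close>

lemma step_small:
  assumes e: "e * (K + K * K * real (card I) / step_bound) < m * step_bound"
  shows "norm d \<le> step_bound"
proof (rule ccontr)
  assume "\<not> norm d \<le> step_bound"
  then have nd: "norm d > step_bound" "norm d > 0" using step_bound_pos by auto
  have "(\<Sum>l\<in>J. \<bar>mult_err l\<bar>) \<le> (\<Sum>l\<in>J. K)"
    using \<eta>_bounded sets by (intro sum_mono) auto
  also have "\<dots> \<le> real (card I) * K"
    using pos sets card_mono[OF sets(1,2)] by (simp add: mult_right_mono)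
  finally have W: "K * e * (\<Sum>l\<in>J. \<bar>mult_err l\<bar>) \<le> K * e * (real (card I) * K)"
    using pos by (intro mult_left_mono) auto
  have "m * (norm d)\<^sup>2 \<le> K * e * norm d + K * e * (real (card I) * K)"
    using H_coercive[of d] stationary[of d] p_small[of d] feasible_sum W by linarith
  also have "K * e * (real (card I) * K) \<le> (K * e * (real (card I) * K)) * (norm d / step_bound)"
    using mult_left_mono[of 1 "norm d / step_bound" "K * e * (real (card I) * K)"] nd pos step_bound_pos
    by simp
  finally have "m * (norm d)\<^sup>2 \<le> e * (K + K * K * real (card I) / step_bound) * norm d"
    by (simp add: algebra_simps)
  then have "m * norm d \<le> e * (K + K * K * real (card I) / step_bound)"
    using nd by (simp add: power2_eq_square)
  moreover have "m * step_bound < m * norm d" using nd pos by simp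
  ultimately show False using e by linarith
qed

lemma inactive_multiplier_zero:
  assumes "norm d \<le> step_bound" "l \<in> I - J"
  shows "\<eta> l = 0"
proof -
  have "\<bar>a l d\<bar> \<le> K * norm d" using a_bounded assms by auto
  also have "\<dots> \<le> K * step_bound" using assms pos by (intro mult_left_mono) auto
  also have "\<dots> < \<sigma>" unfolding step_bound_def using pos by (simp add: field_simps add_nonneg_pos)
  finally have "c l + a l d < 0" using inactive(2)[OF assms(2)] by linarith
  then show ?thesis using inequality(3)[of l] assms sets by auto
qed

lemma sum_active:
  assumes "norm d \<le> step_bound"
  shows "(\<Sum>l\<in>I. mult_err l * a l \<xi>) = (\<Sum>l\<in>J. mult_err l * a l \<xi>)"
  by (rule sum.mono_neutral_right)
     (use sets inactive(1) inactive_multiplier_zero[OF assms] in auto)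

text \<open>Once the inactive multipliers vanish, only functionals that are independent remain, and the
  saddle-point estimate applies with residual of order \<open>e\<close>.\<close>

lemma first_order_bounds:
  assumes "norm d \<le> step_bound"
  shows "norm d \<le> primal_gain * e" "(\<Sum>l\<in>J. \<bar>mult_err l\<bar>) \<le> dual_gain * e"
proof -
  have "0 \<le> K * e" using pos by simp
  moreover have "\<bar>H d \<xi> + (\<Sum>l\<in>J. mult_err l * a l \<xi>)\<bar> \<le> (K * e) * norm \<xi>" for \<xi>
    using stationary[of \<xi>] p_small[of \<xi>] sum_active[OF assms] by (simp add: mult.assoc)
  moreover have "- (\<Sum>l\<in>J. mult_err l * a l d) \<le> (K * e) * (\<Sum>l\<in>J. \<bar>mult_err l\<bar>)"
    using feasible_sum sum_active[OF assms] by simp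
  ultimately show "norm d \<le> primal_gain * e" "(\<Sum>l\<in>J. \<bar>mult_err l\<bar>) \<le> dual_gain * e"
    using saddle_point[of "K * e" d mult_err]
    unfolding primal_gain_def dual_gain_def by (simp_all add: mult.assoc)
qed

text \<open>This is where strict complementarity enters: multipliers close to positive ones are positive.\<close>

lemma active_constraints_tight:
  assumes "norm d \<le> step_bound" "dual_gain * e < \<sigma>" "l \<in> J"
  shows "c l + a l d = 0"
proof (cases "l \<in> E")
  case True
  then show ?thesis by (rule equality)
next
  case False
  have "\<bar>mult_err l\<bar> \<le> (\<Sum>l\<in>J. \<bar>mult_err l\<bar>)"
    using assms(3) finite_J by (intro member_le_sum) auto
  then have "\<eta> l > 0"
    using first_order_bounds(2)[OF assms(1)] assms(2) strict[of l] False assms(3) by auto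
  then show ?thesis using inequality(3)[of l] False assms(3) sets by auto
qed

text \<open>The new relative position \<open>z + d\<close> solves the same saddle-point system with residual of order \<open>e\<^sup>2\<close>:
  replacing \<open>d\<close> by \<open>z + d\<close> replaces the differential and the constraint values by their first-order
  Taylor errors.\<close>

lemma second_order_bounds:
  assumes "norm d \<le> step_bound" "dual_gain * e < \<sigma>"
  shows "norm (z + d) \<le> primal_gain * e\<^sup>2" "(\<Sum>l\<in>J. \<bar>mult_err l\<bar>) \<le> dual_gain * e\<^sup>2"
proof -
  have "0 \<le> K * e\<^sup>2" using pos by simp
  moreover have "\<bar>H (z + d) \<xi> + (\<Sum>l\<in>J. mult_err l * a l \<xi>)\<bar> \<le> (K * e\<^sup>2) * norm \<xi>" for \<xi>
    using stationary[of \<xi>] p_Taylor[of \<xi>] sum_active[OF assms(1), of \<xi>] H_add[of z d \<xi>] by linarith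
  moreover have "- (\<Sum>l\<in>J. mult_err l * a l (z + d)) \<le> (K * e\<^sup>2) * (\<Sum>l\<in>J. \<bar>mult_err l\<bar>)"
  proof -
    have "- (mult_err l * a l (z + d)) \<le> (K * e\<^sup>2) * \<bar>mult_err l\<bar>" if "l \<in> J" for l
    proof -
      have "\<bar>a l (z + d)\<bar> \<le> K * e\<^sup>2"
        using active_constraints_tight[OF assms that] c_Taylor[OF that] a_add[of l z d] that sets by auto
      then have "\<bar>mult_err l\<bar> * \<bar>a l (z + d)\<bar> \<le> \<bar>mult_err l\<bar> * (K * e\<^sup>2)" by (intro mult_left_mono) auto
      then show ?thesis by (simp only: abs_mult[symmetric]) (simp add: mult.commute)
    qed
    then show ?thesis by (simp add: sum_negf[symmetric] sum_distrib_left sum_mono)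
  qed
  ultimately show "norm (z + d) \<le> primal_gain * e\<^sup>2" "(\<Sum>l\<in>J. \<bar>mult_err l\<bar>) \<le> dual_gain * e\<^sup>2"
    using saddle_point[of "K * e\<^sup>2" "z + d" mult_err]
    unfolding primal_gain_def dual_gain_def by (simp_all add: mult.assoc)
qed

end

text \<open>The threshold \<open>\<delta>\<close> guarantees both the rough bound on the step and the positivity of the active
  multipliers, and depends only on the constants.\<close>

theorem newton_qp_quadratic_step:
  fixes I :: "'i set"
  assumes "0 < m" "0 \<le> K" "0 \<le> \<kappa>" "0 < \<sigma>"
  shows "\<exists>\<delta>>0. \<exists>C\<ge>0. \<forall>e z d H p c a \<eta>.
    newton_qp I J E \<eta>s m K \<kappa> \<sigma> e (z::'e::real_normed_vector) d H p c a \<eta> \<longrightarrow> e \<le> \<delta> \<longrightarrow>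
    norm d \<le> C * e \<and> norm (z + d) \<le> C * e\<^sup>2 \<and> (\<forall>l\<in>I. \<bar>\<eta> l - \<eta>s l\<bar> \<le> C * e\<^sup>2)"
proof -
  define C1 where "C1 = max 1 ((1 + \<kappa> * K + \<kappa>) / m) * K"
  define C2 where "C2 = \<kappa> * (K * max 1 ((1 + \<kappa> * K + \<kappa>) / m) + 1) * K"
  define \<tau> where "\<tau> = \<sigma> / (2 * (K + 1))"
  define Q where "Q = K + K * K * real (card I) / \<tau>"
  define \<delta> where "\<delta> = min (m * \<tau> / (2 * (Q + 1))) (\<sigma> / (2 * (C2 + 1)))"
  define C where "C = C1 + C2"
  have C: "C1 \<ge> 0" "C2 \<ge> 0" using assms unfolding C1_def C2_def by (auto intro!: mult_nonneg_nonneg add_nonneg_nonneg)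
  have \<tau>: "\<tau> > 0" unfolding \<tau>_def using assms by simp
  have Q: "Q \<ge> 0" unfolding Q_def using assms \<tau> by simp
  have \<delta>: "\<delta> > 0" unfolding \<delta>_def using assms \<tau> Q C by simp
  have "norm d \<le> C * e \<and> norm (z + d) \<le> C * e\<^sup>2 \<and> (\<forall>l\<in>I. \<bar>\<eta> l - \<eta>s l\<bar> \<le> C * e\<^sup>2)"
    if "newton_qp I J E \<eta>s m K \<kappa> \<sigma> e z d H p c a \<eta>" "e \<le> \<delta>" for e z d H p c a \<eta>
  proof -
    interpret newton_qp I J E \<eta>s m K \<kappa> \<sigma> e z d H p c a \<eta> by fact
    have e0: "0 \<le> e" by (rule pos)
    have "e * Q \<le> m * \<tau> / (2 * (Q + 1)) * Q"
      using that(2) Q by (intro mult_right_mono) (auto simp: \<delta>_def)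
    also have "\<dots> < m * \<tau>" using Q \<tau> assms(1) by (simp add: field_simps add_nonneg_pos)
    finally have "norm d \<le> step_bound"
      using step_small unfolding Q_def \<tau>_def step_bound_def by blast
    moreover have "C2 * e < \<sigma>"
    proof -
      have "C2 * e \<le> C2 * (\<sigma> / (2 * (C2 + 1)))"
        using that(2) C by (intro mult_left_mono) (auto simp: \<delta>_def)
      also have "\<dots> < \<sigma>" using C assms(4) by (simp add: field_simps add_nonneg_pos)
      finally show ?thesis .
    qed
    ultimately have b: "norm d \<le> C1 * e" "norm (z + d) \<le> C1 * e\<^sup>2" "(\<Sum>l\<in>J. \<bar>\<eta> l - \<eta>s l\<bar>) \<le> C2 * e\<^sup>2"
      and sb: "norm d \<le> step_bound"
      using first_order_bounds second_order_bounds unfolding C1_def C2_def primal_gain_def dual_gain_def by auto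
    have mono: "C1 * e \<le> C * e" "C1 * e\<^sup>2 \<le> C * e\<^sup>2" "C2 * e\<^sup>2 \<le> C * e\<^sup>2"
      unfolding C_def using C e0 by (auto intro!: mult_right_mono)
    have "\<bar>\<eta> l - \<eta>s l\<bar> \<le> C * e\<^sup>2" if "l \<in> I" for l
    proof (cases "l \<in> J")
      case True
      have "\<bar>\<eta> l - \<eta>s l\<bar> \<le> (\<Sum>l\<in>J. \<bar>\<eta> l - \<eta>s l\<bar>)"
        using True finite_J by (intro member_le_sum) auto
      then show ?thesis using b mono by linarith
    next
      case False
      then have "\<eta> l - \<eta>s l = 0" using inactive(1)[of l] inactive_multiplier_zero[OF sb, of l] that by auto
      then show ?thesis using C e0 by (simp add: C_def)
    qed
    then show ?thesis using b mono by fastforce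
  qed
  moreover have "C \<ge> 0" using C by (simp add: C_def)
  ultimately show ?thesis using \<delta> by blast
qed

section \<open>A Newton step for a constrained problem in coordinates\<close>

definition C2_bound :: "('e::euclidean_space \<Rightarrow> real) \<Rightarrow> 'e \<Rightarrow> real \<Rightarrow> 'e \<Rightarrow> bool" where
  "C2_bound F p K y \<longleftrightarrow> linear (fderiv F y) \<and>
     \<bar>F y - F p\<bar> \<le> K * norm (y - p) \<and> \<bar>F y - F p - fderiv F y (y - p)\<bar> \<le> K * (norm (y - p))\<^sup>2 \<and>
     (\<forall>v. \<bar>fderiv F y v\<bar> \<le> K * norm v) \<and> (\<forall>v. \<bar>fderiv F y v - fderiv F p v\<bar> \<le> K * norm (y - p) * norm v) \<and>
     (\<forall>u v. \<bar>fderiv2 F y u v\<bar> \<le> K * norm u * norm v)"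

text \<open>The expansion of the differential is based at \<open>y\<close>, because the second derivative in the
  subproblem is taken at the iterate.\<close>

definition C3_bound :: "('e::euclidean_space \<Rightarrow> real) \<Rightarrow> 'e \<Rightarrow> real \<Rightarrow> 'e \<Rightarrow> bool" where
  "C3_bound F p K y \<longleftrightarrow> (\<forall>v. \<bar>fderiv F y v - fderiv F p v - fderiv2 F y (y - p) v\<bar>
     \<le> K * (norm (y - p))\<^sup>2 * norm v)"

lemma C2_bound_mono: "C2_bound F p K y \<Longrightarrow> K \<le> K' \<Longrightarrow> C2_bound F p K' y"
  unfolding C2_bound_def by (elim conjE, intro conjI allI) (meson order.trans mult_right_mono norm_ge_zero zero_le_power2)+

lemma C3_bound_mono: "C3_bound F p K y \<Longrightarrow> K \<le> K' \<Longrightarrow> C3_bound F p K' y"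
  unfolding C3_bound_def by (intro allI) (meson order.trans mult_right_mono norm_ge_zero zero_le_power2)

lemma eventually_uniform_bound:
  assumes "finite I" "\<And>l. l \<in> I \<Longrightarrow> \<exists>K\<ge>(0::real). \<forall>\<^sub>F y in F. P l K y"
    and mono: "\<And>l K K' y. P l K y \<Longrightarrow> K \<le> K' \<Longrightarrow> P l K' y"
  shows "\<exists>K\<ge>0. \<forall>\<^sub>F y in F. \<forall>l\<in>I. P l K y"
proof -
  obtain K where K: "\<And>l. l \<in> I \<Longrightarrow> K l \<ge> 0" "\<And>l. l \<in> I \<Longrightarrow> \<forall>\<^sub>F y in F. P l (K l) y"
    using assms(2) by metis
  have "\<forall>\<^sub>F y in F. \<forall>l\<in>I. P l (K l) y" using K(2) assms(1) by (intro eventually_ball_finite ballI) auto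
  then have "\<forall>\<^sub>F y in F. \<forall>l\<in>I. P l (sum K I) y"
  proof eventually_elim
    case (elim y)
    have "K l \<le> sum K I" if "l \<in> I" for l using that K(1) assms(1) by (intro member_le_sum) auto
    then show ?case using elim mono by blast
  qed
  then show ?thesis using K(1) sum_nonneg by blast
qed

text \<open>Linearity in \<open>v\<close>, the direction of the inner derivative, needs the linearity of the inner
  differentials on a whole neighbourhood.\<close>

lemma fderiv_fderiv_bilinear:
  fixes F :: "'e::euclidean_space \<Rightarrow> real"
  assumes S: "open S" "y \<in> S" and F: "Ck_on 2 F S"
  shows "bilinear (\<lambda>u v. fderiv2 F y u v)"
proof -
  have d: "(\<lambda>z. fderiv F z v) differentiable (at y)" for v
    using Ck_on_differentiable[OF Ck_on_fderiv[OF F, of 1 v]] S by simp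
  have lin: "linear (fderiv F z)" if "z \<in> S" for z
    using Ck_on_differentiable[OF F _ that] by (intro linear_frechet_derivative) auto
  have "fderiv (\<lambda>z. fderiv F z (v + w)) y = (\<lambda>u. fderiv2 F y u v + fderiv2 F y u w)" for v w
    by (rule fderiv_eqI, rule has_derivative_transform_within_open[OF _ S])
       (rule has_derivative_add[OF fderiv_has_derivative[OF d[of v]] fderiv_has_derivative[OF d[of w]]], use linear_add[OF lin] in auto)
  moreover have "fderiv (\<lambda>z. fderiv F z (t *\<^sub>R v)) y = (\<lambda>u. t *\<^sub>R fderiv2 F y u v)" for t v
    by (rule fderiv_eqI, rule has_derivative_transform_within_open[OF _ S])
       (rule has_derivative_scaleR_right[OF fderiv_has_derivative[OF d[of v]]], use linear_scale[OF lin] in auto)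
  ultimately have "linear (\<lambda>v. fderiv2 F y u v)" for u by (intro linearI) auto
  then show ?thesis using d unfolding bilinear_def by (auto intro: linear_frechet_derivative)
qed

lemma eventually_C2_bound:
  fixes F :: "'e::euclidean_space \<Rightarrow> real"
  assumes S: "open S" "p \<in> S" and F: "Ck_on 2 F S"
  shows "\<exists>K\<ge>0. \<forall>\<^sub>F y in nhds p. C2_bound F p K y"
proof -
  have F1: "Ck_on 1 F S" by (rule Ck_on_mono[OF F]) simp
  have F2: "Ck_on 1 (\<lambda>z. fderiv F z b) S" for b using Ck_on_fderiv[OF F, of 1 b] by simp
  obtain \<delta>1 K1 where 1: "\<delta>1 > 0" "K1 \<ge> 0"
    "\<And>x y. x \<in> ball p \<delta>1 \<Longrightarrow> y \<in> ball p \<delta>1 \<Longrightarrow> norm (F x - F y) \<le> K1 * norm (x - y)"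
    using C1_locally_Lipschitz[OF S F1] by metis
  obtain \<delta>2 K2 where 2: "\<delta>2 > 0" "K2 \<ge> 0"
    "\<And>x y. x \<in> ball p \<delta>2 \<Longrightarrow> y \<in> ball p \<delta>2 \<Longrightarrow> norm (F y - F x - fderiv F x (y - x)) \<le> K2 * (norm (y - x))\<^sup>2"
    using C2_Taylor[OF S F] by metis
  obtain K3 where 3: "K3 \<ge> 0" "\<forall>\<^sub>F y in nhds p. \<forall>v. norm (fderiv F y v) \<le> K3 * norm v"
    using C1_fderiv_bounded[OF S F1] by blast
  have "\<exists>K\<ge>0. \<forall>\<^sub>F y in nhds p. norm (fderiv F y b - fderiv F p b) \<le> K * norm (y - p)" for b
  proof -
    obtain \<delta> K where K: "\<delta> > 0" "K \<ge> 0"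
      "\<And>x y. x \<in> ball p \<delta> \<Longrightarrow> y \<in> ball p \<delta> \<Longrightarrow> norm (fderiv F x b - fderiv F y b) \<le> K * norm (x - y)"
      using C1_locally_Lipschitz[OF S F2[of b]] by metis
    have "\<forall>\<^sub>F y in nhds p. y \<in> ball p \<delta>" using K(1) by (intro eventually_nhds_in_open) auto
    then have "\<forall>\<^sub>F y in nhds p. norm (fderiv F y b - fderiv F p b) \<le> K * norm (y - p)"
      by eventually_elim (use K(1,3) in auto)
    then show ?thesis using K(2) by blast
  qed
  then have "\<exists>K\<ge>0. \<forall>\<^sub>F y in nhds p. \<forall>b\<in>Basis. norm (fderiv F y b - fderiv F p b) \<le> K * norm (y - p)"
    by (intro eventually_uniform_bound finite_Basis) (auto, meson order.trans mult_right_mono norm_ge_zero)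
  then obtain K4 where 4: "K4 \<ge> 0" "\<forall>\<^sub>F y in nhds p. \<forall>b\<in>Basis. norm (fderiv F y b - fderiv F p b) \<le> K4 * norm (y - p)"
    by blast
  have "\<exists>K\<ge>0. \<forall>\<^sub>F y in nhds p. \<forall>b\<in>Basis. \<forall>u. norm (fderiv2 F y u b) \<le> K * norm u"
    by (rule eventually_uniform_bound[where P = "\<lambda>b K y. \<forall>u. norm (fderiv2 F y u b) \<le> K * norm u",
          OF finite_Basis C1_fderiv_bounded[OF S F2]])
       (meson order.trans mult_right_mono norm_ge_zero)
  then obtain K5 where 5: "K5 \<ge> 0" "\<forall>\<^sub>F y in nhds p. \<forall>b\<in>Basis. \<forall>u. norm (fderiv2 F y u b) \<le> K5 * norm u"
    by blast
  define n where "n = real DIM('e)"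
  define K where "K = K1 + K2 + K3 + n * K4 + n * (n * K5)"
  have n: "n \<ge> 0" by (simp add: n_def)
  have K: "K1 \<le> K" "K2 \<le> K" "K3 \<le> K" "n * K4 \<le> K" "n * (n * K5) \<le> K" "K \<ge> 0"
    unfolding K_def using 1 2 3 4 5 n by simp_all
  have inS: "\<forall>\<^sub>F y in nhds p. y \<in> S" using S by (intro eventually_nhds_in_open)
  have b1: "\<forall>\<^sub>F y in nhds p. y \<in> ball p \<delta>1" using 1(1) by (intro eventually_nhds_in_open) auto
  have b2: "\<forall>\<^sub>F y in nhds p. y \<in> ball p \<delta>2" using 2(1) by (intro eventually_nhds_in_open) auto
  have lin: "linear (fderiv F z)" if "z \<in> S" for z
    using Ck_on_differentiable[OF F _ that] by (intro linear_frechet_derivative) auto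
  have "\<forall>\<^sub>F y in nhds p. C2_bound F p K y"
    using inS b1 b2 3(2) 4(2) 5(2)
  proof eventually_elim
    case (elim y)
    have "\<bar>F y - F p\<bar> \<le> K1 * norm (y - p)" using 1(3)[OF elim(2), of p] 1(1) by simp
    moreover have "\<bar>F y - F p - fderiv F y (y - p)\<bar> \<le> K2 * (norm (y - p))\<^sup>2"
    proof -
      have "fderiv F y (p - y) = - fderiv F y (y - p)"
        using linear_neg[OF lin[OF elim(1)], of "y - p"] by simp
      then show ?thesis using 2(3)[OF elim(3), of p] 2(1) by (simp add: norm_minus_commute abs_minus_commute)
    qed
    moreover have "\<bar>fderiv F y v - fderiv F p v\<bar> \<le> n * K4 * norm (y - p) * norm v" for v
      using linear_norm_le_Basis[OF linear_compose_sub[OF lin[OF elim(1)] lin[OF S(2)]], of "K4 * norm (y - p)" v] elim(5)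
      by (simp add: n_def mult.assoc)
    moreover have "\<bar>fderiv2 F y u v\<bar> \<le> n * (n * K5) * norm u * norm v" for u v
    proof -
      have "norm (fderiv2 F y a b) \<le> K5" if "a \<in> Basis" "b \<in> Basis" for a b
        using elim(6)[rule_format, of b a] that by simp
      then show ?thesis
        using bilinear_norm_le_Basis[OF fderiv_fderiv_bilinear[OF S(1) elim(1) F], where K = K5 and u = u and v = v]
        by (simp add: n_def)
    qed
    moreover have up: "a \<le> K * norm u * norm v" if "a \<le> k * norm u * norm v" "k \<le> K" for a k and u v :: 'e
      using that by (meson mult_right_mono norm_ge_zero order.trans)
    ultimately show ?case
      unfolding C2_bound_def using elim(4) lin[OF elim(1)] K
      by (intro conjI allI) (auto intro: order.trans[OF _ mult_right_mono] up[OF _ K(4)] up[OF _ K(5)])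
  qed
  then show ?thesis using K(6) by blast
qed

text \<open>The Taylor estimate for class \<open>C\<^sup>2\<close>, applied to the directional derivatives along a basis.\<close>

lemma eventually_C3_bound:
  fixes F :: "'e::euclidean_space \<Rightarrow> real"
  assumes S: "open S" "p \<in> S" and F: "Ck_on 3 F S"
  shows "\<exists>K\<ge>0. \<forall>\<^sub>F y in nhds p. C3_bound F p K y"
proof -
  have F2: "Ck_on 2 F S" by (rule Ck_on_mono[OF F]) simp
  have Fb: "Ck_on 2 (\<lambda>z. fderiv F z b) S" for b using Ck_on_fderiv[OF F, of 2 b] by simp
  define R where "R y v = fderiv F y v - fderiv F p v - fderiv2 F y (y - p) v" for y v
  have "\<exists>K\<ge>0. \<forall>\<^sub>F y in nhds p. norm (R y b) \<le> K * (norm (y - p))\<^sup>2" for b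
  proof -
    obtain K where "K \<ge> 0" "\<forall>\<^sub>F y in nhds p. C2_bound (\<lambda>z. fderiv F z b) p K y"
      using eventually_C2_bound[OF S Fb] by blast
    then show ?thesis
      by (intro exI[of _ K] conjI) (auto elim: eventually_mono simp: C2_bound_def R_def)
  qed
  then have "\<exists>K\<ge>0. \<forall>\<^sub>F y in nhds p. \<forall>b\<in>Basis. norm (R y b) \<le> K * (norm (y - p))\<^sup>2"
    by (intro eventually_uniform_bound finite_Basis) (auto, meson order.trans mult_right_mono zero_le_power2)
  then obtain K where K: "K \<ge> 0" "\<forall>\<^sub>F y in nhds p. \<forall>b\<in>Basis. norm (R y b) \<le> K * (norm (y - p))\<^sup>2"
    by blast
  have inS: "\<forall>\<^sub>F y in nhds p. y \<in> S" using S by (intro eventually_nhds_in_open)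
  have lin: "linear (fderiv F z)" if "z \<in> S" for z
    using Ck_on_differentiable[OF F _ that] by (intro linear_frechet_derivative) auto
  from inS K(2) have "\<forall>\<^sub>F y in nhds p. C3_bound F p (real DIM('e) * K) y"
  proof eventually_elim
    case (elim y)
    have "linear (R y)"
      unfolding R_def using fderiv_fderiv_bilinear[OF S(1) elim(1) F2] lin[OF elim(1)] lin[OF S(2)]
      unfolding bilinear_def by (intro linear_compose_sub) auto
    then show ?case
      unfolding C3_bound_def R_def[symmetric]
      using linear_norm_le_Basis[of "R y" "K * (norm (y - p))\<^sup>2"] elim(2) by (simp add: mult.assoc)
  qed
  then show ?thesis using K(1) by (intro exI[of _ "real DIM('e) * K"]) auto
qed

text \<open>A nonlinear program on an open set with a KKT point \<open>p\<close> satisfying strict complementarity and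
  independence of the active gradients.  Objective and active constraints have one more derivative
  than the inactive ones, whose optimal multipliers are zero.\<close>

locale chart_nlp =
  fixes S :: "'e::euclidean_space set" and p :: 'e and F :: "'e \<Rightarrow> real" and c :: "'i \<Rightarrow> 'e \<Rightarrow> real"
    and I J E :: "'i set" and \<eta>s :: "'i \<Rightarrow> real"
  assumes S: "open S" "p \<in> S" and sets: "finite I" "J \<subseteq> I" "E \<subseteq> J"
    and F3: "Ck_on 3 F S" and c2: "\<And>l. l \<in> I \<Longrightarrow> Ck_on 2 (c l) S" and c3: "\<And>l. l \<in> J \<Longrightarrow> Ck_on 3 (c l) S"
    and stationary_p: "\<And>v. fderiv F p v + (\<Sum>l\<in>I. \<eta>s l * fderiv (c l) p v) = 0"
    and active_p: "\<And>l. l \<in> J \<Longrightarrow> c l p = 0"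
    and inactive_p: "\<And>l. l \<in> I - J \<Longrightarrow> c l p < 0" "\<And>l. l \<in> I - J \<Longrightarrow> \<eta>s l = 0"
    and strict_p: "\<And>l. l \<in> J - E \<Longrightarrow> 0 < \<eta>s l"
    and licq_p: "\<And>w. (\<And>\<xi>. (\<Sum>l\<in>J. w l * fderiv (c l) p \<xi>) = 0) \<Longrightarrow> \<forall>l\<in>J. w l = 0"
begin

definition DL :: "('i \<Rightarrow> real) \<Rightarrow> 'e \<Rightarrow> 'e \<Rightarrow> real" where
  "DL \<eta> y v = fderiv F y v + (\<Sum>l\<in>I. \<eta> l * fderiv (c l) y v)"

definition D2L :: "('i \<Rightarrow> real) \<Rightarrow> 'e \<Rightarrow> 'e \<Rightarrow> 'e \<Rightarrow> real" where
  "D2L \<eta> y u v = fderiv2 F y u v + (\<Sum>l\<in>I. \<eta> l * fderiv2 (c l) y u v)"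

definition abs_sum where "abs_sum = (\<Sum>l\<in>I. \<bar>\<eta>s l\<bar>)"

lemma lagrange_sum_bound:
  assumes "\<bar>a\<bar> \<le> t" "\<And>l. l \<in> L \<Longrightarrow> \<bar>b l\<bar> \<le> t" "L \<subseteq> I"
  shows "\<bar>a + (\<Sum>l\<in>L. \<eta>s l * b l)\<bar> \<le> (1 + abs_sum) * t"
proof -
  have t: "t \<ge> 0" using assms(1) by linarith
  have "\<bar>\<Sum>l\<in>L. \<eta>s l * b l\<bar> \<le> (\<Sum>l\<in>L. \<bar>\<eta>s l\<bar> * t)"
    using assms(2) by (intro order.trans[OF sum_abs] sum_mono) (auto simp: abs_mult intro: mult_left_mono)
  also have "\<dots> \<le> abs_sum * t"
    unfolding abs_sum_def sum_distrib_right using assms(3) sets(1) t by (intro sum_mono2) auto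
  finally show ?thesis using assms(1) by (simp add: algebra_simps)
qed

lemma difference_sum_bound:
  assumes "\<And>l. l \<in> I \<Longrightarrow> \<bar>\<eta> l - \<eta>s l\<bar> \<le> e" "\<And>l. l \<in> I \<Longrightarrow> \<bar>b l\<bar> \<le> t" "0 \<le> e"
  shows "\<bar>\<Sum>l\<in>I. (\<eta> l - \<eta>s l) * b l\<bar> \<le> real (card I) * (e * t)"
proof -
  have "\<bar>\<Sum>l\<in>I. (\<eta> l - \<eta>s l) * b l\<bar> \<le> (\<Sum>l\<in>I. e * t)"
    using assms by (intro order.trans[OF sum_abs] sum_mono) (auto simp: abs_mult intro!: mult_mono)
  then show ?thesis by simp
qed

lemma DL_diff: "DL \<eta> y v = DL \<eta>s y v + (\<Sum>l\<in>I. (\<eta> l - \<eta>s l) * fderiv (c l) y v)"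
  unfolding DL_def by (simp add: left_diff_distrib sum_subtractf)

lemma D2L_diff: "D2L \<eta> y u v = D2L \<eta>s y u v + (\<Sum>l\<in>I. (\<eta> l - \<eta>s l) * fderiv2 (c l) y u v)"
  unfolding D2L_def by (simp add: left_diff_distrib sum_subtractf)

lemma sum_active_p: "(\<Sum>l\<in>I. \<eta>s l * b l) = (\<Sum>l\<in>J. \<eta>s l * b l)"
  using sets inactive_p(2) by (intro sum.mono_neutral_right) auto

text \<open>\<open>d\<close> and \<open>\<eta>q\<close> satisfy the KKT conditions of the subproblem at \<open>y\<close> whose quadratic form \<open>H\<close> is the
  second derivative of the Lagrangian with multipliers \<open>\<eta>\<close>, corrected by a first-order term; in the
  application \<open>\<Gamma>\<close> are the Christoffel symbols of the metric.\<close>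

definition newton_step :: "real \<Rightarrow> real \<Rightarrow> real \<Rightarrow> real \<Rightarrow> 'e \<Rightarrow> ('i \<Rightarrow> real) \<Rightarrow> ('i \<Rightarrow> real) \<Rightarrow> 'e
    \<Rightarrow> ('e \<Rightarrow> 'e \<Rightarrow> real) \<Rightarrow> ('e \<Rightarrow> 'e \<Rightarrow> 'e) \<Rightarrow> bool" where
  "newton_step m K\<Gamma> K\<eta> e y \<eta> \<eta>q d H \<Gamma> \<longleftrightarrow>
     norm (y - p) \<le> e \<and> (\<forall>l\<in>I. \<bar>\<eta> l - \<eta>s l\<bar> \<le> e) \<and> (\<forall>l\<in>I. \<bar>\<eta>q l - \<eta>s l\<bar> \<le> K\<eta>) \<and>
     (\<forall>u v. norm (\<Gamma> u v) \<le> K\<Gamma> * norm u * norm v) \<and>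
     (\<forall>u v. H u v = D2L \<eta> y u v - DL \<eta> y (\<Gamma> u v)) \<and>
     (\<forall>u v w. H (u + v) w = H u w + H v w) \<and> (\<forall>u. m * (norm u)\<^sup>2 \<le> H u u) \<and>
     (\<forall>\<xi>. H d \<xi> + DL \<eta>q y \<xi> = 0) \<and>
     (\<forall>l\<in>E. c l y + fderiv (c l) y d = 0) \<and>
     (\<forall>l\<in>I-E. c l y + fderiv (c l) y d \<le> 0 \<and> 0 \<le> \<eta>q l \<and> \<eta>q l * (c l y + fderiv (c l) y d) = 0)"

text \<open>The two deviations of \<open>H\<close> from the second derivative of the Lagrangian with optimal multipliers
  are harmless.  The multiplier error contributes terms with factor \<open>\<eta> - \<eta>s\<close>, the correction \<open>\<Gamma>\<close> enters
  through the differential of the Lagrangian; both factors are of order \<open>e\<close> and multiply a vector of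
  order \<open>e\<close>.\<close>

theorem newton_step_quadratic:
  assumes m: "0 < m" and K\<Gamma>: "0 \<le> K\<Gamma>" and K\<eta>: "0 \<le> K\<eta>"
  shows "\<exists>\<delta>>0. \<exists>C\<ge>0. \<forall>e y \<eta> \<eta>q d H \<Gamma>. newton_step m K\<Gamma> K\<eta> e y \<eta> \<eta>q d H \<Gamma> \<longrightarrow> e \<le> \<delta> \<longrightarrow>
    norm d \<le> C * e \<and> norm (y - p + d) \<le> C * e\<^sup>2 \<and> (\<forall>l\<in>I. \<bar>\<eta>q l - \<eta>s l\<bar> \<le> C * e\<^sup>2)"
proof -
  have F2: "Ck_on 2 F S" by (rule Ck_on_mono[OF F3]) simp
  obtain B1 where B1: "B1 \<ge> 0" "\<forall>\<^sub>F y in nhds p. C2_bound F p B1 y"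
    using eventually_C2_bound[OF S F2] by blast
  obtain B2 where B2: "B2 \<ge> 0" "\<forall>\<^sub>F y in nhds p. \<forall>l\<in>I. C2_bound (c l) p B2 y"
    using eventually_uniform_bound[where I = I and F = "nhds p" and P = "\<lambda>l. C2_bound (c l) p"]
      sets(1) eventually_C2_bound[OF S c2] C2_bound_mono by blast
  obtain B3 where B3: "B3 \<ge> 0" "\<forall>\<^sub>F y in nhds p. C3_bound F p B3 y"
    using eventually_C3_bound[OF S F3] by blast
  obtain B4 where B4: "B4 \<ge> 0" "\<forall>\<^sub>F y in nhds p. \<forall>l\<in>J. C3_bound (c l) p B4 y"
    using eventually_uniform_bound[where I = J and F = "nhds p" and P = "\<lambda>l. C3_bound (c l) p"]
      finite_subset[OF sets(2,1)] eventually_C3_bound[OF S c3] C3_bound_mono by blast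
  define B where "B = B1 + B2 + B3 + B4"
  have B: "B \<ge> 0" "B1 \<le> B" "B2 \<le> B" "B3 \<le> B" "B4 \<le> B" using B1 B2 B3 B4 by (auto simp: B_def)
  have "\<forall>\<^sub>F y in nhds p. C2_bound F p B y \<and> (\<forall>l\<in>I. C2_bound (c l) p B y) \<and>
      C3_bound F p B y \<and> (\<forall>l\<in>J. C3_bound (c l) p B y)"
    using B1(2) B2(2) B3(2) B4(2)
    by eventually_elim (use B C2_bound_mono C3_bound_mono in blast)
  then obtain \<delta>1 where \<delta>1: "\<delta>1 > 0" and bnd: "\<And>y. dist y p < \<delta>1 \<Longrightarrow> C2_bound F p B y \<and> (\<forall>l\<in>I. C2_bound (c l) p B y) \<and>
      C3_bound F p B y \<and> (\<forall>l\<in>J. C3_bound (c l) p B y)"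
    unfolding eventually_nhds_metric by blast
  have lin: "linear (fderiv (c l) p)" if "l \<in> J" for l
    using Ck_on_differentiable[OF c3[OF that] _ S(2)] by (intro linear_frechet_derivative) auto
  obtain \<rho> \<kappa> where \<rho>: "\<rho> > 0" "\<kappa> \<ge> 0"
    and stable: "\<forall>a. (\<forall>l\<in>J. \<forall>\<xi>. \<bar>a l \<xi> - fderiv (c l) p \<xi>\<bar> \<le> \<rho> * norm \<xi>) \<longrightarrow>
      (\<forall>w s. (\<forall>\<xi>. \<bar>\<Sum>l\<in>J. w l * a l \<xi>\<bar> \<le> s * norm \<xi>) \<longrightarrow> (\<Sum>l\<in>J. \<bar>w l\<bar>) \<le> \<kappa> * s)"
    using independent_functionals_stable[of J "\<lambda>l. fderiv (c l) p", OF finite_subset[OF sets(2,1)] lin licq_p]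
    by blast
  define \<sigma> where "\<sigma> = Min (insert 1 ((\<lambda>l. - c l p / 2) ` (I - J) \<union> \<eta>s ` (J - E)))"
  have finU: "finite (insert 1 ((\<lambda>l. - c l p / 2) ` (I - J) \<union> \<eta>s ` (J - E)))"
    using sets(1) finite_subset[OF sets(2,1)] by simp
  have \<sigma>: "\<sigma> > 0" unfolding \<sigma>_def using finU inactive_p(1) strict_p by (subst Min_gr_iff) auto
  have \<sigma>1: "\<sigma> \<le> - c l p / 2" if "l \<in> I - J" for l
    unfolding \<sigma>_def using finU that by (intro Min_le) auto
  have \<sigma>2: "\<sigma> \<le> \<eta>s l" if "l \<in> J - E" for l
    unfolding \<sigma>_def using finU that by (intro Min_le) auto
  define N where "N = real (card I)"
  define P where "P = (1 + abs_sum) * B + N * B"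
  define K where "K = P * (1 + K\<Gamma>) + B + K\<eta>"
  have as: "abs_sum \<ge> 0" unfolding abs_sum_def by (intro sum_nonneg) auto
  have N: "N \<ge> 0" by (simp add: N_def)
  have P: "P \<ge> 0" unfolding P_def using B as N by simp
  have "0 \<le> P * K\<Gamma>" using P K\<Gamma> by simp
  then have K: "K \<ge> 0" "P * (1 + K\<Gamma>) \<le> K" "B \<le> K" "K\<eta> \<le> K" "P \<le> K"
    unfolding K_def using P K\<Gamma> K\<eta> B by (auto simp: distrib_left)
  have PB: "(1 + abs_sum) * B \<le> P" unfolding P_def using N B by simp
  obtain \<delta>2 C where \<delta>2: "\<delta>2 > 0" "C \<ge> 0" and step: "\<forall>e z d H q cc a \<eta>q.
      newton_qp I J E \<eta>s m K \<kappa> \<sigma> e (z::'e) d H q cc a \<eta>q \<longrightarrow> e \<le> \<delta>2 \<longrightarrow>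
      norm d \<le> C * e \<and> norm (z + d) \<le> C * e\<^sup>2 \<and> (\<forall>l\<in>I. \<bar>\<eta>q l - \<eta>s l\<bar> \<le> C * e\<^sup>2)"
    using newton_qp_quadratic_step[OF m K(1) \<rho>(2) \<sigma>, of I J E \<eta>s] by blast
  \<comment> \<open>The last two bounds keep the constraint differentials within
    \<open>\<rho>\<close> and the inactive constraint values within half of their slack.\<close>
  define \<delta> where "\<delta> = Min {\<delta>1 / 2, \<delta>2, 1, \<rho> / (B + 1), \<sigma> / (B + 1)}"
  have \<delta>: "\<delta> > 0" unfolding \<delta>_def using \<delta>1 \<delta>2 \<rho> \<sigma> B by simp
  have \<delta>le: "\<delta> \<le> \<delta>1 / 2" "\<delta> \<le> \<delta>2" "\<delta> \<le> 1" "\<delta> \<le> \<rho> / (B + 1)" "\<delta> \<le> \<sigma> / (B + 1)"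
    unfolding \<delta>_def by (intro Min_le; simp)+
  have B\<delta>: "B * \<delta> \<le> \<rho>" "B * \<delta> \<le> \<sigma>"
    using \<delta>le(4,5) B(1) \<delta> by (simp_all add: field_simps)
  have main: "norm d \<le> C * e \<and> norm (y - p + d) \<le> C * e\<^sup>2 \<and> (\<forall>l\<in>I. \<bar>\<eta>q l - \<eta>s l\<bar> \<le> C * e\<^sup>2)"
    if step_data: "newton_step m K\<Gamma> K\<eta> e y \<eta> \<eta>q d H \<Gamma>" and e: "e \<le> \<delta>" for e y \<eta> \<eta>q d H \<Gamma>
  proof -
    have ye: "norm (y - p) \<le> e" and \<eta>: "\<And>l. l \<in> I \<Longrightarrow> \<bar>\<eta> l - \<eta>s l\<bar> \<le> e"
      and \<eta>q: "\<And>l. l \<in> I \<Longrightarrow> \<bar>\<eta>q l - \<eta>s l\<bar> \<le> K\<eta>"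
      and \<Gamma>: "\<And>u v. norm (\<Gamma> u v) \<le> K\<Gamma> * norm u * norm v"
      and H: "\<And>u v. H u v = D2L \<eta> y u v - DL \<eta> y (\<Gamma> u v)"
      and Hadd: "\<And>u v w. H (u + v) w = H u w + H v w" and Hc: "\<And>u. m * (norm u)\<^sup>2 \<le> H u u"
      and st: "\<And>\<xi>. H d \<xi> + DL \<eta>q y \<xi> = 0"
      and eq: "\<And>l. l \<in> E \<Longrightarrow> c l y + fderiv (c l) y d = 0"
      and ineq: "\<And>l. l \<in> I - E \<Longrightarrow> c l y + fderiv (c l) y d \<le> 0 \<and> 0 \<le> \<eta>q l \<and> \<eta>q l * (c l y + fderiv (c l) y d) = 0"
      using step_data unfolding newton_step_def by blast+
    let ?z = "y - p"
    have e0: "0 \<le> e" using ye norm_ge_zero order.trans by blast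
    have e1: "e \<le> 1" using e \<delta>le by linarith
    have "dist y p < \<delta>1" using ye e \<delta>le(1) \<delta>1 by (simp add: dist_norm)
    note bb = bnd[OF this]
    note bF = conjunct1[OF bb, unfolded C2_bound_def]
    have bc: "C2_bound (c l) p B y" if "l \<in> I" for l using bb that by blast
    note bc = this[unfolded C2_bound_def]
    have z2: "(norm ?z)\<^sup>2 \<le> e\<^sup>2" using ye by (intro power_mono) auto
    have Be: "B * norm ?z \<le> B * e" "B * (norm ?z)\<^sup>2 \<le> B * e\<^sup>2" using ye z2 B(1) by (auto intro: mult_left_mono)
    have Be\<delta>: "B * e \<le> B * \<delta>" using e B(1) by (intro mult_left_mono)
    have DLs: "\<bar>DL \<eta>s y v\<bar> \<le> (1 + abs_sum) * B * e * norm v" for v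
    proof -
      have "DL \<eta>s y v = (fderiv F y v - fderiv F p v) + (\<Sum>l\<in>I. \<eta>s l * (fderiv (c l) y v - fderiv (c l) p v))"
        using stationary_p[of v] unfolding DL_def by (simp add: right_diff_distrib sum_subtractf)
      also have "\<bar>\<dots>\<bar> \<le> (1 + abs_sum) * (B * norm ?z * norm v)"
        using bF bc by (intro lagrange_sum_bound) auto
      also have "\<dots> \<le> (1 + abs_sum) * (B * e * norm v)"
        using ye z2 as B(1) by (intro mult_left_mono mult_right_mono) auto
      finally show ?thesis by (simp add: mult.assoc)
    qed
    have DL\<eta>: "\<bar>DL \<eta> y v\<bar> \<le> P * e * norm v" for v
    proof -
      have "\<bar>\<Sum>l\<in>I. (\<eta> l - \<eta>s l) * fderiv (c l) y v\<bar> \<le> N * (e * (B * norm v))"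
        unfolding N_def using \<eta> bc e0 by (intro difference_sum_bound) auto
      then show ?thesis using DLs[of v] DL_diff[of \<eta> y v] unfolding P_def by (simp add: algebra_simps) 
    qed
    have D2\<eta>: "\<bar>D2L \<eta> y u v\<bar> \<le> P * norm u * norm v" for u v
    proof -
      have "\<bar>D2L \<eta>s y u v\<bar> \<le> (1 + abs_sum) * (B * norm u * norm v)"
        unfolding D2L_def using bF bc by (intro lagrange_sum_bound) auto
      moreover have "\<bar>\<Sum>l\<in>I. (\<eta> l - \<eta>s l) * fderiv2 (c l) y u v\<bar> \<le> N * (e * (B * norm u * norm v))"
        unfolding N_def using \<eta> bc e0 by (intro difference_sum_bound) auto
      moreover have "N * (e * (B * norm u * norm v)) \<le> N * (1 * (B * norm u * norm v))"
        using e1 N B(1) by (intro mult_left_mono mult_right_mono) auto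
      ultimately show ?thesis using D2L_diff[of \<eta> y u v] unfolding P_def by (simp add: algebra_simps)
    qed
    have DL\<Gamma>: "\<bar>DL \<eta> y (\<Gamma> u v)\<bar> \<le> P * K\<Gamma> * e * norm u * norm v" for u v
    proof -
      have "P * e * norm (\<Gamma> u v) \<le> P * e * (K\<Gamma> * norm u * norm v)" using P e0 \<Gamma> by (intro mult_left_mono) auto
      then show ?thesis using DL\<eta>[of "\<Gamma> u v"] by (simp add: algebra_simps)
    qed
    have Hb: "\<bar>H u v\<bar> \<le> P * (1 + K\<Gamma>) * norm u * norm v" for u v
    proof -
      have "P * K\<Gamma> * e * norm u * norm v \<le> P * K\<Gamma> * 1 * norm u * norm v"
        using e1 P K\<Gamma> by (intro mult_right_mono mult_left_mono) auto
      then show ?thesis using H[of u v] D2\<eta>[of u v] DL\<Gamma>[of u v] by (simp add: algebra_simps) 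
    qed
    have Tay: "\<bar>DL \<eta>s y \<xi> - H ?z \<xi>\<bar> \<le> P * (1 + K\<Gamma>) * e\<^sup>2 * norm \<xi>" for \<xi>
    proof -
      define T where "T G = fderiv G y \<xi> - fderiv G p \<xi> - fderiv2 G y ?z \<xi>" for G :: "'e \<Rightarrow> real"
      have "DL \<eta>s y \<xi> - D2L \<eta>s y ?z \<xi> = T F + (\<Sum>l\<in>I. \<eta>s l * T (c l))"
        using stationary_p[of \<xi>] unfolding DL_def D2L_def T_def
        by (simp add: right_diff_distrib sum_subtractf)
      \<comment> \<open>Inactive constraints, which lack a third derivative, drop out
        here.\<close>
      also have "\<dots> = T F + (\<Sum>l\<in>J. \<eta>s l * T (c l))" using sum_active_p[of "\<lambda>l. T (c l)"] by simp
      also have "\<bar>\<dots>\<bar> \<le> (1 + abs_sum) * (B * (norm ?z)\<^sup>2 * norm \<xi>)"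
        using bb sets(2) unfolding T_def C3_bound_def by (intro lagrange_sum_bound) auto
      also have "\<dots> \<le> (1 + abs_sum) * (B * e\<^sup>2 * norm \<xi>)"
        using ye z2 as B(1) by (intro mult_left_mono mult_right_mono) auto
      finally have t1: "\<bar>DL \<eta>s y \<xi> - D2L \<eta>s y ?z \<xi>\<bar> \<le> (1 + abs_sum) * (B * e\<^sup>2 * norm \<xi>)" .
      have "\<bar>\<Sum>l\<in>I. (\<eta> l - \<eta>s l) * fderiv2 (c l) y ?z \<xi>\<bar> \<le> N * (e * (B * norm ?z * norm \<xi>))"
        unfolding N_def using \<eta> bc e0 by (intro difference_sum_bound) auto
      also have "\<dots> \<le> N * (e * (B * e * norm \<xi>))"
        using ye N e0 B(1) by (intro mult_left_mono mult_right_mono) auto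
      finally have t2: "\<bar>D2L \<eta> y ?z \<xi> - D2L \<eta>s y ?z \<xi>\<bar> \<le> N * (e * (B * e * norm \<xi>))"
        using D2L_diff[of \<eta> y ?z \<xi>] by simp
      have "P * K\<Gamma> * e * norm ?z * norm \<xi> \<le> P * K\<Gamma> * e * e * norm \<xi>"
        using ye P K\<Gamma> e0 by (intro mult_right_mono mult_left_mono) auto
      then have t3: "\<bar>DL \<eta> y (\<Gamma> ?z \<xi>)\<bar> \<le> P * K\<Gamma> * e * e * norm \<xi>" using DL\<Gamma>[of ?z \<xi>] by linarith
      have "\<bar>DL \<eta>s y \<xi> - H ?z \<xi>\<bar> \<le> (1 + abs_sum) * (B * e\<^sup>2 * norm \<xi>) + N * (e * (B * e * norm \<xi>)) + P * K\<Gamma> * e * e * norm \<xi>"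
        using H[of ?z \<xi>] t1 t2 t3 by linarith
      also have "\<dots> = P * (1 + K\<Gamma>) * e\<^sup>2 * norm \<xi>" unfolding P_def by (simp add: algebra_simps power2_eq_square)
      finally show ?thesis .
    qed
    have "newton_qp I J E \<eta>s m K \<kappa> \<sigma> e ?z d H (DL \<eta>s y) (\<lambda>l. c l y) (\<lambda>l. fderiv (c l) y) \<eta>q"
    proof (unfold_locales)
      show "finite I" "J \<subseteq> I" "E \<subseteq> J" "0 < m" "0 \<le> K" "0 \<le> \<kappa>" "0 < \<sigma>" "0 \<le> e"
        using sets m K \<rho> \<sigma> e0 e1 by auto
      show "\<eta>s l = 0" "c l y \<le> - \<sigma>" if "l \<in> I - J" for l
      proof -
        show "\<eta>s l = 0" using inactive_p that by auto
        have "\<bar>c l y - c l p\<bar> \<le> B * norm ?z" using bc that by blast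
        then show "c l y \<le> - \<sigma>" using \<sigma>1[OF that] Be(1) Be\<delta> B\<delta>(2) by linarith
      qed
      show "\<sigma> \<le> \<eta>s l" if "l \<in> J - E" for l using \<sigma>2[OF that] .
      show "H (u + v) \<xi> = H u \<xi> + H v \<xi>" for u v \<xi> by (rule Hadd)
      show "m * (norm u)\<^sup>2 \<le> H u u" for u by (rule Hc)
      show "\<bar>H u v\<bar> \<le> K * norm u * norm v" for u v
        using Hb[of u v] K(2) by (meson mult_right_mono norm_ge_zero order.trans)
      show "\<bar>DL \<eta>s y \<xi>\<bar> \<le> K * e * norm \<xi>" for \<xi>
        using DLs[of \<xi>] order.trans[OF PB K(5)] e0 by (meson mult_right_mono norm_ge_zero order.trans)
      show "\<bar>DL \<eta>s y \<xi> - H ?z \<xi>\<bar> \<le> K * e\<^sup>2 * norm \<xi>" for \<xi>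
        using Tay[of \<xi>] K(2) by (meson mult_right_mono norm_ge_zero zero_le_power2 order.trans)
      show "fderiv (c l) y (u + v) = fderiv (c l) y u + fderiv (c l) y v" if "l \<in> I" for l u v
        using bc[OF that] linear_add by blast
      show "\<bar>fderiv (c l) y \<xi>\<bar> \<le> K * norm \<xi>" if "l \<in> I" for l \<xi>
        using bc[OF that] K(3) by (meson mult_right_mono norm_ge_zero order.trans)
      show "\<bar>c l y\<bar> \<le> K * e" "\<bar>c l y - fderiv (c l) y ?z\<bar> \<le> K * e\<^sup>2" if "l \<in> J" for l
      proof -
        have l: "l \<in> I" using that sets by auto
        have "\<bar>c l y\<bar> \<le> B * e" "\<bar>c l y - fderiv (c l) y ?z\<bar> \<le> B * e\<^sup>2"
          using bc[OF l] Be active_p[OF that] by auto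
        then show "\<bar>c l y\<bar> \<le> K * e" "\<bar>c l y - fderiv (c l) y ?z\<bar> \<le> K * e\<^sup>2"
          using K(3) e0 by (meson mult_right_mono zero_le_power2 order.trans)+
      qed
      show "(\<Sum>l\<in>J. \<bar>w l\<bar>) \<le> \<kappa> * s" if "\<And>\<xi>. \<bar>\<Sum>l\<in>J. w l * fderiv (c l) y \<xi>\<bar> \<le> s * norm \<xi>" for w s
      proof (rule stable[rule_format])
        fix l \<xi>
        show "\<bar>fderiv (c l) y \<xi> - fderiv (c l) p \<xi>\<bar> \<le> \<rho> * norm \<xi>" if "l \<in> J"
        proof -
          have "\<bar>fderiv (c l) y \<xi> - fderiv (c l) p \<xi>\<bar> \<le> B * norm ?z * norm \<xi>"
            using that bc sets by blast
          also have "\<dots> \<le> \<rho> * norm \<xi>" using Be(1) Be\<delta> B\<delta>(1) by (intro mult_right_mono) auto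
          finally show "\<bar>fderiv (c l) y \<xi> - fderiv (c l) p \<xi>\<bar> \<le> \<rho> * norm \<xi>" .
        qed
      qed (use that in blast)
      show "H d \<xi> + DL \<eta>s y \<xi> + (\<Sum>l\<in>I. (\<eta>q l - \<eta>s l) * fderiv (c l) y \<xi>) = 0" for \<xi>
        using st[of \<xi>] DL_diff[of \<eta>q y \<xi>] by simp
      show "c l y + fderiv (c l) y d = 0" if "l \<in> E" for l using eq[OF that] .
      show "c l y + fderiv (c l) y d \<le> 0" "0 \<le> \<eta>q l" "\<eta>q l * (c l y + fderiv (c l) y d) = 0"
        if "l \<in> I - E" for l using ineq[OF that] by auto
      show "\<bar>\<eta>q l - \<eta>s l\<bar> \<le> K" if "l \<in> I" for l using \<eta>q[OF that] K(4) by linarith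
    qed
    then show ?thesis using step e \<delta>le(2) by fastforce
  qed
  show ?thesis using \<delta> \<delta>2(2) main by blast
qed

end

section \<open>Smooth manifolds in charts\<close>

lemma smooth_on_imp_Ck_on: "smooth_on f S \<Longrightarrow> Ck_on k f S"
  by (simp add: smooth_on_def)

locale smooth_manifold =
  fixes A :: "('p::{t2_space,second_countable_topology}, 'e::euclidean_space) chart set"
  assumes atlas: "smooth_atlas A"
begin

text \<open>Coordinate changes between tangent vectors in any two charts; \<open>to_coord\<close> and \<open>from_coord\<close> are the
  special cases in which one of the charts is the one chosen at the point.\<close>

definition transition_deriv :: "('p, 'e) chart \<Rightarrow> ('p, 'e) chart \<Rightarrow> 'p \<Rightarrow> 'e \<Rightarrow> 'e" where
  "transition_deriv c c' x = fderiv (\<lambda>y. snd c' (chart_inv c y)) (snd c x)"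

lemma chart_open:
  assumes "c \<in> A" shows "open (fst c)" "open (snd c ` fst c)"
  using atlas assms unfolding smooth_atlas_def by auto

lemma chart_homeo: "c \<in> A \<Longrightarrow> homeomorphism (fst c) (snd c ` fst c) (snd c) (chart_inv c)"
  using atlas unfolding smooth_atlas_def by auto

lemma chart_inv_left: "c \<in> A \<Longrightarrow> x \<in> fst c \<Longrightarrow> chart_inv c (snd c x) = x"
  using chart_homeo homeomorphism_apply1 by blast

lemma chart_inv_right: "c \<in> A \<Longrightarrow> y \<in> snd c ` fst c \<Longrightarrow> snd c (chart_inv c y) = y"
  using chart_homeo homeomorphism_apply2 by blast

lemma chart_inv_mem: "c \<in> A \<Longrightarrow> y \<in> snd c ` fst c \<Longrightarrow> chart_inv c y \<in> fst c"
  using chart_inv_left by (metis imageE)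

lemma chart_image_open:
  assumes "c \<in> A" "open W" "W \<subseteq> fst c"
  shows "open (snd c ` W)"
proof -
  have "openin (top_of_set (snd c ` fst c)) (snd c ` W)"
    using homeomorphism_imp_open_map[OF chart_homeo[OF assms(1)], of W] assms
    by (simp add: openin_open_eq chart_open)
  then show ?thesis using chart_open[OF assms(1)] openin_open_trans by blast
qed

lemma chart_continuous:
  assumes "c \<in> A"
  shows "continuous_on (fst c) (snd c)" "continuous_on (snd c ` fst c) (chart_inv c)"
  using chart_homeo[OF assms] by (auto simp: homeomorphism_def)

lemma chart_at: "chart_at A x \<in> A" "x \<in> fst (chart_at A x)"
proof -
  have "\<exists>c. c \<in> A \<and> x \<in> fst c" using atlas unfolding smooth_atlas_def by blast
  then have "chart_at A x \<in> A \<and> x \<in> fst (chart_at A x)"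
    unfolding chart_at_def by (rule someI_ex)
  then show "chart_at A x \<in> A" "x \<in> fst (chart_at A x)" by auto
qed

lemma overlap_open: "c \<in> A \<Longrightarrow> c' \<in> A \<Longrightarrow> open (snd c ` (fst c \<inter> fst c'))"
  by (intro chart_image_open) (auto intro: chart_open)

lemma transition_smooth:
  assumes "c \<in> A" "c' \<in> A"
  shows "Ck_on k (\<lambda>y. snd c' (chart_inv c y)) (snd c ` (fst c \<inter> fst c'))"
  using atlas assms unfolding smooth_atlas_def by (auto simp: smooth_on_def o_def)

lemma transition_differentiable:
  assumes "c \<in> A" "c' \<in> A" "x \<in> fst c" "x \<in> fst c'"
  shows "(\<lambda>y. snd c' (chart_inv c y)) differentiable (at (snd c x))"
  using transition_smooth[OF assms(1,2), of 1] assms by auto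

lemma transition_deriv_linear: "c \<in> A \<Longrightarrow> c' \<in> A \<Longrightarrow> x \<in> fst c \<Longrightarrow> x \<in> fst c' \<Longrightarrow> linear (transition_deriv c c' x)"
  unfolding transition_deriv_def by (intro linear_frechet_derivative transition_differentiable)

lemma fderiv_change_chart:
  assumes c: "c \<in> A" "x \<in> fst c" and c': "c' \<in> A" "x \<in> fst c'"
    and d: "(\<lambda>y. F (chart_inv c' y)) differentiable (at (snd c' x))"
  shows "(\<lambda>y. F (chart_inv c y)) differentiable (at (snd c x))"
    and "fderiv (\<lambda>y. F (chart_inv c y)) (snd c x) v = fderiv (\<lambda>y. F (chart_inv c' y)) (snd c' x) (transition_deriv c c' x v)"
proof -
  have "((\<lambda>y. F (chart_inv c' y)) has_derivative fderiv (\<lambda>y. F (chart_inv c' y)) (snd c' x))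
      (at (snd c' (chart_inv c (snd c x))))"
    using d c by (simp add: chart_inv_left fderiv_has_derivative)
  from has_derivative_compose[OF fderiv_has_derivative[OF transition_differentiable[OF c(1) c'(1) c(2) c'(2)]] this]
  have "((\<lambda>y. F (chart_inv c' (snd c' (chart_inv c y)))) has_derivative
      (\<lambda>v. fderiv (\<lambda>y. F (chart_inv c' y)) (snd c' x) (transition_deriv c c' x v))) (at (snd c x))"
    by (simp add: transition_deriv_def)
  then have "((\<lambda>y. F (chart_inv c y)) has_derivative
      (\<lambda>v. fderiv (\<lambda>y. F (chart_inv c' y)) (snd c' x) (transition_deriv c c' x v))) (at (snd c x))"
    by (rule has_derivative_transform_within_open[OF _ overlap_open[OF c(1) c'(1)]])
       (use c c' in \<open>auto simp: chart_inv_left\<close>)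
  then show "(\<lambda>y. F (chart_inv c y)) differentiable (at (snd c x))"
    and "fderiv (\<lambda>y. F (chart_inv c y)) (snd c x) v = fderiv (\<lambda>y. F (chart_inv c' y)) (snd c' x) (transition_deriv c c' x v)"
    by (auto simp: differentiable_def dest: fderiv_eqI)
qed

lemma transition_deriv_compose:
  assumes "c \<in> A" "c' \<in> A" "c'' \<in> A" "x \<in> fst c" "x \<in> fst c'" "x \<in> fst c''"
  shows "transition_deriv c' c'' x (transition_deriv c c' x v) = transition_deriv c c'' x v"
  using fderiv_change_chart(2)[OF assms(1,4,2,5) transition_differentiable[OF assms(2,3,5,6)]]
  by (simp add: transition_deriv_def)

lemma transition_deriv_self:
  assumes "c \<in> A" "x \<in> fst c"
  shows "transition_deriv c c x v = v"
proof -
  have "((\<lambda>y. snd c (chart_inv c y)) has_derivative (\<lambda>v. v)) (at (snd c x))"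
    by (rule has_derivative_transform_within_open[OF has_derivative_ident chart_open(2)[OF assms(1)]])
       (use assms in \<open>auto simp: chart_inv_left\<close>)
  then show ?thesis unfolding transition_deriv_def by (simp add: fderiv_eqI)
qed

lemma to_coord_eq_transition_deriv: "to_coord A c x = transition_deriv (chart_at A x) c x"
  by (simp add: to_coord_def transition_deriv_def o_def)

lemma from_coord_eq_transition_deriv: "from_coord A c x = transition_deriv c (chart_at A x) x"
  by (simp add: from_coord_def transition_deriv_def o_def)

lemma to_from_coord: "c \<in> A \<Longrightarrow> x \<in> fst c \<Longrightarrow> to_coord A c x (from_coord A c x v) = v"
  by (simp add: to_coord_eq_transition_deriv from_coord_eq_transition_deriv transition_deriv_compose chart_at transition_deriv_self)

lemma from_to_coord: "c \<in> A \<Longrightarrow> x \<in> fst c \<Longrightarrow> from_coord A c x (to_coord A c x v) = v"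
  by (simp add: to_coord_eq_transition_deriv from_coord_eq_transition_deriv transition_deriv_compose chart_at transition_deriv_self)

lemma to_from_coord_charts:
  "c \<in> A \<Longrightarrow> x \<in> fst c \<Longrightarrow> c' \<in> A \<Longrightarrow> x \<in> fst c' \<Longrightarrow> to_coord A c' x (from_coord A c x v) = transition_deriv c c' x v"
  by (simp add: to_coord_eq_transition_deriv from_coord_eq_transition_deriv transition_deriv_compose chart_at)

lemma linear_to_coord: "c \<in> A \<Longrightarrow> x \<in> fst c \<Longrightarrow> linear (to_coord A c x)"
  by (simp add: to_coord_eq_transition_deriv transition_deriv_linear chart_at)

lemma linear_from_coord: "c \<in> A \<Longrightarrow> x \<in> fst c \<Longrightarrow> linear (from_coord A c x)"
  by (simp add: from_coord_eq_transition_deriv transition_deriv_linear chart_at)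

text \<open>The differential is defined with the chart chosen at each point, which may jump from point to
  point; this lemma moves everything to one fixed chart.\<close>

lemma differential_in_chart:
  assumes "c \<in> A" "x \<in> fst c" "(\<lambda>y. \<theta> (chart_inv c y)) differentiable (at (snd c x))"
  shows "differential A \<theta> x \<xi> = fderiv (\<lambda>y. \<theta> (chart_inv c y)) (snd c x) (to_coord A c x \<xi>)"
  using fderiv_change_chart(2)[OF chart_at assms]
  by (simp add: differential_def to_coord_eq_transition_deriv o_def)

lemma Ck_fun_in_chart: "Ck_fun A k \<theta> \<Longrightarrow> c \<in> A \<Longrightarrow> Ck_on k (\<lambda>y. \<theta> (chart_inv c y)) (snd c ` fst c)"
  by (simp add: Ck_fun_def o_def)

lemma Ck_fun_differentiable:
  assumes "Ck_fun A k \<theta>" "0 < k" "c \<in> A" "y \<in> snd c ` fst c"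
  shows "(\<lambda>y. \<theta> (chart_inv c y)) differentiable (at y)"
  using Ck_on_differentiable[OF Ck_fun_in_chart[OF assms(1,3)] assms(2,4)] .

lemma differential_Ck_fun:
  assumes "Ck_fun A k \<theta>" "0 < k" "c \<in> A" "x \<in> fst c"
  shows "differential A \<theta> x \<xi> = fderiv (\<lambda>y. \<theta> (chart_inv c y)) (snd c x) (to_coord A c x \<xi>)"
  using assms by (intro differential_in_chart Ck_fun_differentiable) auto

lemma differential_linear:
  assumes "Ck_fun A k \<theta>" "0 < k"
  shows "linear (differential A \<theta> x)"
  unfolding differential_def o_def
  using Ck_fun_differentiable[OF assms chart_at(1), of "snd (chart_at A x) x"] chart_at(2)
  by (intro linear_frechet_derivative) auto

lemma closed_chart_compact:
  assumes "c \<in> A" "compact K" "K \<subseteq> snd c ` fst c"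
  shows "closed (chart_inv c ` K)"
proof -
  have "continuous_on K (chart_inv c)" using chart_continuous(2)[OF assms(1)] assms(3) continuous_on_subset by blast
  then show ?thesis using assms(2) by (intro compact_imp_closed compact_continuous_image)
qed

lemma chart_image_split:
  assumes "c \<in> A" "c' \<in> A" "compact K" "K \<subseteq> snd c ` fst c"
  shows "snd c' ` fst c' = snd c' ` (fst c' \<inter> fst c) \<union> snd c' ` (fst c' - chart_inv c ` K)"
    and "open (snd c' ` (fst c' - chart_inv c ` K))"
proof -
  have "chart_inv c ` K \<subseteq> fst c" using assms chart_inv_mem by blast
  then show "snd c' ` fst c' = snd c' ` (fst c' \<inter> fst c) \<union> snd c' ` (fst c' - chart_inv c ` K)" by blast
  show "open (snd c' ` (fst c' - chart_inv c ` K))"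
    by (intro chart_image_open open_Diff chart_open closed_chart_compact assms) auto
qed

text \<open>In every other chart the extension is \<open>C\<^sup>k\<close> on two open sets that cover it: the overlap with \<open>c\<close>, and
  the complement of the compact support, which is closed since the manifold is Hausdorff.\<close>

lemma Ck_fun_extend_by_zero:
  assumes c: "c \<in> A" and K: "compact K" "K \<subseteq> snd c ` fst c"
    and F: "Ck_on k F (snd c ` fst c)" "\<And>y. y \<in> snd c ` fst c - K \<Longrightarrow> F y = 0"
  shows "Ck_fun A k (\<lambda>p. if p \<in> fst c then F (snd c p) else 0)"
  unfolding Ck_fun_def o_def
proof
  fix c' assume c': "c' \<in> A"
  let ?f = "\<lambda>y. if chart_inv c' y \<in> fst c then F (snd c (chart_inv c' y)) else 0"
  have "Ck_on k (\<lambda>y. F (snd c (chart_inv c' y))) (snd c' ` (fst c' \<inter> fst c))"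
    by (rule Ck_on_compose[OF overlap_open[OF c' c] chart_open(2)[OF c] transition_smooth[OF c' c] F(1)])
       (use c' in \<open>auto simp: chart_inv_left\<close>)
  then have 1: "Ck_on k ?f (snd c' ` (fst c' \<inter> fst c))"
    by (rule Ck_on_cong[OF overlap_open[OF c' c]]) (use c' in \<open>auto simp: chart_inv_left\<close>)
  have 2: "Ck_on k ?f (snd c' ` (fst c' - chart_inv c ` K))"
  proof (rule Ck_on_cong[OF chart_image_split(2)[OF c c' K] Ck_on_const[of _ 0]])
    fix y assume "y \<in> snd c' ` (fst c' - chart_inv c ` K)"
    then obtain p where p: "p \<in> fst c'" "p \<notin> chart_inv c ` K" "y = snd c' p" by auto
    have "F (snd c p) = 0" if "p \<in> fst c"
      using F(2)[of "snd c p"] that p(2) c by (metis DiffI chart_inv_left image_eqI)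
    then show "0 = ?f y" using p c' by (simp add: chart_inv_left)
  qed
  show "Ck_on k ?f (snd c' ` fst c')"
    unfolding chart_image_split(1)[OF c c' K]
    by (rule Ck_on_Un[OF overlap_open[OF c' c] chart_image_split(2)[OF c c' K] 1 2])
qed

text \<open>As for functions; on the overlap the components in the other chart arise by applying the smooth
  differential of the transition map.\<close>

lemma Ck_field_extend_by_zero:
  assumes c: "c \<in> A" and K: "compact K" "K \<subseteq> snd c ` fst c"
    and F: "Ck_on k F (snd c ` fst c)" "\<And>y. y \<in> snd c ` fst c - K \<Longrightarrow> F y = 0"
  shows "Ck_field A k (\<lambda>p. if p \<in> fst c then from_coord A c p (F (snd c p)) else 0)"
  unfolding Ck_field_def
proof
  fix c' assume c': "c' \<in> A"
  let ?V = "\<lambda>p. if p \<in> fst c then from_coord A c p (F (snd c p)) else 0"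
  let ?f = "\<lambda>y. to_coord A c' (chart_inv c' y) (?V (chart_inv c' y))"
  let ?\<tau> = "\<lambda>y. snd c (chart_inv c' y)"
  note op = overlap_open[OF c' c]
  have im: "?\<tau> ` (snd c' ` (fst c' \<inter> fst c)) \<subseteq> snd c ` (fst c \<inter> fst c')"
    using c' by (auto simp: chart_inv_left)
  have "Ck_on k (\<lambda>y. \<Sum>b\<in>Basis. (F (?\<tau> y) \<bullet> b) *\<^sub>R fderiv (\<lambda>y. snd c' (chart_inv c y)) (?\<tau> y) b)
      (snd c' ` (fst c' \<inter> fst c))"
  proof (intro Ck_on_sum op Ck_on_scaleR Ck_on_bounded_linear[OF bounded_linear_inner_left])
    show "Ck_on k (\<lambda>y. F (?\<tau> y)) (snd c' ` (fst c' \<inter> fst c))"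
      by (rule Ck_on_compose[OF op chart_open(2)[OF c] transition_smooth[OF c' c] F(1)]) (use im in auto)
    show "Ck_on k (\<lambda>y. fderiv (\<lambda>y. snd c' (chart_inv c y)) (?\<tau> y) b) (snd c' ` (fst c' \<inter> fst c))" for b
      by (rule Ck_on_compose[OF op overlap_open[OF c c'] transition_smooth[OF c' c] _ im])
         (rule Ck_on_fderiv[OF transition_smooth[OF c c', of "Suc k"]], simp)
  qed
  then have 1: "Ck_on k ?f (snd c' ` (fst c' \<inter> fst c))"
  proof (rule Ck_on_cong[OF op])
    fix y assume "y \<in> snd c' ` (fst c' \<inter> fst c)"
    then obtain p where p: "p \<in> fst c'" "p \<in> fst c" "y = snd c' p" by auto
    then have "?f y = transition_deriv c c' p (F (snd c p))"
      using c c' by (simp add: chart_inv_left to_from_coord_charts)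
    also have "\<dots> = (\<Sum>b\<in>Basis. (F (snd c p) \<bullet> b) *\<^sub>R transition_deriv c c' p b)"
      using c c' p by (intro linear_eq_sum_Basis transition_deriv_linear)
    finally show "(\<Sum>b\<in>Basis. (F (?\<tau> y) \<bullet> b) *\<^sub>R fderiv (\<lambda>y. snd c' (chart_inv c y)) (?\<tau> y) b) = ?f y"
      using p c' by (simp add: chart_inv_left transition_deriv_def)
  qed
  have 2: "Ck_on k ?f (snd c' ` (fst c' - chart_inv c ` K))"
  proof (rule Ck_on_cong[OF chart_image_split(2)[OF c c' K] Ck_on_const[of _ 0]])
    fix y assume "y \<in> snd c' ` (fst c' - chart_inv c ` K)"
    then obtain p where p: "p \<in> fst c'" "p \<notin> chart_inv c ` K" "y = snd c' p" by auto
    have F0: "F (snd c p) = 0" if "p \<in> fst c"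
      using F(2)[of "snd c p"] that p(2) c by (metis DiffI chart_inv_left image_eqI)
    then have "?V p = 0"
      using c by (auto simp: linear_0[OF linear_from_coord])
    moreover have "chart_inv c' y = p" using p c' by (simp add: chart_inv_left)
    ultimately show "0 = ?f y" using p c' by (simp only: linear_0[OF linear_to_coord])
  qed
  show "Ck_on k ?f (snd c' ` fst c')"
    unfolding chart_image_split(1)[OF c c' K]
    by (rule Ck_on_Un[OF op chart_image_split(2)[OF c c' K] 1 2])
qed

end

section \<open>Gradients\<close>

locale riemannian = smooth_manifold A for A :: "('p::{t2_space,second_countable_topology}, 'e::euclidean_space) chart set" +
  fixes met :: "'p \<Rightarrow> 'e \<Rightarrow> 'e \<Rightarrow> real"
  assumes metric: "riemannian_metric A met"
begin

text \<open>The matrix of the metric in the chart \<open>c\<close>, as a bilinear form depending on the coordinate point.\<close>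

definition gram :: "('p, 'e) chart \<Rightarrow> 'e \<Rightarrow> 'e \<Rightarrow> 'e \<Rightarrow> real" where
  "gram c y u v = met (chart_inv c y) (from_coord A c (chart_inv c y) u) (from_coord A c (chart_inv c y) v)"

lemma met_bilinear: "bilinear (met x)"
  and met_sym: "met x u v = met x v u"
  and met_pos: "u \<noteq> 0 \<Longrightarrow> met x u u > 0"
  using metric unfolding riemannian_metric_def by blast+

lemma gram_smooth: "c \<in> A \<Longrightarrow> Ck_on k (\<lambda>y. gram c y u v) (snd c ` fst c)"
  using metric unfolding riemannian_metric_def gram_def smooth_on_def by blast

lemma gram_sym: "gram c y u v = gram c y v u"
  unfolding gram_def by (rule met_sym)

lemma gram_bilinear:
  assumes "c \<in> A" "y \<in> snd c ` fst c"
  shows "bilinear (gram c y)"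
proof -
  have l: "linear (from_coord A c (chart_inv c y))"
    using assms by (intro linear_from_coord chart_inv_mem)
  show ?thesis
    using met_bilinear[of "chart_inv c y"] unfolding bilinear_def gram_def
    by (auto intro: linear_compose[OF l, unfolded o_def])
qed

lemma gram_pos:
  assumes "c \<in> A" "y \<in> snd c ` fst c" "u \<noteq> 0"
  shows "gram c y u u > 0"
proof -
  have "to_coord A c (chart_inv c y) (from_coord A c (chart_inv c y) u) = u"
    using assms by (intro to_from_coord chart_inv_mem)
  then have "from_coord A c (chart_inv c y) u \<noteq> 0"
    using assms linear_0[OF linear_to_coord[OF assms(1) chart_inv_mem[OF assms(1,2)]]] by metis
  then show ?thesis unfolding gram_def by (rule met_pos)
qed

lemma met_grad:
  assumes "Ck_fun A k \<theta>" "0 < k"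
  shows "met x (grad A met \<theta> x) \<xi> = differential A \<theta> x \<xi>"
proof -
  have "\<exists>!u. \<forall>v. met x u v = differential A \<theta> x v"
    by (rule posdef_representation[OF met_bilinear met_pos differential_linear[OF assms]])
  from theI'[OF this] show ?thesis unfolding grad_def by blast
qed

text \<open>The coordinates of the gradient solve the linear system given by the metric and the differential.
  Membership in the class of \<open>C\<^sup>1\<close> fields is what makes the axioms of the connection applicable to it.\<close>

lemma grad_C1_field:
  assumes "Ck_fun A 2 \<theta>"
  shows "Ck_field A 1 (grad A met \<theta>)"
  unfolding Ck_field_def
proof
  fix c assume c: "c \<in> A"
  let ?F = "\<lambda>y. \<theta> (chart_inv c y)"
  show "Ck_on 1 (\<lambda>y. to_coord A c (chart_inv c y) (grad A met \<theta> (chart_inv c y))) (snd c ` fst c)"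
  proof (rule posdef_solution_C1[where G = "gram c" and \<rho> = "\<lambda>y v. fderiv ?F y v"])
    show "open (snd c ` fst c)" by (rule chart_open[OF c])
    show "bilinear (gram c y)" if "y \<in> snd c ` fst c" for y using gram_bilinear c that .
    show "0 < gram c y u u" if "y \<in> snd c ` fst c" "u \<noteq> 0" for y u using gram_pos c that .
    show "Ck_on 1 (\<lambda>y. gram c y u v) (snd c ` fst c)" for u v using gram_smooth[OF c] .
    show "Ck_on 1 (\<lambda>y. fderiv ?F y v) (snd c ` fst c)" for v
      by (rule Ck_on_fderiv[OF Ck_fun_in_chart[OF assms c]]) simp
    show "gram c y (to_coord A c (chart_inv c y) (grad A met \<theta> (chart_inv c y))) v = fderiv ?F y v"
      if y: "y \<in> snd c ` fst c" for y v
    proof -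
      let ?x = "chart_inv c y"
      note x = chart_inv_mem[OF c y]
      have "gram c y (to_coord A c ?x (grad A met \<theta> ?x)) v = met ?x (grad A met \<theta> ?x) (from_coord A c ?x v)"
        using c x by (simp add: gram_def from_to_coord)
      also have "\<dots> = differential A \<theta> ?x (from_coord A c ?x v)" using assms by (rule met_grad) simp
      also have "\<dots> = fderiv ?F y v"
        using differential_Ck_fun[OF assms _ c x] c x y by (simp add: to_from_coord chart_inv_right)
      finally show ?thesis .
    qed
  qed
qed

end

section \<open>The Hessian in coordinates\<close>

lemma max0_power_has_derivative:
  "((\<lambda>t::real. max 0 t ^ (n + 2)) has_real_derivative real (n + 2) * max 0 t ^ (n + 1)) (at t)"
proof (cases t "0::real" rule: linorder_cases)
  case less
  have "((\<lambda>t::real. 0) has_real_derivative real (n + 2) * max 0 t ^ (n + 1)) (at t)"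
    using less by simp
  then show ?thesis
    by (rule has_field_derivative_transform_within_open[of _ _ _ "{..<0}"]) (use less in auto)
next
  case greater
  have "((\<lambda>t::real. t ^ (n + 2)) has_real_derivative real (n + 2) * max 0 t ^ (n + 1)) (at t)"
    using greater DERIV_pow[of "n + 2" t UNIV] by simp
  then show ?thesis
    by (rule has_field_derivative_transform_within_open[of _ _ _ "{0<..}"]) (use greater in auto)
next
  case equal
  have "((\<lambda>h::real. max 0 h ^ (n + 1)) \<longlongrightarrow> max 0 0 ^ (n + 1)) (at 0)"
    by (intro tendsto_intros)
  then have "((\<lambda>h::real. max 0 h ^ (n + 1)) \<longlongrightarrow> 0) (at 0)" by simp
  then have "((\<lambda>h::real. (max 0 (0 + h) ^ (n + 2) - max 0 0 ^ (n + 2)) / h) \<longlongrightarrow> 0) (at 0)"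
  proof (rule Lim_transform_eventually[OF _ eventually_at_filter[THEN iffD2]])
    show "\<forall>\<^sub>F h in nhds 0. h \<noteq> 0 \<longrightarrow> h \<in> UNIV \<longrightarrow>
        max 0 h ^ (n + 1) = (max 0 (0 + h) ^ (n + 2) - max 0 0 ^ (n + 2)) / (h::real)"
      by (rule always_eventually) (auto simp: max_def)
  qed
  then show ?thesis using equal by (simp add: DERIV_def)
qed

lemma Ck_on_max0_power: "Ck_on n (\<lambda>t::real. max 0 t ^ (n + 1)) UNIV"
proof (induction n)
  case 0
  then show ?case by (auto intro!: continuous_intros)
next
  case (Suc n)
  have der: "((\<lambda>t::real. max 0 t ^ (n + 2)) has_derivative (\<lambda>v. v * (real (n + 2) * max 0 t ^ (n + 1)))) (at t)" for t
    using max0_power_has_derivative[of n t] by (simp add: has_field_derivative_def mult_commute_abs)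
  have "Ck_on n (\<lambda>t::real. v * (real (n + 2) * max 0 t ^ (n + 1))) UNIV" for v
    using Ck_on_bounded_linear[OF bounded_linear_mult_right open_UNIV Suc, of "v * real (n + 2)"]
    by (simp add: mult.assoc)
  moreover have "fderiv (\<lambda>t::real. max 0 t ^ (n + 2)) t v = v * (real (n + 2) * max 0 t ^ (n + 1))" for t v
    using fderiv_eqI[OF der] by metis
  moreover have "(\<lambda>t::real. max 0 t ^ (n + 2)) differentiable (at t)" for t
    using der differentiable_def by blast
  ultimately show ?case by simp
qed

text \<open>A bump function with a plateau, built from cubes of positive parts: \<open>s\<close> equals 1 up to 1 and 0
  from 2 on.  Class \<open>C\<^sup>2\<close> is what the torsion axiom asks of its test functions.\<close>

lemma C2_bump_exists:
  fixes p :: "'e::euclidean_space"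
  assumes "0 < r"
  shows "\<exists>\<psi>::'e \<Rightarrow> real. Ck_on 2 \<psi> UNIV \<and> (\<forall>y\<in>ball p r. \<psi> y = 1) \<and> (\<forall>y. y \<notin> cball p (2 * r) \<longrightarrow> \<psi> y = 0)"
proof -
  define s :: "real \<Rightarrow> real" where "s t = max 0 (1 + (-1) * max 0 (t + (-1)) ^ 3) ^ 3" for t
  define \<psi> where "\<psi> y = s (((y + - p) \<bullet> (y + - p)) * (1 / r\<^sup>2))" for y
  have cube: "Ck_on 2 (\<lambda>t::real. max 0 t ^ 3) UNIV"
    using Ck_on_max0_power[of 2] by (simp add: numeral_3_eq_3)
  have "Ck_on 2 s UNIV"
    unfolding s_def
    by (intro Ck_on_compose[OF open_UNIV open_UNIV _ cube] Ck_on_add Ck_on_mult Ck_on_const Ck_on_ident) auto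
  moreover have "Ck_on 2 (\<lambda>y. ((y + - p) \<bullet> (y + - p)) * (1 / r\<^sup>2)) UNIV"
    by (intro Ck_on_mult Ck_on_inner Ck_on_add Ck_on_const Ck_on_ident open_UNIV)
  ultimately have "Ck_on 2 \<psi> UNIV"
    unfolding \<psi>_def using Ck_on_compose[OF open_UNIV open_UNIV _ _ subset_UNIV] by blast
  moreover have "\<psi> y = 1" if "y \<in> ball p r" for y
  proof -
    have "(norm (y - p))\<^sup>2 \<le> r\<^sup>2" using that by (intro power_mono) (auto simp: dist_norm norm_minus_commute)
    then have "((y + - p) \<bullet> (y + - p)) * (1 / r\<^sup>2) \<le> 1"
      using assms by (simp add: power2_norm_eq_inner[symmetric] field_simps)
    then show ?thesis unfolding \<psi>_def s_def by (simp add: max_def)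
  qed
  moreover have "\<psi> y = 0" if "y \<notin> cball p (2 * r)" for y
  proof -
    define t where "t = ((y + - p) \<bullet> (y + - p)) * (1 / r\<^sup>2)"
    have "(2 * r)\<^sup>2 \<le> (norm (y - p))\<^sup>2"
      using that assms by (intro power_mono) (auto simp: dist_norm norm_minus_commute)
    then have "4 \<le> t"
      unfolding t_def using assms by (simp add: power2_norm_eq_inner[symmetric] field_simps)
    then have "1 \<le> max 0 (t + (-1)) ^ 3" by (intro one_le_power) auto
    then show ?thesis unfolding \<psi>_def s_def t_def[symmetric] by simp
  qed
  ultimately show ?thesis by blast
qed

context smooth_manifold begin

lemma differential_local:
  assumes c: "c \<in> A" and B: "open B" "B \<subseteq> snd c ` fst c" "y \<in> B"
    and F: "F differentiable (at y)" "\<And>z. z \<in> B \<Longrightarrow> \<theta> (chart_inv c z) = F z"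
  shows "differential A \<theta> (chart_inv c y) (from_coord A c (chart_inv c y) a) = fderiv F y a"
proof -
  have y: "chart_inv c y \<in> fst c" "snd c (chart_inv c y) = y"
    using chart_inv_mem[OF c] chart_inv_right[OF c] subsetD[OF B(2,3)] by blast+
  have "((\<lambda>y. \<theta> (chart_inv c y)) has_derivative fderiv F y) (at y)"
    by (rule has_derivative_transform_within_open[OF fderiv_has_derivative[OF F(1)] B(1,3)]) (simp add: F(2))
  then have d: "(\<lambda>y. \<theta> (chart_inv c y)) differentiable (at (snd c (chart_inv c y)))"
    and e: "fderiv (\<lambda>y. \<theta> (chart_inv c y)) y = fderiv F y"
    using y by (auto simp: differentiable_def dest: fderiv_eqI)
  show ?thesis using differential_in_chart[OF c y(1) d] e y c by (simp add: to_from_coord)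
qed

text \<open>The connection acts on globally defined fields.  Multiplying coordinate fields and coordinate
  functions with a bump function makes them global without changing them near \<open>p\<close>.\<close>

lemma coordinate_frame_exists:
  assumes c: "c \<in> A" and p: "p \<in> snd c ` fst c"
  obtains r W \<theta> where "0 < r" "ball p r \<subseteq> snd c ` fst c"
    "\<And>v. Ck_field A 1 (W v)" "\<And>w. Ck_fun A 2 (\<theta> w)"
    "\<And>u v. W (u + v) = (\<lambda>q. W u q + W v q)" "\<And>t v. W (t *\<^sub>R v) = (\<lambda>q. t *\<^sub>R W v q)"
    "\<And>v y. y \<in> ball p r \<Longrightarrow> W v (chart_inv c y) = from_coord A c (chart_inv c y) v"
    "\<And>w y. y \<in> ball p r \<Longrightarrow> \<theta> w (chart_inv c y) = w \<bullet> y"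
proof -
  obtain r' where r': "r' > 0" "cball p r' \<subseteq> snd c ` fst c"
    using chart_open(2)[OF c] p open_contains_cball by blast
  define r where "r = r' / 2"
  have r: "r > 0" "cball p (2 * r) \<subseteq> snd c ` fst c" using r' by (auto simp: r_def)
  have sub: "ball p r \<subseteq> snd c ` fst c" using r subset_trans[of "ball p r" "cball p (2 * r)"] by (auto simp: dist_norm)
  obtain \<psi> :: "'e \<Rightarrow> real" where \<psi>: "Ck_on 2 \<psi> UNIV" "\<And>y. y \<in> ball p r \<Longrightarrow> \<psi> y = 1"
    "\<And>y. y \<notin> cball p (2 * r) \<Longrightarrow> \<psi> y = 0"
    using C2_bump_exists[OF r(1)] by metis
  define W where "W v = (\<lambda>q. if q \<in> fst c then from_coord A c q (\<psi> (snd c q) *\<^sub>R v) else 0)" for v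
  define \<theta> where "\<theta> w = (\<lambda>q. if q \<in> fst c then \<psi> (snd c q) * (w \<bullet> snd c q) else 0)" for w
  have \<psi>2: "Ck_on 2 \<psi> (snd c ` fst c)" using \<psi>(1) Ck_on_subset by blast
  note op = chart_open(2)[OF c]
  have "Ck_field A 1 (W v)" for v
    unfolding W_def
    by (rule Ck_field_extend_by_zero[OF c compact_cball r(2)])
       (intro Ck_on_scaleR op Ck_on_const Ck_on_mono[OF \<psi>2], auto simp: \<psi>(3))
  moreover have "Ck_fun A 2 (\<theta> w)" for w
    unfolding \<theta>_def
    by (rule Ck_fun_extend_by_zero[OF c compact_cball r(2)])
       (intro Ck_on_mult op Ck_on_inner Ck_on_const Ck_on_ident \<psi>2, auto simp: \<psi>(3))
  moreover have "W (u + v) = (\<lambda>q. W u q + W v q)" for u v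
    unfolding W_def using c
    by (intro ext) (simp add: scaleR_add_right linear_add[OF linear_from_coord])
  moreover have "W (t *\<^sub>R v) = (\<lambda>q. t *\<^sub>R W v q)" for t v
  proof
    fix q
    show "W (t *\<^sub>R v) q = t *\<^sub>R W v q"
      using linear_scale[OF linear_from_coord[OF c], of q t "\<psi> (snd c q) *\<^sub>R v"]
      unfolding W_def by (simp add: mult.commute)
  qed
  moreover have "W v (chart_inv c y) = from_coord A c (chart_inv c y) v" if "y \<in> ball p r" for v y
    unfolding W_def using that sub c \<psi>(2) by (auto simp: subset_iff chart_inv_right chart_inv_mem)
  moreover have "\<theta> w (chart_inv c y) = w \<bullet> y" if "y \<in> ball p r" for w y
    unfolding \<theta>_def using that sub c \<psi>(2) by (auto simp: subset_iff chart_inv_right chart_inv_mem)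
  ultimately show thesis using r(1) sub by (intro that[of r W \<theta>])
qed

end

locale levi_civita_connection = riemannian A met
  for A :: "('p::{t2_space,second_countable_topology}, 'e::euclidean_space) chart set" and met +
  fixes nab :: "'p \<Rightarrow> 'e \<Rightarrow> ('p \<Rightarrow> 'e) \<Rightarrow> 'e"
  assumes connection: "levi_civita A met nab"
begin

lemma nab_linear: "Ck_field A 1 V \<Longrightarrow> linear (\<lambda>\<xi>. nab x \<xi> V)"
  and nab_add: "Ck_field A 1 V \<Longrightarrow> Ck_field A 1 W \<Longrightarrow> nab x \<xi> (\<lambda>y. V y + W y) = nab x \<xi> V + nab x \<xi> W"
  and nab_product: "Ck_fun A 1 \<theta> \<Longrightarrow> Ck_field A 1 V \<Longrightarrow>
        nab x \<xi> (\<lambda>y. \<theta> y *\<^sub>R V y) = differential A \<theta> x \<xi> *\<^sub>R V x + \<theta> x *\<^sub>R nab x \<xi> V"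
  and nab_metric: "Ck_field A 1 V \<Longrightarrow> Ck_field A 1 W \<Longrightarrow>
        differential A (\<lambda>y. met y (V y) (W y)) x \<xi> = met x (nab x \<xi> V) (W x) + met x (V x) (nab x \<xi> W)"
  and nab_torsion: "Ck_field A 1 V \<Longrightarrow> Ck_field A 1 W \<Longrightarrow> Ck_fun A 2 \<theta> \<Longrightarrow>
        differential A \<theta> x (nab x (V x) W - nab x (W x) V) =
          differential A (\<lambda>y. differential A \<theta> y (W y)) x (V x) -
          differential A (\<lambda>y. differential A \<theta> y (V y)) x (W x)"
  using connection unfolding levi_civita_def by blast+

lemma nab_scale:
  assumes "Ck_field A 1 V"
  shows "nab x \<xi> (\<lambda>y. t *\<^sub>R V y) = t *\<^sub>R nab x \<xi> V"
proof -
  have "Ck_fun A 1 (\<lambda>_. t)" unfolding Ck_fun_def o_def by (intro ballI Ck_on_const)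
  moreover have "differential A (\<lambda>_. t) x \<xi> = 0" by (simp add: differential_def o_def)
  ultimately show ?thesis using nab_product[of "\<lambda>_. t" V x \<xi>] assms by simp
qed

context
  fixes c p r W \<theta>
  assumes c: "c \<in> A" and sub: "ball p r \<subseteq> snd c ` fst c"
    and W1: "\<And>v. Ck_field A 1 (W v)" and \<theta>2: "\<And>w. Ck_fun A 2 (\<theta> w)"
    and W_add: "\<And>u v. W (u + v) = (\<lambda>q. W u q + W v q)"
    and W_scale: "\<And>t v. W (t *\<^sub>R v) = (\<lambda>q. t *\<^sub>R W v q)"
    and W_at: "\<And>v y. y \<in> ball p r \<Longrightarrow> W v (chart_inv c y) = from_coord A c (chart_inv c y) v"
    and \<theta>_at: "\<And>w y. y \<in> ball p r \<Longrightarrow> \<theta> w (chart_inv c y) = w \<bullet> y"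
begin

text \<open>The Christoffel symbols of the chart: the covariant derivative of the coordinate field with
  components \<open>b\<close> in the direction with components \<open>a\<close>.\<close>

definition christoffel :: "'e \<Rightarrow> 'e \<Rightarrow> 'e \<Rightarrow> 'e" where
  "christoffel y a b = to_coord A c (chart_inv c y) (nab (chart_inv c y) (from_coord A c (chart_inv c y) a) (W b))"

lemma in_dom:
  assumes "y \<in> ball p r"
  shows "y \<in> snd c ` fst c" "chart_inv c y \<in> fst c" "snd c (chart_inv c y) = y"
  using assms sub c by (auto simp: subset_iff chart_inv_right chart_inv_mem)

lemma from_coord_christoffel:
  "y \<in> ball p r \<Longrightarrow> from_coord A c (chart_inv c y) (christoffel y a b) = nab (chart_inv c y) (from_coord A c (chart_inv c y) a) (W b)"
  unfolding christoffel_def using c in_dom by (simp add: from_to_coord)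

lemma christoffel_bilinear:
  assumes y: "y \<in> ball p r"
  shows "bilinear (christoffel y)"
  unfolding bilinear_def
proof (intro conjI allI)
  let ?x = "chart_inv c y"
  note x = in_dom[OF y]
  note lt = linear_to_coord[OF c x(2)]
  show "linear (\<lambda>b. christoffel y a b)" for a
    by (rule linearI)
       (simp_all add: christoffel_def W_add W_scale nab_add[OF W1 W1] nab_scale[OF W1] linear_add[OF lt] linear_scale[OF lt])
  show "linear (\<lambda>a. christoffel y a b)" for b
    by (rule linearI)
       (simp_all add: christoffel_def linear_add[OF nab_linear[OF W1]] linear_scale[OF nab_linear[OF W1]]
         linear_add[OF linear_from_coord[OF c x(2)]] linear_scale[OF linear_from_coord[OF c x(2)]]
         linear_add[OF lt] linear_scale[OF lt])
qed

text \<open>Coordinate fields commute, and coordinate functions separate tangent vectors.\<close>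

lemma christoffel_sym:
  assumes y: "y \<in> ball p r"
  shows "christoffel y a b = christoffel y b a"
proof -
  let ?x = "chart_inv c y"
  note x = in_dom[OF y]
  note loc = differential_local[OF c open_ball sub]
  define \<delta> where "\<delta> = nab ?x (W a ?x) (W b) - nab ?x (W b ?x) (W a)"
  have d\<theta>: "differential A (\<theta> w) (chart_inv c z) (W v (chart_inv c z)) = w \<bullet> v" if "z \<in> ball p r" for w v z
    using loc[OF that, of "\<lambda>z. w \<bullet> z" "\<theta> w" v] W_at[OF that] \<theta>_at
    by (simp add: fderiv_eqI[OF has_derivative_inner_right[OF has_derivative_ident]])
  have dd: "differential A (\<lambda>q. differential A (\<theta> w) q (W v q)) ?x (W u ?x) = 0" for w u v
    using loc[OF y, of "\<lambda>_. w \<bullet> v" "\<lambda>q. differential A (\<theta> w) q (W v q)" u] d\<theta> W_at[OF y] by simp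
  have "w \<bullet> to_coord A c ?x \<delta> = 0" for w
  proof -
    have "w \<bullet> to_coord A c ?x \<delta> = differential A (\<theta> w) ?x (from_coord A c ?x (to_coord A c ?x \<delta>))"
      using loc[OF y, of "\<lambda>z. w \<bullet> z" "\<theta> w"] \<theta>_at
      by (simp add: fderiv_eqI[OF has_derivative_inner_right[OF has_derivative_ident]])
    also have "\<dots> = differential A (\<theta> w) ?x \<delta>" using c x by (simp add: from_to_coord)
    also have "\<dots> = 0" unfolding \<delta>_def using nab_torsion[OF W1 W1 \<theta>2] dd by simp
    finally show ?thesis .
  qed
  then have "to_coord A c ?x \<delta> = 0" using inner_eq_zero_iff by blast
  then show ?thesis
    unfolding \<delta>_def christoffel_def using W_at[OF y] linear_diff[OF linear_to_coord[OF c x(2)]] by simp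
qed

lemma gram_derivative:
  assumes y: "y \<in> ball p r"
  shows "fderiv (\<lambda>z. gram c z b v) y a = gram c y (christoffel y a b) v + gram c y b (christoffel y a v)"
proof -
  let ?x = "chart_inv c y"
  have "fderiv (\<lambda>z. gram c z b v) y a = differential A (\<lambda>q. met q (W b q) (W v q)) ?x (from_coord A c ?x a)"
  proof (rule differential_local[OF c open_ball sub y, symmetric])
    show "(\<lambda>z. gram c z b v) differentiable (at y)"
      using gram_smooth[OF c, of 1] in_dom(1)[OF y] by auto
    show "met (chart_inv c z) (W b (chart_inv c z)) (W v (chart_inv c z)) = gram c z b v" if "z \<in> ball p r" for z
      using W_at[OF that] by (simp add: gram_def)
  qed
  also have "\<dots> = gram c y (christoffel y a b) v + gram c y b (christoffel y a v)"
    using nab_metric[OF W1 W1] from_coord_christoffel[OF y] W_at[OF y] by (simp add: gram_def)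
  finally show ?thesis .
qed

text \<open>The Koszul formula for coordinate fields.  It expresses the connection through first derivatives
  of the metric, the only source of any regularity of the connection in the base point.\<close>

lemma koszul:
  assumes y: "y \<in> ball p r"
  shows "2 * gram c y (christoffel y a b) v =
    fderiv (\<lambda>z. gram c z b v) y a + fderiv (\<lambda>z. gram c z a v) y b - fderiv (\<lambda>z. gram c z a b) y v"
proof -
  note s = christoffel_sym[OF y]
  show ?thesis
    unfolding gram_derivative[OF y]
    using s[of b a] s[of v a] s[of v b] gram_sym[of c y "christoffel y a v" b] gram_sym[of c y "christoffel y b v" a] by simp
qed

text \<open>Metric compatibility of the connection, applied to a coordinate field and the gradient.\<close>

lemma hessian_formula:
  assumes y: "y \<in> ball p r" and \<phi>: "Ck_fun A 2 \<phi>"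
  shows "met (chart_inv c y) (Hess A met nab \<phi> (chart_inv c y) (from_coord A c (chart_inv c y) u))
      (from_coord A c (chart_inv c y) v) =
    fderiv2 (\<lambda>z. \<phi> (chart_inv c z)) y u v - fderiv (\<lambda>z. \<phi> (chart_inv c z)) y (christoffel y u v)"
proof -
  let ?x = "chart_inv c y" and ?F = "\<lambda>z. \<phi> (chart_inv c z)"
  let ?u = "from_coord A c ?x u"
  have d: "differential A \<phi> (chart_inv c z) (from_coord A c (chart_inv c z) w) = fderiv ?F z w"
    if "z \<in> ball p r" for z w
    using differential_Ck_fun[OF \<phi> _ c] in_dom[OF that] c by (simp add: to_from_coord)
  have mg: "met q w (grad A met \<phi> q) = differential A \<phi> q w" for q w
    using met_grad[OF \<phi>] met_sym by simp
  have "fderiv (\<lambda>z. fderiv ?F z v) y u = differential A (\<lambda>q. met q (W v q) (grad A met \<phi> q)) ?x ?u"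
  proof (rule differential_local[OF c open_ball sub y, symmetric])
    show "(\<lambda>z. fderiv ?F z v) differentiable (at y)"
      using Ck_on_differentiable[OF Ck_on_fderiv[OF Ck_fun_in_chart[OF \<phi> c], of 1 v]] in_dom(1)[OF y] by simp
    show "met (chart_inv c z) (W v (chart_inv c z)) (grad A met \<phi> (chart_inv c z)) = fderiv ?F z v"
      if "z \<in> ball p r" for z using mg W_at[OF that] d[OF that] by simp
  qed
  also have "\<dots> = met ?x (nab ?x ?u (W v)) (grad A met \<phi> ?x) + met ?x (W v ?x) (nab ?x ?u (grad A met \<phi>))"
    by (rule nab_metric[OF W1 grad_C1_field[OF \<phi>]])
  also have "met ?x (nab ?x ?u (W v)) (grad A met \<phi> ?x) = fderiv ?F y (christoffel y u v)"
    unfolding mg from_coord_christoffel[OF y, symmetric] by (rule d[OF y])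
  finally show ?thesis using W_at[OF y] met_sym by (simp add: Hess_def)
qed

lemma christoffel_bounded:
  shows "r > 0 \<Longrightarrow> \<exists>K\<ge>0. \<forall>\<^sub>F y in nhds p. \<forall>u v. norm (christoffel y u v) \<le> K * norm u * norm v"
proof -
  assume r: "r > 0"
  let ?S = "snd c ` fst c"
  have p: "p \<in> ?S" using sub r by auto
  note op = chart_open(2)[OF c]
  \<comment> \<open>Basis fields suffice, because the symbols are bilinear.\<close>
  define bound where "bound b v K \<longleftrightarrow> K \<ge> 0 \<and>
      (\<forall>\<^sub>F y in nhds p. \<forall>a. norm (fderiv (\<lambda>z. gram c z b v) y a) \<le> K * norm a)" for b v K
  define K where "K b v = (SOME K. bound b v K)" for b v
  have "\<exists>K. bound b v K" for b v
    unfolding bound_def using C1_fderiv_bounded[OF op p gram_smooth[OF c]] by blast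
  then have bK: "bound b v (K b v)" for b v unfolding K_def by (rule someI_ex)
  have K: "K b v \<ge> 0"
    "\<forall>\<^sub>F y in nhds p. \<forall>a. norm (fderiv (\<lambda>z. gram c z b v) y a) \<le> K b v * norm a" for b v
    using bK[of b v] unfolding bound_def by auto
  define M where "M = (\<Sum>b\<in>Basis. \<Sum>v\<in>Basis. K b v)"
  have M: "K b v \<le> M" if "b \<in> Basis" "v \<in> Basis" for b v
  proof -
    have "K b v \<le> (\<Sum>v\<in>Basis. K b v)" using K that by (intro member_le_sum) auto
    also have "\<dots> \<le> M" unfolding M_def using K that by (intro member_le_sum) (auto intro: sum_nonneg)
    finally show ?thesis .
  qed
  have M0: "M \<ge> 0" unfolding M_def using K by (intro sum_nonneg) auto
  have ev1: "\<forall>\<^sub>F y in nhds p. \<forall>b\<in>Basis. \<forall>v\<in>Basis. \<forall>a. norm (fderiv (\<lambda>z. gram c z b v) y a) \<le> K b v * norm a"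
    using K(2) by (intro eventually_ball_finite ballI) auto
  obtain m where m: "m > 0" "\<forall>\<^sub>F y in nhds p. \<forall>u. m * (norm u)\<^sup>2 \<le> gram c y u u"
    using locally_uniformly_coercive[OF op p gram_bilinear[OF c] gram_pos[OF c p]
        Ck_on_imp_continuous[OF gram_smooth[OF c]]] by blast
  have ev3: "\<forall>\<^sub>F y in nhds p. y \<in> ball p r" using r by (intro eventually_nhds_in_open) auto
  define n where "n = real DIM('e)"
  define N where "N = n * (3 / 2 * M) / m"
  have "\<forall>\<^sub>F y in nhds p. \<forall>u v. norm (christoffel y u v) \<le> n * (n * N) * norm u * norm v"
    using ev1 m(2) ev3
  proof eventually_elim
    case (elim y)
    have y: "y \<in> ball p r" by fact
    note gb = gram_bilinear[OF c in_dom(1)[OF y]]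
    have "norm (christoffel y a b) \<le> N" if ab: "a \<in> Basis" "b \<in> Basis" for a b
    proof -
      have D: "\<bar>fderiv (\<lambda>z. gram c z b v) y a\<bar> \<le> M" if "b \<in> Basis" "v \<in> Basis" "a \<in> Basis" for a b v
        using elim(1)[rule_format, of b v a] M[of b v] that by simp
      have "\<bar>gram c y (christoffel y a b) v\<bar> \<le> 3 / 2 * M" if v: "v \<in> Basis" for v
        using koszul[OF y, of a b v] D[of b v a] D[of a v b] D[of a b v] ab v by linarith
      then have "(\<Sum>v\<in>Basis. \<bar>gram c y (christoffel y a b) v\<bar>) \<le> (\<Sum>v\<in>(Basis::'e set). 3 / 2 * M)"
        by (rule sum_mono)
      also have "\<dots> = n * (3 / 2 * M)" by (simp add: n_def)
      finally show ?thesis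
        using coercive_norm_le[OF gb m(1), of "christoffel y a b"] elim(2) divide_right_mono[of _ _ m] m(1)
        unfolding N_def by (meson less_imp_le order.trans)
    qed
    then show ?case
      using bilinear_norm_le_Basis[OF christoffel_bilinear[OF y], of N] by (simp add: n_def)
  qed
  moreover have "n * (n * N) \<ge> 0" unfolding N_def n_def using M0 m by simp
  ultimately show ?thesis by blast
qed

end

definition hessian_expansion :: "('p, 'e) chart \<Rightarrow> real \<Rightarrow> ('e \<Rightarrow> 'e \<Rightarrow> 'e) \<Rightarrow> 'e \<Rightarrow> bool" where
  "hessian_expansion c K \<Gamma> y \<longleftrightarrow> (\<forall>u v. norm (\<Gamma> u v) \<le> K * norm u * norm v) \<and>
    (\<forall>\<phi> u v. Ck_fun A 2 \<phi> \<longrightarrow>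
      met (chart_inv c y) (Hess A met nab \<phi> (chart_inv c y) (from_coord A c (chart_inv c y) u))
        (from_coord A c (chart_inv c y) v) =
      fderiv2 (\<lambda>z. \<phi> (chart_inv c z)) y u v - fderiv (\<lambda>z. \<phi> (chart_inv c z)) y (\<Gamma> u v))"

text \<open>The correction \<open>\<Gamma>\<close> is bounded uniformly near \<open>p\<close> and does not depend on the function.\<close>

theorem hessian_in_chart:
  assumes c: "c \<in> A" and p: "p \<in> snd c ` fst c"
  shows "\<exists>K\<ge>0. \<exists>\<Gamma>. \<forall>\<^sub>F y in nhds p. hessian_expansion c K (\<Gamma> y) y"
proof (rule coordinate_frame_exists[OF c p])
  fix r and W :: "'e \<Rightarrow> 'p \<Rightarrow> 'e" and \<theta> :: "'e \<Rightarrow> 'p \<Rightarrow> real"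
  assume r: "0 < r" and sub: "ball p r \<subseteq> snd c ` fst c"
    and W: "\<And>v. Ck_field A 1 (W v)" "\<And>w. Ck_fun A 2 (\<theta> w)"
      "\<And>u v. W (u + v) = (\<lambda>q. W u q + W v q)" "\<And>t v. W (t *\<^sub>R v) = (\<lambda>q. t *\<^sub>R W v q)"
      "\<And>v y. y \<in> ball p r \<Longrightarrow> W v (chart_inv c y) = from_coord A c (chart_inv c y) v"
      "\<And>w y. y \<in> ball p r \<Longrightarrow> \<theta> w (chart_inv c y) = w \<bullet> y"
  obtain K where K: "K \<ge> 0" "\<forall>\<^sub>F y in nhds p. \<forall>u v. norm (christoffel c W y u v) \<le> K * norm u * norm v"
    using christoffel_bounded[OF c sub W r] by blast
  have "\<forall>\<^sub>F y in nhds p. y \<in> ball p r" using r by (intro eventually_nhds_in_open) auto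
  with K(2) have "\<forall>\<^sub>F y in nhds p. hessian_expansion c K (christoffel c W y) y"
  proof eventually_elim
    case (elim y)
    then show ?case
      unfolding hessian_expansion_def using hessian_formula[OF c sub W] by blast
  qed
  then show ?thesis using K(1) by blast
qed

end

section \<open>Retractions in coordinates\<close>

text \<open>In coordinates a retraction is a \<open>C\<^sup>2\<close> map of position and direction that at direction zero is the
  identity with identity differential, so it agrees with addition up to second order.  The uniform
  Taylor estimate on the product space makes the constant independent of the base point.\<close>

lemma (in smooth_manifold) retraction_in_chart:
  assumes R: "riem_retraction A R" and c: "c \<in> A" and p: "p \<in> snd c ` fst c"
  obtains \<delta> K where "0 < \<delta>" "0 \<le> K"
    "\<And>y w. norm (y - p) < \<delta> \<Longrightarrow> norm w < \<delta> \<Longrightarrow> y \<in> snd c ` fst c \<Longrightarrow>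
       R (chart_inv c y) (from_coord A c (chart_inv c y) w) \<in> fst c \<and>
       norm (snd c (R (chart_inv c y) (from_coord A c (chart_inv c y) w)) - (y + w)) \<le> K * (norm w)\<^sup>2"
proof -
  define F where "F = (\<lambda>(y, w). R (chart_inv c y) (from_coord A c (chart_inv c y) w))"
  define D where "D c' = {(y, w). y \<in> snd c ` fst c \<and> F (y, w) \<in> fst c'}" for c' :: "('p, 'e) chart"
  have R0: "R x 0 = x" and R1: "((\<lambda>v. snd (chart_at A x) (R x v)) has_derivative (\<lambda>v. v)) (at 0)" for x
    using R unfolding riem_retraction_def by (auto simp: o_def id_def)
  have oD: "open (D c')" and sm: "smooth_on (\<lambda>q. snd c' (F q)) (D c')" if "c' \<in> A" for c'
    using R c that unfolding riem_retraction_def D_def F_def Let_def o_def by blast+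
  have lin: "linear (from_coord A c (chart_inv c y))" if "y \<in> snd c ` fst c" for y
    using that c by (intro linear_from_coord chart_inv_mem)
  have F0: "F (y, 0) = chart_inv c y" if "y \<in> snd c ` fst c" for y
    unfolding F_def using R0 linear_0[OF lin[OF that]] by simp
  have P0: "(p, 0) \<in> D c" unfolding D_def using p F0 c by (auto intro: chart_inv_mem)
  have \<Phi>2: "Ck_on 2 (\<lambda>q. snd c (F q)) (D c)" using sm[OF c] by (rule smooth_on_imp_Ck_on)
  obtain \<delta> K where \<delta>: "\<delta> > 0" "K \<ge> 0" "ball (p, 0) \<delta> \<subseteq> D c"
    "\<And>q q'. q \<in> ball (p, 0) \<delta> \<Longrightarrow> q' \<in> ball (p, 0) \<delta> \<Longrightarrow>
      norm (snd c (F q') - snd c (F q) - fderiv (\<lambda>q. snd c (F q)) q (q' - q)) \<le> K * (norm (q' - q))\<^sup>2"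
    using C2_Taylor[OF oD[OF c] P0 \<Phi>2] by metis
  have der: "fderiv (\<lambda>q. snd c (F q)) (y, 0) (0, w) = w" if y: "(y, 0) \<in> D c" for y w
  proof -
    let ?x = "chart_inv c y" and ?ca = "chart_at A (chart_inv c y)"
    have yS: "y \<in> snd c ` fst c" using y by (auto simp: D_def)
    note x = chart_inv_mem[OF c yS]
    have pair: "((\<lambda>w. (y, w)) has_derivative (\<lambda>w. (0, w))) (at 0)"
      by (intro has_derivative_Pair has_derivative_const has_derivative_ident)
    have "((\<lambda>q. snd c (F q)) has_derivative fderiv (\<lambda>q. snd c (F q)) (y, 0)) (at (y, 0))"
      using Ck_on_has_derivative[OF \<Phi>2 _ y] by simp
    from has_derivative_compose[OF pair this]
    \<comment> \<open>The partial differential in direction \<open>w\<close> is computed twice: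
      from the differential on the product, and through the chart chosen at the base point, where
      the retraction axiom speaks.\<close>
    have 1: "((\<lambda>w. snd c (F (y, w))) has_derivative (\<lambda>w. fderiv (\<lambda>q. snd c (F q)) (y, 0) (0, w))) (at 0)" .
    have l0: "((\<lambda>w. from_coord A c ?x w) has_derivative (\<lambda>w. from_coord A c ?x w)) (at 0)"
      using lin[OF yS] by (simp add: linear_conv_bounded_linear bounded_linear_imp_has_derivative)
    have "((\<lambda>v. snd ?ca (R ?x v)) has_derivative (\<lambda>v. v)) (at (from_coord A c ?x 0))"
      using R1[of ?x] linear_0[OF lin[OF yS]] by simp
    from has_derivative_compose[OF l0 this]
    have l1: "((\<lambda>w. snd ?ca (R ?x (from_coord A c ?x w))) has_derivative (\<lambda>w. from_coord A c ?x w)) (at 0)" .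
    have "((\<lambda>z. snd c (chart_inv ?ca z)) has_derivative transition_deriv ?ca c ?x) (at (snd ?ca (R ?x (from_coord A c ?x 0))))"
      using fderiv_has_derivative[OF transition_differentiable[OF chart_at(1) c chart_at(2) x]]
        linear_0[OF lin[OF yS]] R0 by (simp add: transition_deriv_def)
    from has_derivative_compose[OF l1 this]
    have "((\<lambda>w. snd c (chart_inv ?ca (snd ?ca (R ?x (from_coord A c ?x w))))) has_derivative
        (\<lambda>w. transition_deriv ?ca c ?x (from_coord A c ?x w))) (at 0)" .
    moreover have "transition_deriv ?ca c ?x (from_coord A c ?x w) = w" for w
      using to_from_coord[OF c x] by (simp add: to_coord_eq_transition_deriv)
    ultimately have l2: "((\<lambda>w. snd c (chart_inv ?ca (snd ?ca (R ?x (from_coord A c ?x w))))) has_derivative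
        (\<lambda>w. w)) (at 0)" by simp
    have "open (Pair y -` D ?ca)"
      by (intro open_vimage oD chart_at continuous_on_Pair continuous_on_const continuous_on_id)
    moreover have "0 \<in> Pair y -` D ?ca"
      using yS F0[OF yS] chart_at(2) by (simp add: D_def)
    ultimately have "((\<lambda>w. snd c (F (y, w))) has_derivative (\<lambda>w. w)) (at 0)"
      by (rule has_derivative_transform_within_open[OF l2])
         (auto simp: D_def F_def chart_inv_left[OF chart_at(1)])
    from has_derivative_unique[OF 1 this] show ?thesis by (rule fun_cong)
  qed
  show thesis
  proof (rule that[of "\<delta> / 2" K])
    fix y w :: 'e assume yw: "norm (y - p) < \<delta> / 2" "norm w < \<delta> / 2" and y: "y \<in> snd c ` fst c"
    have "dist (p, 0) (y, w) \<le> norm (y - p) + norm w"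
      using norm_Pair_le[of "p - y" "- w"] by (simp add: dist_norm norm_minus_commute)
    then have q': "(y, w) \<in> ball (p, 0) \<delta>" using yw by simp
    have q: "(y, 0) \<in> ball (p, 0) \<delta>" using yw \<delta>(1) by (simp add: dist_Pair_Pair dist_norm norm_minus_commute)
    have "norm (snd c (F (y, w)) - snd c (F (y, 0)) - fderiv (\<lambda>q. snd c (F q)) (y, 0) ((y, w) - (y, 0)))
        \<le> K * (norm ((y, w) - (y, 0)))\<^sup>2" by (rule \<delta>(4)[OF q q'])
    then have "norm (snd c (F (y, w)) - (y + w)) \<le> K * (norm w)\<^sup>2"
      using der[OF subsetD[OF \<delta>(3) q]] F0[OF y] chart_inv_right[OF c y]
      by (simp add: norm_Pair algebra_simps)
    moreover have "F (y, w) \<in> fst c" using subsetD[OF \<delta>(3) q'] by (simp add: D_def)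
    ultimately show "R (chart_inv c y) (from_coord A c (chart_inv c y) w) \<in> fst c \<and>
       norm (snd c (R (chart_inv c y) (from_coord A c (chart_inv c y) w)) - (y + w)) \<le> K * (norm w)\<^sup>2"
      by (simp add: F_def)
  qed (use \<delta> in auto)
qed

section \<open>The constrained problem near the solution\<close>

lemma (in riemannian) met_grad_from_coord:
  assumes "Ck_fun A k \<theta>" "0 < k" "c \<in> A" "x \<in> fst c"
  shows "met x (grad A met \<theta> x) (from_coord A c x v) = fderiv (\<lambda>y. \<theta> (chart_inv c y)) (snd c x) v"
  using met_grad[OF assms(1,2)] differential_Ck_fun[OF assms] assms by (simp add: to_from_coord)

lemma (in riemannian) met_nondegenerate:
  assumes "c \<in> A" "x \<in> fst c" "\<And>v. met x u (from_coord A c x v) = 0"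
  shows "u = 0"
  using assms(3)[of "to_coord A c x u"] met_pos[of u x] assms(1,2) by (fastforce simp: from_to_coord)

lemma fderiv_linear_combination:
  fixes F :: "'e::euclidean_space \<Rightarrow> real"
  assumes "F differentiable (at y)" "\<And>l. l \<in> I \<Longrightarrow> G l differentiable (at y)"
  shows "fderiv (\<lambda>z. F z + (\<Sum>l\<in>I. w l * G l z)) y v = fderiv F y v + (\<Sum>l\<in>I. w l * fderiv (G l) y v)"
proof -
  have "((\<lambda>z. F z + (\<Sum>l\<in>I. w l * G l z)) has_derivative
      (\<lambda>v. fderiv F y v + (\<Sum>l\<in>I. w l * fderiv (G l) y v))) (at y)"
    by (intro has_derivative_add has_derivative_sum has_derivative_mult_right fderiv_has_derivative assms)
  then show ?thesis by (simp add: fderiv_eqI)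
qed

locale constrained_problem = levi_civita_connection A met nab
  for A :: "('p::{t2_space,second_countable_topology}, 'e::euclidean_space) chart set" and met nab +
  fixes f :: "'p \<Rightarrow> real" and g h :: "nat \<Rightarrow> 'p \<Rightarrow> real" and m n :: nat
    and xs :: 'p and \<mu>s lams :: "nat \<Rightarrow> real" and ch :: "('p, 'e) chart"
  assumes ch: "ch \<in> A" "xs \<in> fst ch"
    and f3: "Ck_fun A 3 f" and g2: "\<And>i. i \<in> {1..m} \<Longrightarrow> Ck_fun A 2 (g i)"
    and g3: "\<And>i. i \<in> active_set g m xs \<Longrightarrow> Ck_fun A 3 (g i)" and h3: "\<And>j. j \<in> {1..n} \<Longrightarrow> Ck_fun A 3 (h j)"
    and kkt: "KKT A met f g h m n xs \<mu>s lams" and licq: "LICQ A met g h m n xs"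
    and strict: "strict_complementarity g m xs \<mu>s"
begin

text \<open>Inequalities are the left and equalities the right summands of the index type, so that both kinds
  of constraints form a single family.\<close>

abbreviation "p \<equiv> snd ch xs"
abbreviation "\<Omega> \<equiv> snd ch ` fst ch"

definition obj :: "'e \<Rightarrow> real" where "obj y = f (chart_inv ch y)"
definition con :: "nat + nat \<Rightarrow> 'e \<Rightarrow> real" where
  "con l y = case_sum (\<lambda>i. g i (chart_inv ch y)) (\<lambda>j. h j (chart_inv ch y)) l"
definition con_index :: "(nat + nat) set" where "con_index = {1..m} <+> {1..n}"
definition active_index :: "(nat + nat) set" where "active_index = active_set g m xs <+> {1..n}"
definition eq_index :: "(nat + nat) set" where "eq_index = {} <+> {1..n}"

lemma con_simps: "con (Inl i) = (\<lambda>y. g i (chart_inv ch y))" "con (Inr j) = (\<lambda>y. h j (chart_inv ch y))"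
  by (auto simp: con_def)

lemma p_in: "p \<in> \<Omega>" using ch by auto

lemma f2: "Ck_fun A 2 f" and h2: "j \<in> {1..n} \<Longrightarrow> Ck_fun A 2 (h j)"
  using f3 h3[of j] Ck_on_mono[of 3 _ _ 2] unfolding Ck_fun_def by (auto simp del: Ck_on.simps)

lemma active_subset: "active_set g m xs \<subseteq> {1..m}" by (auto simp: active_set_def)

lemma sum_con_index: "(\<Sum>l\<in>con_index. b l) = (\<Sum>i\<in>{1..m}. b (Inl i)) + (\<Sum>j\<in>{1..n}. b (Inr j))"
  unfolding con_index_def by (subst sum.Plus) auto

lemma sum_active_index: "(\<Sum>l\<in>active_index. b l) = (\<Sum>i\<in>active_set g m xs. b (Inl i)) + (\<Sum>j\<in>{1..n}. b (Inr j))"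
  unfolding active_index_def using finite_subset[OF active_subset] by (subst sum.Plus) auto

lemma obj_C3: "Ck_on 3 obj \<Omega>"
  using Ck_fun_in_chart[OF f3 ch(1)] by (simp only: obj_def[abs_def])

lemma con_C2: "l \<in> con_index \<Longrightarrow> Ck_on 2 (con l) \<Omega>"
  unfolding con_index_def using Ck_fun_in_chart[OF g2 ch(1)] Ck_fun_in_chart[OF h2 ch(1)]
  by (elim PlusE) (simp_all only: con_simps)

lemma con_C3: "l \<in> active_index \<Longrightarrow> Ck_on 3 (con l) \<Omega>"
  unfolding active_index_def using Ck_fun_in_chart[OF g3 ch(1)] Ck_fun_in_chart[OF h3 ch(1)]
  by (elim PlusE) (simp_all only: con_simps)

lemma lagrangian_in_chart:
  "lagrangian f g h m n \<mu> lam (chart_inv ch y) = obj y + (\<Sum>l\<in>con_index. case_sum \<mu> lam l * con l y)"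
  by (simp add: lagrangian_def obj_def sum_con_index con_simps)

lemma lagrangian_C2: "Ck_fun A 2 (lagrangian f g h m n \<mu> lam)"
  unfolding Ck_fun_def lagrangian_def[abs_def] o_def
  by (intro ballI Ck_on_add Ck_on_sum Ck_on_mult Ck_on_const chart_open Ck_fun_in_chart f2 g2 h2)

definition lagr_deriv :: "(nat + nat \<Rightarrow> real) \<Rightarrow> 'e \<Rightarrow> 'e \<Rightarrow> real" where
  "lagr_deriv \<eta> y v = fderiv obj y v + (\<Sum>l\<in>con_index. \<eta> l * fderiv (con l) y v)"

lemma fderiv_lagrangian:
  assumes "y \<in> \<Omega>"
  shows "fderiv (\<lambda>y. lagrangian f g h m n \<mu> lam (chart_inv ch y)) y v = lagr_deriv (case_sum \<mu> lam) y v"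
  unfolding lagrangian_in_chart lagr_deriv_def
  using Ck_on_differentiable[OF obj_C3 _ assms] Ck_on_differentiable[OF con_C2 _ assms]
  by (intro fderiv_linear_combination) auto

lemma fderiv_fderiv_lagrangian:
  assumes "y \<in> \<Omega>"
  shows "fderiv2 (\<lambda>y. lagrangian f g h m n \<mu> lam (chart_inv ch y)) y u v =
    fderiv2 obj y u v + (\<Sum>l\<in>con_index. case_sum \<mu> lam l * fderiv2 (con l) y u v)"
proof -
  have d: "(\<lambda>z. fderiv obj z v) differentiable (at y)" "\<And>l. l \<in> con_index \<Longrightarrow> (\<lambda>z. fderiv (con l) z v) differentiable (at y)"
    using Ck_on_differentiable[OF Ck_on_fderiv[OF obj_C3, of 1 v] _ assms]
      Ck_on_differentiable[OF Ck_on_fderiv[OF con_C2, of _ 1 v] _ assms] by simp_all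
  then have dd: "(\<lambda>z. lagr_deriv (case_sum \<mu> lam) z v) differentiable (at y)"
    unfolding lagr_deriv_def con_index_def
    by (intro differentiable_add differentiable_sum differentiable_mult differentiable_const) auto
  have eq: "fderiv (\<lambda>z. lagr_deriv (case_sum \<mu> lam) z v) y =
      fderiv (\<lambda>z. fderiv (\<lambda>y. lagrangian f g h m n \<mu> lam (chart_inv ch y)) z v) y"
    using fderiv_lagrangian
    by (intro frechet_derivative_transform_within_open[OF dd chart_open(2)[OF ch(1)] assms]) simp
  show ?thesis
    unfolding eq[symmetric] unfolding lagr_deriv_def by (rule fderiv_linear_combination) (use d in auto)
qed

text \<open>Pairing with the metric turns gradients into differentials, so KKT, LICQ and strict
  complementarity become their counterparts in coordinates.\<close>

lemma chart_nlp: "chart_nlp \<Omega> p obj con con_index active_index eq_index (case_sum \<mu>s lams)"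
proof
  show "open \<Omega>" by (rule chart_open[OF ch(1)])
  show "p \<in> \<Omega>" by (rule p_in)
  show "finite con_index" by (simp add: con_index_def)
  show "active_index \<subseteq> con_index" "eq_index \<subseteq> active_index" using active_subset by (auto simp: con_index_def active_index_def eq_index_def)
  show "Ck_on 3 obj \<Omega>" by (rule obj_C3)
  show "Ck_on 2 (con l) \<Omega>" if "l \<in> con_index" for l using con_C2[OF that] .
  show "Ck_on 3 (con l) \<Omega>" if "l \<in> active_index" for l using con_C3[OF that] .
  show "fderiv obj p v + (\<Sum>l\<in>con_index. case_sum \<mu>s lams l * fderiv (con l) p v) = 0" for v
    using met_grad_from_coord[OF lagrangian_C2 _ ch, of \<mu>s lams v] kkt fderiv_lagrangian[OF p_in, of \<mu>s lams v]
    unfolding KKT_def lagr_deriv_def by (simp add: bilinear_lzero[OF met_bilinear])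
  show "con l p = 0" if "l \<in> active_index" for l
    using that kkt chart_inv_left[OF ch] unfolding active_index_def KKT_def
    by (auto simp: con_simps active_set_def)
  show "con l p < 0" "case_sum \<mu>s lams l = 0" if "l \<in> con_index - active_index" for l
    using that kkt strict chart_inv_left[OF ch] unfolding con_index_def active_index_def KKT_def strict_complementarity_def
    by (auto simp: con_simps active_set_def less_le)
  show "0 < case_sum \<mu>s lams l" if "l \<in> active_index - eq_index" for l
    using that kkt strict unfolding eq_index_def active_index_def KKT_def strict_complementarity_def
    by (auto simp: active_set_def less_le)
  show "\<forall>l\<in>active_index. w l = 0" if w: "\<And>\<xi>. (\<Sum>l\<in>active_index. w l * fderiv (con l) p \<xi>) = 0" for w
  proof -
    define G where "G = (\<Sum>i\<in>active_set g m xs. w (Inl i) *\<^sub>R grad A met (g i) xs) +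
        (\<Sum>j\<in>{1..n}. w (Inr j) *\<^sub>R grad A met (h j) xs)"
    have "met xs G (from_coord A ch xs v) = 0" for v
    proof -
      have lin: "linear (\<lambda>u. met xs u (from_coord A ch xs v))"
        using met_bilinear by (simp add: bilinear_def)
      have "met xs G (from_coord A ch xs v) =
          (\<Sum>i\<in>active_set g m xs. w (Inl i) * met xs (grad A met (g i) xs) (from_coord A ch xs v)) +
          (\<Sum>j\<in>{1..n}. w (Inr j) * met xs (grad A met (h j) xs) (from_coord A ch xs v))"
        unfolding G_def by (simp add: linear_add[OF lin] linear_sum[OF lin] linear_scale[OF lin])
      also have "\<dots> = (\<Sum>l\<in>active_index. w l * fderiv (con l) p v)"
        unfolding sum_active_index con_simps
        by (intro arg_cong2[of _ _ _ _ "(+)"] sum.cong refl)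
           (simp_all add: met_grad_from_coord[OF g3 _ ch] met_grad_from_coord[OF h3 _ ch])
      finally show ?thesis using w by simp
    qed
    then have "G = 0" by (rule met_nondegenerate[OF ch])
    then have "(\<forall>i\<in>active_set g m xs. w (Inl i) = 0) \<and> (\<forall>j\<in>{1..n}. w (Inr j) = 0)"
      using licq[unfolded LICQ_def, rule_format, of "\<lambda>i. w (Inl i)" "\<lambda>j. w (Inr j)"] unfolding G_def by blast
    then show ?thesis by (auto simp: active_index_def)
  qed
qed

end

section \<open>Quadratic convergence\<close>

lemma coord_error_ge:
  "norm (snd c x - snd c xs) \<le> coord_error m n c x \<mu> lam xs \<mu>s lams"
  "i \<in> {1..m} \<Longrightarrow> \<bar>\<mu> i - \<mu>s i\<bar> \<le> coord_error m n c x \<mu> lam xs \<mu>s lams"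
  "j \<in> {1..n} \<Longrightarrow> \<bar>lam j - lams j\<bar> \<le> coord_error m n c x \<mu> lam xs \<mu>s lams"
proof -
  have s: "0 \<le> (\<Sum>i\<in>{1..m}. (\<mu> i - \<mu>s i)\<^sup>2)" "0 \<le> (\<Sum>j\<in>{1..n}. (lam j - lams j)\<^sup>2)"
    by (auto intro: sum_nonneg)
  show "norm (snd c x - snd c xs) \<le> coord_error m n c x \<mu> lam xs \<mu>s lams"
    unfolding coord_error_def using s by (intro real_le_rsqrt) simp
  show "\<bar>\<mu> i - \<mu>s i\<bar> \<le> coord_error m n c x \<mu> lam xs \<mu>s lams" if "i \<in> {1..m}"
  proof -
    have "(\<mu> i - \<mu>s i)\<^sup>2 \<le> (\<Sum>i\<in>{1..m}. (\<mu> i - \<mu>s i)\<^sup>2)" using that by (intro member_le_sum) auto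
    then have "\<bar>\<mu> i - \<mu>s i\<bar>\<^sup>2 \<le> (norm (snd c x - snd c xs))\<^sup>2 +
        (\<Sum>i\<in>{1..m}. (\<mu> i - \<mu>s i)\<^sup>2) + (\<Sum>j\<in>{1..n}. (lam j - lams j)\<^sup>2)"
      unfolding power2_abs using s zero_le_power2[of "norm (snd c x - snd c xs)"] by linarith
    then show ?thesis unfolding coord_error_def by (rule real_le_rsqrt)
  qed
  show "\<bar>lam j - lams j\<bar> \<le> coord_error m n c x \<mu> lam xs \<mu>s lams" if "j \<in> {1..n}"
  proof -
    have "(lam j - lams j)\<^sup>2 \<le> (\<Sum>j\<in>{1..n}. (lam j - lams j)\<^sup>2)" using that by (intro member_le_sum) auto
    then have "\<bar>lam j - lams j\<bar>\<^sup>2 \<le> (norm (snd c x - snd c xs))\<^sup>2 +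
        (\<Sum>i\<in>{1..m}. (\<mu> i - \<mu>s i)\<^sup>2) + (\<Sum>j\<in>{1..n}. (lam j - lams j)\<^sup>2)"
      unfolding power2_abs using s zero_le_power2[of "norm (snd c x - snd c xs)"] by linarith
    then show ?thesis unfolding coord_error_def by (rule real_le_rsqrt)
  qed
qed

lemma coord_error_nonneg: "0 \<le> coord_error m n c x \<mu> lam xs \<mu>s lams"
  by (rule order.trans[OF norm_ge_zero coord_error_ge(1)])

lemma coord_error_le:
  assumes "norm (snd c x - snd c xs) \<le> t" "\<And>i. i \<in> {1..m} \<Longrightarrow> \<bar>\<mu> i - \<mu>s i\<bar> \<le> t"
    "\<And>j. j \<in> {1..n} \<Longrightarrow> \<bar>lam j - lams j\<bar> \<le> t"
  shows "coord_error m n c x \<mu> lam xs \<mu>s lams \<le> sqrt (1 + real m + real n) * t"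
proof -
  have t: "0 \<le> t" using assms(1) norm_ge_zero order.trans by blast
  have "(norm (snd c x - snd c xs))\<^sup>2 + (\<Sum>i\<in>{1..m}. (\<mu> i - \<mu>s i)\<^sup>2) + (\<Sum>j\<in>{1..n}. (lam j - lams j)\<^sup>2)
      \<le> t\<^sup>2 + (\<Sum>i\<in>{1..m}. t\<^sup>2) + (\<Sum>j\<in>{1..n}. t\<^sup>2)"
    using assms t by (intro add_mono sum_mono) (auto intro: power_mono simp: abs_le_square_iff[symmetric])
  also have "\<dots> = (1 + real m + real n) * t\<^sup>2" by (simp add: algebra_simps)
  finally have "coord_error m n c x \<mu> lam xs \<mu>s lams \<le> sqrt ((1 + real m + real n) * t\<^sup>2)"
    unfolding coord_error_def by simp
  then show ?thesis using t by (simp add: real_sqrt_mult)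
qed

context constrained_problem begin

text \<open>One full iteration near the solution.  The lower bound on \<open>B\<close> is measured in the metric and becomes
  coercivity in coordinates because the metric is uniformly positive definite near the solution.\<close>

lemma rsqo_step:
  assumes R: "riem_retraction A R" and m0: "0 < m0" and K\<eta>: "0 \<le> K\<eta>"
  obtains \<delta> C where "0 < \<delta>" "0 \<le> C"
    "\<And>x \<mu> lam B dx \<mu>q lamq. \<lbrakk>x \<in> fst ch; coord_error m n ch x \<mu> lam xs \<mu>s lams \<le> \<delta>;
       spd_operator met x B; \<And>\<xi>. m0 * (tnorm met x \<xi>)\<^sup>2 \<le> met x (B \<xi>) \<xi>;
       B = Hess A met nab (lagrangian f g h m n \<mu> lam) x; QP_KKT A met f g h m n x B dx \<mu>q lamq;
       \<And>i. i \<in> {1..m} \<Longrightarrow> \<bar>\<mu>q i\<bar> \<le> K\<eta>; \<And>j. j \<in> {1..n} \<Longrightarrow> \<bar>lamq j\<bar> \<le> K\<eta>\<rbrakk> \<Longrightarrow>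
     R x dx \<in> fst ch \<and>
     coord_error m n ch (R x dx) \<mu>q lamq xs \<mu>s lams \<le> C * (coord_error m n ch x \<mu> lam xs \<mu>s lams)\<^sup>2"
proof -
  interpret nlp: chart_nlp \<Omega> p obj con con_index active_index eq_index "case_sum \<mu>s lams" by (rule chart_nlp)
  obtain K\<Gamma> \<Gamma> where K\<Gamma>: "K\<Gamma> \<ge> 0" and hess: "\<forall>\<^sub>F y in nhds p. hessian_expansion ch K\<Gamma> (\<Gamma> y) y"
    using hessian_in_chart[OF ch(1) p_in] by blast
  obtain mg where mg: "mg > 0" "\<forall>\<^sub>F y in nhds p. \<forall>u. mg * (norm u)\<^sup>2 \<le> gram ch y u u"
    using locally_uniformly_coercive[OF chart_open(2)[OF ch(1)] p_in gram_bilinear[OF ch(1)] gram_pos[OF ch(1) p_in]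
        Ck_on_imp_continuous[OF gram_smooth[OF ch(1)]]] by blast
  from hess mg(2) have "\<forall>\<^sub>F y in nhds p. hessian_expansion ch K\<Gamma> (\<Gamma> y) y \<and> (\<forall>u. mg * (norm u)\<^sup>2 \<le> gram ch y u u)"
    by eventually_elim blast
  then obtain \<delta>1 where \<delta>1: "\<delta>1 > 0" and near: "\<And>y. dist y p < \<delta>1 \<Longrightarrow>
      hessian_expansion ch K\<Gamma> (\<Gamma> y) y \<and> (\<forall>u. mg * (norm u)\<^sup>2 \<le> gram ch y u u)"
    unfolding eventually_nhds_metric by blast
  have as: "nlp.abs_sum \<ge> 0" unfolding nlp.abs_sum_def by (intro sum_nonneg) auto
  obtain \<delta>2 C2 where \<delta>2: "0 < \<delta>2" "0 \<le> C2"
    and step: "\<forall>e y \<eta> \<eta>q d H \<Gamma>. nlp.newton_step (m0 * mg) K\<Gamma> (K\<eta> + nlp.abs_sum) e y \<eta> \<eta>q d H \<Gamma> \<longrightarrow> e \<le> \<delta>2 \<longrightarrow>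
      norm d \<le> C2 * e \<and> norm (y - p + d) \<le> C2 * e\<^sup>2 \<and> (\<forall>l\<in>con_index. \<bar>\<eta>q l - case_sum \<mu>s lams l\<bar> \<le> C2 * e\<^sup>2)"
    using nlp.newton_step_quadratic[of "m0 * mg" K\<Gamma> "K\<eta> + nlp.abs_sum"] m0 mg K\<Gamma> K\<eta> as by auto
  show thesis
  proof (rule retraction_in_chart[OF R ch(1) p_in])
    fix \<delta>R KR :: real
    assume \<delta>R: "0 < \<delta>R" "0 \<le> KR" and retr: "\<And>y w. norm (y - p) < \<delta>R \<Longrightarrow> norm w < \<delta>R \<Longrightarrow> y \<in> \<Omega> \<Longrightarrow>
       R (chart_inv ch y) (from_coord A ch (chart_inv ch y) w) \<in> fst ch \<and>
       norm (snd ch (R (chart_inv ch y) (from_coord A ch (chart_inv ch y) w)) - (y + w)) \<le> KR * (norm w)\<^sup>2"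
    define \<delta> where "\<delta> = Min {\<delta>1 / 2, \<delta>2, \<delta>R / 2, \<delta>R / (2 * (C2 + 1))}"
    have \<delta>: "0 < \<delta>" unfolding \<delta>_def using \<delta>1 \<delta>2 \<delta>R by simp
    have \<delta>le: "\<delta> \<le> \<delta>1 / 2" "\<delta> \<le> \<delta>2" "\<delta> \<le> \<delta>R / 2" "\<delta> \<le> \<delta>R / (2 * (C2 + 1))"
      unfolding \<delta>_def by (intro Min_le; simp)+
    define Cq where "Cq = KR * C2\<^sup>2 + C2"
    have Cq: "C2 \<le> Cq" "0 \<le> Cq" unfolding Cq_def using \<delta>R \<delta>2 by simp_all
    show thesis
    proof (rule that[OF \<delta>, of "sqrt (1 + real m + real n) * Cq"])
      show "0 \<le> sqrt (1 + real m + real n) * Cq" using Cq by simp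
      fix x \<mu> lam B dx \<mu>q lamq
      define e where "e = coord_error m n ch x \<mu> lam xs \<mu>s lams"
      assume x: "x \<in> fst ch" and e\<delta>': "coord_error m n ch x \<mu> lam xs \<mu>s lams \<le> \<delta>"
        and spd: "spd_operator met x B" and Bm: "\<And>\<xi>. m0 * (tnorm met x \<xi>)\<^sup>2 \<le> met x (B \<xi>) \<xi>"
        and B: "B = Hess A met nab (lagrangian f g h m n \<mu> lam) x"
        and qp: "QP_KKT A met f g h m n x B dx \<mu>q lamq"
        and bq: "\<And>i. i \<in> {1..m} \<Longrightarrow> \<bar>\<mu>q i\<bar> \<le> K\<eta>" "\<And>j. j \<in> {1..n} \<Longrightarrow> \<bar>lamq j\<bar> \<le> K\<eta>"
      define y where "y = snd ch x"
      define d where "d = to_coord A ch x dx"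
      note e\<delta> = e\<delta>'[folded e_def]
      have e0: "0 \<le> e" unfolding e_def by (rule coord_error_nonneg)
      have y: "y \<in> \<Omega>" "chart_inv ch y = x" using x ch by (auto simp: y_def chart_inv_left)
      have dx: "from_coord A ch x d = dx" unfolding d_def by (rule from_to_coord[OF ch(1) x])
      have ye: "norm (y - p) \<le> e" unfolding y_def e_def by (rule coord_error_ge)
      have "dist y p < \<delta>1" using ye e\<delta> \<delta>le(1) \<delta>1 by (simp add: dist_norm)
      note nr = near[OF this, unfolded hessian_expansion_def y(2)]
      define H where "H u v = met x (B (from_coord A ch x u)) (from_coord A ch x v)" for u v
      have linB: "linear B" using spd by (simp add: spd_operator_def)
      note linf = linear_from_coord[OF ch(1) x]
      have grd: "met x (grad A met \<theta> x) (from_coord A ch x v) = fderiv (\<lambda>y. \<theta> (chart_inv ch y)) y v"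
        if "Ck_fun A 2 \<theta>" for \<theta> v
        using met_grad_from_coord[OF that _ ch(1) x] by (simp add: y_def)
      have st: "H d \<xi> + lagr_deriv (case_sum \<mu>q lamq) y \<xi> = 0" for \<xi>
      proof -
        let ?\<xi> = "from_coord A ch x \<xi>"
        have lin: "linear (\<lambda>u. met x u ?\<xi>)" using met_bilinear by (simp add: bilinear_def)
        have "0 = met x (B dx + grad A met f x + (\<Sum>i\<in>{1..m}. \<mu>q i *\<^sub>R grad A met (g i) x)
            + (\<Sum>j\<in>{1..n}. lamq j *\<^sub>R grad A met (h j) x)) ?\<xi>"
          using qp unfolding QP_KKT_def by (simp add: bilinear_lzero[OF met_bilinear])
        also have "\<dots> = met x (B dx) ?\<xi> + met x (grad A met f x) ?\<xi>
            + (\<Sum>i\<in>{1..m}. \<mu>q i * met x (grad A met (g i) x) ?\<xi>)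
            + (\<Sum>j\<in>{1..n}. lamq j * met x (grad A met (h j) x) ?\<xi>)"
          by (simp add: linear_add[OF lin] linear_sum[OF lin] linear_scale[OF lin])
        also have "\<dots> = H d \<xi> + lagr_deriv (case_sum \<mu>q lamq) y \<xi>"
          unfolding lagr_deriv_def sum_con_index con_simps H_def dx obj_def[abs_def] using g2 h2 by (simp add: grd f2)
        finally show ?thesis by simp
      qed
      have lg: "g i x + met x (grad A met (g i) x) dx = con (Inl i) y + fderiv (con (Inl i)) y d" if "i \<in> {1..m}" for i
        unfolding con_simps y(2) using grd[OF g2[OF that], of d] dx by simp
      have lh: "h j x + met x (grad A met (h j) x) dx = con (Inr j) y + fderiv (con (Inr j)) y d" if "j \<in> {1..n}" for j
        unfolding con_simps y(2) using grd[OF h2[OF that], of d] dx by simp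
      have "nlp.newton_step (m0 * mg) K\<Gamma> (K\<eta> + nlp.abs_sum) e y (case_sum \<mu> lam) (case_sum \<mu>q lamq) d H (\<Gamma> y)"
        unfolding nlp.newton_step_def
      proof (intro conjI ballI allI)
        show "norm (y - p) \<le> e" by (rule ye)
        show "\<bar>case_sum \<mu> lam l - case_sum \<mu>s lams l\<bar> \<le> e" if "l \<in> con_index" for l
          using that unfolding con_index_def e_def by (elim PlusE) (simp_all add: coord_error_ge)
        show "\<bar>case_sum \<mu>q lamq l - case_sum \<mu>s lams l\<bar> \<le> K\<eta> + nlp.abs_sum" if l: "l \<in> con_index" for l
        proof -
          have "\<bar>case_sum \<mu>s lams l\<bar> \<le> nlp.abs_sum"
            unfolding nlp.abs_sum_def using l by (intro member_le_sum) (auto simp: con_index_def)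
          moreover have "\<bar>case_sum \<mu>q lamq l\<bar> \<le> K\<eta>"
            using l bq unfolding con_index_def by (elim PlusE) simp_all
          ultimately show ?thesis by linarith
        qed
        show "norm (\<Gamma> y u v) \<le> K\<Gamma> * norm u * norm v" for u v using nr by blast
        show "H u v = nlp.D2L (case_sum \<mu> lam) y u v - nlp.DL (case_sum \<mu> lam) y (\<Gamma> y u v)" for u v
        proof -
          have "H u v = fderiv2 (\<lambda>z. lagrangian f g h m n \<mu> lam (chart_inv ch z)) y u v
              - fderiv (\<lambda>z. lagrangian f g h m n \<mu> lam (chart_inv ch z)) y (\<Gamma> y u v)"
            unfolding H_def B using nr lagrangian_C2 by blast
          then show ?thesis
            unfolding fderiv_fderiv_lagrangian[OF y(1)] fderiv_lagrangian[OF y(1)]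
            by (simp add: nlp.D2L_def nlp.DL_def lagr_deriv_def)
        qed
        show "H (u + v) w = H u w + H v w" for u v w
          unfolding H_def by (simp add: linear_add[OF linf] linear_add[OF linB] bilinear_ladd[OF met_bilinear])
        show "m0 * mg * (norm u)\<^sup>2 \<le> H u u" for u
        proof -
          have "m0 * (mg * (norm u)\<^sup>2) \<le> m0 * gram ch y u u" using nr m0 by (intro mult_left_mono) auto
          also have "gram ch y u u = (tnorm met x (from_coord A ch x u))\<^sup>2"
            unfolding gram_def y(2) tnorm_def
            using met_pos[of "from_coord A ch x u" x] bilinear_lzero[OF met_bilinear, of x]
            by (cases "from_coord A ch x u = 0") auto
          also have "m0 * \<dots> \<le> H u u" unfolding H_def by (rule Bm)
          finally show ?thesis by (simp add: mult.assoc)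
        qed
        show "H d \<xi> + nlp.DL (case_sum \<mu>q lamq) y \<xi> = 0" for \<xi>
          using st[of \<xi>] by (simp add: nlp.DL_def lagr_deriv_def)
        show "con l y + fderiv (con l) y d = 0" if "l \<in> eq_index" for l
          using that qp lh unfolding eq_index_def QP_KKT_def QP_feasible_set_def by auto
        fix l assume "l \<in> con_index - eq_index"
        then obtain i where i: "l = Inl i" "i \<in> {1..m}" by (auto simp: con_index_def eq_index_def)
        have qi: "g i x + met x (grad A met (g i) x) dx \<le> 0" "0 \<le> \<mu>q i"
          "\<mu>q i * (g i x + met x (grad A met (g i) x) dx) = 0"
          using qp i(2) unfolding QP_KKT_def QP_feasible_set_def by blast+
        then show "con l y + fderiv (con l) y d \<le> 0" "0 \<le> case_sum \<mu>q lamq l"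
          "case_sum \<mu>q lamq l * (con l y + fderiv (con l) y d) = 0"
          unfolding i(1) lg[OF i(2)] by simp_all
      qed
      moreover have "e \<le> \<delta>2" using e\<delta> \<delta>le by linarith
      ultimately have "norm d \<le> C2 * e \<and> norm (y - p + d) \<le> C2 * e\<^sup>2 \<and>
          (\<forall>l\<in>con_index. \<bar>case_sum \<mu>q lamq l - case_sum \<mu>s lams l\<bar> \<le> C2 * e\<^sup>2)"
        using step by blast
      then have dC: "norm d \<le> C2 * e" and zd: "norm (y - p + d) \<le> C2 * e\<^sup>2"
        and \<eta>C: "\<And>l. l \<in> con_index \<Longrightarrow> \<bar>case_sum \<mu>q lamq l - case_sum \<mu>s lams l\<bar> \<le> C2 * e\<^sup>2" by blast+
      have "C2 * e \<le> C2 * (\<delta>R / (2 * (C2 + 1)))" using e\<delta> \<delta>le(4) \<delta>2 by (intro mult_left_mono) auto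
      also have "\<dots> < \<delta>R" using \<delta>2(2) \<delta>R(1) by (simp add: field_simps add_nonneg_pos)
      finally have dR: "norm d < \<delta>R" using dC by linarith
      have "norm (y - p) < \<delta>R" using ye e\<delta> \<delta>le(3) \<delta>R(1) by linarith
      from retr[OF this dR y(1)] have rx: "R x dx \<in> fst ch" and
        rn: "norm (snd ch (R x dx) - (y + d)) \<le> KR * (norm d)\<^sup>2" by (auto simp: y(2) dx)
      have "norm (snd ch (R x dx) - p) \<le> norm (snd ch (R x dx) - (y + d)) + norm (y - p + d)"
        using norm_triangle_ineq[of "snd ch (R x dx) - (y + d)" "y - p + d"] by (simp add: algebra_simps)
      also have "\<dots> \<le> KR * (C2 * e)\<^sup>2 + C2 * e\<^sup>2"
        using rn zd dC \<delta>R(2) by (intro add_mono order.trans[OF rn] mult_left_mono power_mono) auto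
      also have "\<dots> = Cq * e\<^sup>2" unfolding Cq_def by (simp add: algebra_simps power_mult_distrib)
      finally have "norm (snd ch (R x dx) - p) \<le> Cq * e\<^sup>2" .
      moreover have "C2 * e\<^sup>2 \<le> Cq * e\<^sup>2" using Cq by (intro mult_right_mono) auto
      then have "\<bar>\<mu>q i - \<mu>s i\<bar> \<le> Cq * e\<^sup>2" if "i \<in> {1..m}" for i
        using \<eta>C[of "Inl i"] InlI[OF that, of "{1..n}"] unfolding con_index_def by simp
      moreover have "\<bar>lamq j - lams j\<bar> \<le> Cq * e\<^sup>2" if "j \<in> {1..n}" for j
        using \<eta>C[of "Inr j"] InrI[OF that, of "{1..m}"] \<open>C2 * e\<^sup>2 \<le> Cq * e\<^sup>2\<close>
        unfolding con_index_def by simp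
      ultimately have "coord_error m n ch (R x dx) \<mu>q lamq xs \<mu>s lams \<le> sqrt (1 + real m + real n) * (Cq * e\<^sup>2)"
        by (rule coord_error_le)
      then show "R x dx \<in> fst ch \<and> coord_error m n ch (R x dx) \<mu>q lamq xs \<mu>s lams
          \<le> sqrt (1 + real m + real n) * Cq * (coord_error m n ch x \<mu> lam xs \<mu>s lams)\<^sup>2"
        using rx by (simp add: e_def mult.assoc)
    qed
  qed
qed

end

theorem theorem3p14:
  fixes A :: "('p::{t2_space,second_countable_topology}, 'e::euclidean_space) chart set"
    and met :: "'p \<Rightarrow> 'e \<Rightarrow> 'e \<Rightarrow> real"
    and nab :: "'p \<Rightarrow> 'e \<Rightarrow> ('p \<Rightarrow> 'e) \<Rightarrow> 'e"
    and f :: "'p \<Rightarrow> real" and g h :: "nat \<Rightarrow> 'p \<Rightarrow> real" and m n :: nat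
    and R :: "'p \<Rightarrow> 'e \<Rightarrow> 'p" and \<epsilon> \<rho>\<^sub>i \<beta> \<gamma> :: real
    and B :: "nat \<Rightarrow> 'e \<Rightarrow> 'e" and dx :: "nat \<Rightarrow> 'e"
    and \<mu>q lamq :: "nat \<Rightarrow> nat \<Rightarrow> real" and \<rho> \<alpha> :: "nat \<Rightarrow> real"
    and x :: "nat \<Rightarrow> 'p" and \<mu> lam :: "nat \<Rightarrow> nat \<Rightarrow> real"
    and xs :: 'p and \<mu>s lams :: "nat \<Rightarrow> real"
    and m0 M0 :: real and K0 :: nat
  assumes manifold: "connected_complete_riemannian_manifold A met"
    and connection: "levi_civita A met nab"
    and C2: "Ck_fun A 2 f" "\<forall>i\<in>{1..m}. Ck_fun A 2 (g i)" "\<forall>j\<in>{1..n}. Ck_fun A 2 (h j)"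
    and retraction: "riem_retraction A R"
    and params: "\<epsilon> > 0" "\<rho>\<^sub>i > 0" "0 < \<beta>" "\<beta> < 1" "0 < \<gamma>" "\<gamma> < 1"
    and RSQO: "RSQO_sequence A met f g h m n R \<epsilon> \<rho>\<^sub>i \<beta> \<gamma> B dx \<mu>q lamq \<rho> \<alpha> x \<mu> lam"
    and accumulation: "accumulation_point m n x \<mu> lam xs \<mu>s lams"
    and A1: "\<forall>k. QP_feasible_set A met g h m n (x k) \<noteq> {}"
    and A2: "m0 > 0" "M0 > 0"
      "\<forall>k \<xi>. m0 * (tnorm met (x k) \<xi>)\<^sup>2 \<le> met (x k) (B k \<xi>) \<xi> \<and>
             met (x k) (B k \<xi>) \<xi> \<le> M0 * (tnorm met (x k) \<xi>)\<^sup>2"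
    and A3: "bounded_iterates A met m n x \<mu> lam"
    and B1: "LICQ A met g h m n xs" "SOSC A met nab f g h m n xs \<mu>s lams"
      "strict_complementarity g m xs \<mu>s"
    and B2: "Ck_fun A 3 f" "\<forall>i\<in>active_set g m xs. Ck_fun A 3 (g i)" "\<forall>j\<in>{1..n}. Ck_fun A 3 (h j)"
    and B3: "\<forall>k\<ge>K0. B k = Hess A met nab (lagrangian f g h m n (\<mu> k) (lam k)) (x k)"
    and B4: "\<forall>k\<ge>K0. \<alpha> k = 1"
  shows "converges_quadratically A m n x \<mu> lam xs \<mu>s lams"
proof -
  interpret levi_civita_connection A met nab
    using manifold connection unfolding connected_complete_riemannian_manifold_def
    by unfold_locales blast+
  define c where "c = chart_at A xs"
  have c: "c \<in> A" "xs \<in> fst c" unfolding c_def by (rule chart_at)+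
  interpret constrained_problem A met nab f g h m n xs \<mu>s lams c
    using C2(2) B1(1,3) B2 c B1(2)[unfolded SOSC_def, THEN conjunct1] by unfold_locales blast+
  define err where "err k = coord_error m n c (x k) (\<mu> k) (lam k) xs \<mu>s lams" for k
  have err0: "0 \<le> err k" for k unfolding err_def by (rule coord_error_nonneg)
  obtain C0 where C0: "\<And>k. L2_set (\<mu> k) {1..m} \<le> C0 \<and> L2_set (lam k) {1..n} \<le> C0"
    using A3 unfolding bounded_iterates_def by blast
  have bd: "\<bar>\<mu> k i\<bar> \<le> C0" if "i \<in> {1..m}" for k i
    using member_le_L2_set[of "{1..m}" i "\<lambda>i. \<bar>\<mu> k i\<bar>"] C0[of k] that by (simp add: L2_set_def)
  have bdl: "\<bar>lam k j\<bar> \<le> C0" if "j \<in> {1..n}" for k j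
    using member_le_L2_set[of "{1..n}" j "\<lambda>j. \<bar>lam k j\<bar>"] C0[of k] that by (simp add: L2_set_def)
  have C00: "0 \<le> C0" using C0[of 0] L2_set_nonneg order.trans by blast
  note it = RSQO[unfolded RSQO_sequence_def, rule_format]
  show ?thesis
  proof (rule rsqo_step[OF retraction A2(1) C00])
    fix \<delta> C
    assume \<delta>: "0 < \<delta>" and Cpos: "0 \<le> C" and step: "\<And>x \<mu> lam B dx \<mu>q lamq. \<lbrakk>x \<in> fst c; coord_error m n c x \<mu> lam xs \<mu>s lams \<le> \<delta>;
       spd_operator met x B; \<And>\<xi>. m0 * (tnorm met x \<xi>)\<^sup>2 \<le> met x (B \<xi>) \<xi>;
       B = Hess A met nab (lagrangian f g h m n \<mu> lam) x; QP_KKT A met f g h m n x B dx \<mu>q lamq;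
       \<And>i. i \<in> {1..m} \<Longrightarrow> \<bar>\<mu>q i\<bar> \<le> C0; \<And>j. j \<in> {1..n} \<Longrightarrow> \<bar>lamq j\<bar> \<le> C0\<rbrakk> \<Longrightarrow>
     R x dx \<in> fst c \<and>
     coord_error m n c (R x dx) \<mu>q lamq xs \<mu>s lams \<le> C * (coord_error m n c x \<mu> lam xs \<mu>s lams)\<^sup>2"
    have next_iterate: "x (Suc k) \<in> fst c \<and> err (Suc k) \<le> C * (err k)\<^sup>2"
      if k: "K0 \<le> k" "x k \<in> fst c" "err k \<le> \<delta>" for k
    proof -
      have mq: "\<mu> (Suc k) i = \<mu>q k i" if "i \<in> {1..m}" for i using it[of k] that by blast
      have lq: "lam (Suc k) j = lamq k j" if "j \<in> {1..n}" for j using it[of k] that by blast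
      have xk: "x (Suc k) = R (x k) (dx k)" using it[of k] B4 k(1) by simp
      have "R (x k) (dx k) \<in> fst c \<and> coord_error m n c (R (x k) (dx k)) (\<mu>q k) (lamq k) xs \<mu>s lams
          \<le> C * (coord_error m n c (x k) (\<mu> k) (lam k) xs \<mu>s lams)\<^sup>2"
      proof (rule step)
        show "x k \<in> fst c" by fact
        show "coord_error m n c (x k) (\<mu> k) (lam k) xs \<mu>s lams \<le> \<delta>" using k(3) by (simp add: err_def)
        show "spd_operator met (x k) (B k)" using it[of k] by blast
        show "m0 * (tnorm met (x k) \<xi>)\<^sup>2 \<le> met (x k) (B k \<xi>) \<xi>" for \<xi> using A2(3) by blast
        show "B k = Hess A met nab (lagrangian f g h m n (\<mu> k) (lam k)) (x k)" using B3 k(1) by blast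
        show "QP_KKT A met f g h m n (x k) (B k) (dx k) (\<mu>q k) (lamq k)" using it[of k] by blast
        show "\<bar>\<mu>q k i\<bar> \<le> C0" if "i \<in> {1..m}" for i using bd[OF that, of "Suc k"] mq[OF that] by simp
        show "\<bar>lamq k j\<bar> \<le> C0" if "j \<in> {1..n}" for j using bdl[OF that, of "Suc k"] lq[OF that] by simp
      qed
      then show ?thesis using mq lq xk by (simp add: err_def coord_error_def)
    qed
    \<comment> \<open>Within \<open>\<delta>'\<close> the quadratic bound at least halves the
      error, so the iterates cannot leave.\<close>
    define \<delta>' where "\<delta>' = min \<delta> (1 / (2 * (C + 1)))"
    have \<delta>': "0 < \<delta>'" "\<delta>' \<le> \<delta>" "C * \<delta>' \<le> 1 / 2"
    proof -
      show "0 < \<delta>'" "\<delta>' \<le> \<delta>" unfolding \<delta>'_def using \<delta> Cpos by auto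
      have "C * \<delta>' \<le> C * (1 / (2 * (C + 1)))" unfolding \<delta>'_def using Cpos by (intro mult_left_mono) auto
      also have "\<dots> \<le> 1 / 2" using Cpos by (simp add: field_simps)
      finally show "C * \<delta>' \<le> 1 / 2" .
    qed
    \<comment> \<open>The accumulation point makes the iterates enter this neighbourhood after
      index \<open>K0\<close>.\<close>
    obtain k0 where k0: "K0 \<le> k0" "x k0 \<in> fst c" "err k0 \<le> \<delta>'"
    proof -
      obtain r where r: "strict_mono r" and lim: "(x \<circ> r) \<longlonglongrightarrow> xs"
        "\<And>i. i \<in> {1..m} \<Longrightarrow> (\<lambda>k. (\<mu> \<circ> r) k i) \<longlonglongrightarrow> \<mu>s i" "\<And>j. j \<in> {1..n} \<Longrightarrow> (\<lambda>k. (lam \<circ> r) k j) \<longlonglongrightarrow> lams j"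
        using accumulation unfolding accumulation_point_def iterates_converge_def by blast
      have inU: "\<forall>\<^sub>F k in sequentially. (x \<circ> r) k \<in> fst c"
        using lim(1) chart_open(1)[OF c(1)] c(2) by (rule topological_tendstoD)
      have "isCont (snd c) xs"
        using chart_continuous(1)[OF c(1)] chart_open(1)[OF c(1)] c(2) by (simp add: continuous_on_eq_continuous_at)
      then have cx: "(\<lambda>k. snd c ((x \<circ> r) k)) \<longlonglongrightarrow> snd c xs" using lim(1) by (rule isCont_tendsto_compose)
      have "(\<lambda>k. err (r k)) \<longlonglongrightarrow> sqrt ((norm (snd c xs - snd c xs))\<^sup>2 + (\<Sum>i\<in>{1..m}. (\<mu>s i - \<mu>s i)\<^sup>2) + (\<Sum>j\<in>{1..n}. (lams j - lams j)\<^sup>2))"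
        unfolding err_def coord_error_def using cx lim(2,3)
        by (intro tendsto_real_sqrt tendsto_add tendsto_power tendsto_norm tendsto_diff tendsto_sum tendsto_const)
           (simp_all add: o_def)
      then have "(\<lambda>k. err (r k)) \<longlonglongrightarrow> 0" by simp
      then have "\<forall>\<^sub>F k in sequentially. err (r k) < \<delta>'" using \<delta>'(1) by (rule order_tendstoD)
      moreover have "\<forall>\<^sub>F k in sequentially. K0 \<le> k" by (rule eventually_ge_at_top)
      ultimately have "\<forall>\<^sub>F k in sequentially. (x \<circ> r) k \<in> fst c \<and> err (r k) < \<delta>' \<and> K0 \<le> k"
        using inU by eventually_elim auto
      then obtain k where "(x \<circ> r) k \<in> fst c" "err (r k) < \<delta>'" "K0 \<le> k"
        using eventually_happens'[OF sequentially_bot] by blast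
      then show thesis using that[of "r k"] seq_suble[OF r, of k] by (auto simp: less_imp_le)
    qed
    \<comment> \<open>Hence the whole sequence stays, and its errors decay geometrically.\<close>
    have geo: "x (k0 + i) \<in> fst c \<and> err (k0 + i) \<le> \<delta>' * (1 / 2) ^ i" for i
    proof (induction i)
      case 0
      then show ?case using k0 by simp
    next
      case (Suc i)
      have "\<delta>' * (1 / 2) ^ i \<le> \<delta>' * 1" using \<delta>' by (intro mult_left_mono power_le_one) auto
      then have le: "err (k0 + i) \<le> \<delta>'" using Suc by linarith
      have nx: "x (Suc (k0 + i)) \<in> fst c" "err (Suc (k0 + i)) \<le> C * (err (k0 + i))\<^sup>2"
        using next_iterate[of "k0 + i"] Suc k0 le \<delta>'(2) by auto
      have "C * (err (k0 + i))\<^sup>2 = (C * err (k0 + i)) * err (k0 + i)" by (simp add: power2_eq_square)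
      also have "\<dots> \<le> (1 / 2) * err (k0 + i)"
        using mult_left_mono[OF le Cpos] \<delta>'(3) err0 by (intro mult_right_mono) auto
      also have "\<dots> \<le> (1 / 2) * (\<delta>' * (1 / 2) ^ i)" using Suc by (intro mult_left_mono) auto
      finally show ?case using nx by simp
    qed
    have near: "x k \<in> fst c \<and> err k \<le> \<delta>' * (1 / 2) ^ (k - k0)" if "k0 \<le> k" for k
      using geo[of "k - k0"] that by simp
    have quad: "err (Suc k) \<le> C * (err k)\<^sup>2" if "k0 \<le> k" for k
    proof -
      have "\<delta>' * (1 / 2) ^ (k - k0) \<le> \<delta>' * 1" using \<delta>' by (intro mult_left_mono power_le_one) auto
      then show ?thesis using near[OF that] next_iterate[of k] k0(1) that \<delta>'(2) by auto
    qed
    have "(\<lambda>k. err (k + k0)) \<longlonglongrightarrow> 0"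
    proof (rule tendsto_sandwich[of "\<lambda>_. 0" _ _ "\<lambda>k. \<delta>' * (1 / 2) ^ k"])
      show "\<forall>\<^sub>F k in sequentially. err (k + k0) \<le> \<delta>' * (1 / 2) ^ k"
        using geo by (simp add: add.commute)
      show "(\<lambda>k. \<delta>' * (1 / 2) ^ k) \<longlonglongrightarrow> 0"
        by (rule tendsto_mult_right_zero) (simp add: LIMSEQ_power_zero)
    qed (use err0 in auto)
    then have lim: "err \<longlonglongrightarrow> 0" by (rule LIMSEQ_offset)
    have lim\<mu>: "(\<lambda>k. \<mu> k i) \<longlonglongrightarrow> \<mu>s i" if "i \<in> {1..m}" for i
      by (rule LIM_zero_cancel, rule Lim_null_comparison[OF always_eventually lim])
         (simp add: err_def coord_error_ge(2)[OF that])
    have liml: "(\<lambda>k. lam k j) \<longlonglongrightarrow> lams j" if "j \<in> {1..n}" for j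
      by (rule LIM_zero_cancel, rule Lim_null_comparison[OF always_eventually lim])
         (simp add: err_def coord_error_ge(3)[OF that])
    have limy: "(\<lambda>k. snd c (x k)) \<longlonglongrightarrow> snd c xs"
      by (rule LIM_zero_cancel, rule Lim_null_comparison[OF always_eventually lim])
         (simp add: err_def coord_error_ge(1))
    have "isCont (chart_inv c) (snd c xs)"
      using chart_continuous(2)[OF c(1)] chart_open(2)[OF c(1)] c(2) by (simp add: continuous_on_eq_continuous_at)
    then have "(\<lambda>k. chart_inv c (snd c (x k))) \<longlonglongrightarrow> chart_inv c (snd c xs)"
      using limy by (rule isCont_tendsto_compose)
    moreover have "\<forall>\<^sub>F k in sequentially. chart_inv c (snd c (x k)) = x k"
      using eventually_ge_at_top[of k0] by eventually_elim (use near c in \<open>auto simp: chart_inv_left\<close>)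
    ultimately have limx: "x \<longlonglongrightarrow> xs"
      using c by (simp add: chart_inv_left tendsto_cong)
    have "\<forall>\<^sub>F k in sequentially. err (Suc k) \<le> C * (err k)\<^sup>2"
      using eventually_ge_at_top[of k0] by eventually_elim (rule quad)
    then show ?thesis
      unfolding converges_quadratically_def iterates_converge_def
      using limx lim\<mu> liml c Cpos unfolding err_def by blast
  qed
qed

end
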